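(* Let $V$ be a vertex operator superalgebra, and let $g,h$ be commuting finite-order automorphisms of $V$. Let $S\in\mathcal C(g,h)$ and $\gamma=\begin{pmatrix}a&b\\c&d\end{pmatrix}\in SL(2,\mathbb Z)$. Define $S|\gamma(v,\tau)=(c\tau+d)^{-k}S(v,\gamma\tau)$ for $v\in V_{[k]}$, and extend linearly in $v\in V$ (and to $V(\cdot,\cdot)$ via property (2) of 1-point functions). Then $S|\gamma\in\mathcal C((g,h)\gamma)$, where $(g,h)\gamma=(g^ah^c,g^bh^d)$.
   Context: A vertex operator superalgebra (VOSA) $V=V_{\bar0}\oplus V_{\bar1}$ has the following structure. - Vertex operators $Y(v,z)=\sum v(n)z^{-n-1}$, vacuum $\mathbf1$, and conformal vector $\omega$ (Virasoro, central charge $c$). - The super Jacobi identity holds with sign $(-1)^{\tilde u\tilde v}$. - $V=\bigoplus_{n\in\frac12\mathbb Z}V_n$ by $L(0)$-weight, with $V_{\bar0}$ integral and $V_{\bar1}$ half-integral weights. $\sigma$ is the parity automorphism, and $\epsilon_v=(-1)^{\tilde v}$. $Y[v,z]=Y(v,e^z-1)e^{z\,\mathrm{wt}v}=\sum v[n]z^{-n-1}$. $\tilde\omega=\omega-\frac c{24}\mathbf1$ and $Y[\tilde\omega,z]=\sum L[n]z^{-n-2}$. $V_{[k]}$ is the $L[0]$-eigenspace of eigenvalue $k$. Modular objects. $q=e^{2\pi i\tau}$ and $B_r(x)$ are the Bernoulli polynomials. $E_{2k}(\tau)=-\frac{B_{2k}(0)}{(2k)!}+\frac2{(2k-1)!}\sum_{n\ge1}\sigma_{2k-1}(n)q^n$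 for $k\ge1$. For $\mu=e^{2\pi ij/M}$ ($0\le j<M$) and a root of unity $\lambda$ with $(\mu,\lambda)\ne(1,1)$: $Q_0=-1$, and for $k\ge1$ $Q_k(\mu,\lambda,\tau)=\frac1{(k-1)!}\sum_{n\ge0}\frac{\lambda(n+j/M)^{k-1}q^{n+j/M}}{1-\lambda q^{n+j/M}}+\frac{(-1)^k}{(k-1)!}\sum_{n\ge1}\frac{\lambda^{-1}(n-j/M)^{k-1}q^{n-j/M}}{1-\lambda^{-1}q^{n-j/M}}-\frac{B_k(j/M)}{k!}$. For $g,h$ of orders $T,T_1$: $N=\mathrm{lcm}(T,T_1)$; $\Gamma(T,T_1)$ is the set of $\begin{pmatrix}a&b\\c&d\end{pmatrix}\in SL(2,\mathbb Z)$ with $a\equiv d\equiv1\bmod N$, $b\equiv0\bmod T$, $c\equiv0\bmod T_1$; $M(T,T_1)$ is the ring of holomorphic modular forms on it (containing $E_{2k}$, $k\ge2$, and the relevant $Q_k$); $V(T,T_1)=M(T,T_1)\otimes V$. $O(g,h)$ is the $M(T,T_1)$-submodule spanned, for $\mathbb Z_2$-homogeneous $v$ with $gv=\mu^{-1}v$, $hv=\lambda^{-1}v$ and any $w$, by: - $v[0]w$ and $v[-2]w+\sum_{k\ge2}(2k-1)E_{2k}\otimes v[2k-2]w$ if $(\mu,\lambda)=(1,1)$; - $v$ if $(\epsilon_v,\mu,\lambda)\ne(1,1,1)$; - $\sum_{k\ge0}Q_k(\mu,\lambda,\tau)\otimes v[k-1]w$ if $(\mu,\lambda)\ne(1,1)$.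 $\mathcal C(g,h)$ (the space of $(g,h)$ 1-point functions) consists of the maps $S:V(T,T_1)\times\mathfrak h\to\mathbb C$ such that: 1. $S(v,\tau)$ is holomorphic in $\tau$; 2. $S$ is linear in $v$ and $S(f\otimes v,\tau)=f(\tau)S(v,\tau)$ for $f\in M(T,T_1)$; 3. $S(v,\tau)=0$ for $v\in O(g,h)$; 4. for $v$ with $\sigma v=gv=hv=v$, $S(L[-2]v,\tau)=\partial S(v,\tau)+\sum_{l\ge2}E_{2l}(\tau)S(L[2l-2]v,\tau)$, where $\partial S(v,\tau)=\frac1{2\pi i}\frac{d}{d\tau}S(v,\tau)+kE_2(\tau)S(v,\tau)$ for $v\in V_{[k]}$, extended linearly. *)

theory Defs
  imports "HOL-Complex_Analysis.Complex_Analysis" "HOL-Computational_Algebra.Formal_Laurent_Series"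
begin

text \<open>Sum of all non-zero values of a function (meaningful when only finitely many are non-zero).\<close>
definition nzsum :: "('i \<Rightarrow> 'a::comm_monoid_add) \<Rightarrow> 'a" where
  "nzsum f = sum f {i. f i \<noteq> 0}"

definition dirsum :: "(complex \<Rightarrow> 'v::ab_group_add \<Rightarrow> 'v) \<Rightarrow> ('i \<Rightarrow> 'v set) \<Rightarrow> bool" where
  "dirsum sc F \<longleftrightarrow> (\<forall>i. module.subspace sc (F i)) \<and>
     (\<forall>v. v \<in> module.span sc (\<Union>i. F i)) \<and>
     (\<forall>i. F i \<inter> module.span sc (\<Union>j\<in>-{i}. F j) = {0})"

definition comp :: "(complex \<Rightarrow> 'v::ab_group_add \<Rightarrow> 'v) \<Rightarrow> ('i \<Rightarrow> 'v set) \<Rightarrow> 'i \<Rightarrow> 'v \<Rightarrow> 'v" where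
  "comp sc F i v = (THE x. x \<in> F i \<and> v - x \<in> module.span sc (\<Union>j\<in>-{i}. F j))"

definition fin_dim :: "(complex \<Rightarrow> 'v::ab_group_add \<Rightarrow> 'v) \<Rightarrow> 'v set \<Rightarrow> bool" where
  "fin_dim sc X \<longleftrightarrow> (\<exists>B. finite B \<and> X \<subseteq> module.span sc B)"

text \<open>Data: a complex vector space (type 'v with scalar multiplication sc),
  modes Y u n w = u(n)w, vacuum vac, conformal vector om, central charge c, and the
  L(0)-weight grading: Vh m is the weight space V_{m/2}.\<close>

text \<open>Parity subspaces: Vpar Vh 0 = V_{0bar} (integral weights), Vpar Vh 1 = V_{1bar}.\<close>
definition Vpar :: "(complex \<Rightarrow> 'v::ab_group_add \<Rightarrow> 'v) \<Rightarrow> (int \<Rightarrow> 'v set) \<Rightarrow> int \<Rightarrow> 'v set" where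
  "Vpar sc Vh e = module.span sc (\<Union>m\<in>{m. m mod 2 = e}. Vh m)"

definition vosa ::
  "(complex \<Rightarrow> 'v::ab_group_add \<Rightarrow> 'v) \<Rightarrow> ('v \<Rightarrow> int \<Rightarrow> 'v \<Rightarrow> 'v) \<Rightarrow> 'v \<Rightarrow> 'v \<Rightarrow> complex
     \<Rightarrow> (int \<Rightarrow> 'v set) \<Rightarrow> bool" where
  "vosa sc Y vac om c Vh \<longleftrightarrow>
     vector_space sc \<and>
     dirsum sc Vh \<and>
     (\<forall>m. fin_dim sc (Vh m)) \<and>
     (\<exists>m0. \<forall>m<m0. Vh m = {0}) \<and>
     \<comment> \<open>bilinearity of (u,w) \<mapsto> u(n)w\<close>
     (\<forall>u n. Vector_Spaces.linear sc sc (Y u n)) \<and>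
     (\<forall>w n. Vector_Spaces.linear sc sc (\<lambda>u. Y u n w)) \<and>
     \<comment> \<open>truncation\<close>
     (\<forall>u w. \<exists>N. \<forall>n\<ge>N. Y u n w = 0) \<and>
     \<comment> \<open>vacuum\<close>
     vac \<in> Vh 0 \<and>
     (\<forall>n w. Y vac n w = (if n = -1 then w else 0)) \<and>
     (\<forall>u. Y u (-1) vac = u) \<and>
     (\<forall>u n. n \<ge> 0 \<longrightarrow> Y u n vac = 0) \<and>
     \<comment> \<open>super Jacobi identity (Borcherds form) for Z2-homogeneous u, v\<close>
     (\<forall>eu ev u v w p q r. eu \<in> {0,1} \<longrightarrow> ev \<in> {0,1} \<longrightarrow>
        u \<in> Vpar sc Vh eu \<longrightarrow> v \<in> Vpar sc Vh ev \<longrightarrow>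
        (\<forall>\<^sub>F M in sequentially.
           (\<Sum>i\<le>M. sc (of_int p gchoose i) (Y (Y u (r + int i) v) (p + q - int i) w)) =
           (\<Sum>i\<le>M. sc ((-1) ^ i * (of_int r gchoose i))
               (Y u (p + r - int i) (Y v (q + int i) w)
                - sc ((-1) powi r * (-1) ^ nat (eu * ev)) (Y v (q + r - int i) (Y u (p + int i) w)))))) \<and>
     \<comment> \<open>conformal vector: L(n) = om(n+1), Virasoro relations with central charge c\<close>
     om \<in> Vh 4 \<and>
     (\<forall>m n w. Y om (m + 1) (Y om (n + 1) w) - Y om (n + 1) (Y om (m + 1) w) =
        sc (of_int (m - n)) (Y om (m + n + 1) w)
        + (if m + n = 0 then sc ((of_int m ^ 3 - of_int m) / 12 * c) w else 0)) \<and>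
     (\<forall>m v. v \<in> Vh m \<longrightarrow> Y om 1 v = sc (of_int m / 2) v) \<and>
     (\<forall>u n w. Y (Y om 0 u) n w = sc (- of_int n) (Y u (n - 1) w))"

definition vosa_aut ::
  "(complex \<Rightarrow> 'v::ab_group_add \<Rightarrow> 'v) \<Rightarrow> ('v \<Rightarrow> int \<Rightarrow> 'v \<Rightarrow> 'v) \<Rightarrow> 'v \<Rightarrow> 'v \<Rightarrow> ('v \<Rightarrow> 'v) \<Rightarrow> bool" where
  "vosa_aut sc Y vac om g \<longleftrightarrow> Vector_Spaces.linear sc sc g \<and> bij g \<and>
     (\<forall>u n w. g (Y u n w) = Y (g u) n (g w)) \<and> g vac = vac \<and> g om = om"

definition finite_order :: "('v \<Rightarrow> 'v) \<Rightarrow> bool" where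
  "finite_order g \<longleftrightarrow> (\<exists>T>0. g ^^ T = id)"

definition zpow :: "('v \<Rightarrow> 'v) \<Rightarrow> int \<Rightarrow> ('v \<Rightarrow> 'v)" where
  "zpow g a = (if a \<ge> 0 then g ^^ nat a else inv g ^^ nat (- a))"

text \<open>For homogeneous v of weight k: Y[v,z] = Y(v,e^z-1) e^{zk} = sum_m v(m) (e^z-1)^{-m-1} e^{zk};
  brc k n m is the coefficient of z^{-n-1} in (e^z-1)^{-m-1} e^{zk}.\<close>
definition brc :: "complex \<Rightarrow> int \<Rightarrow> int \<Rightarrow> complex" where
  "brc k n m = fls_nth ((fps_to_fls (fps_exp 1 - 1)) powi (- m - 1) * fps_to_fls (fps_exp k)) (- n - 1)"

definition brmode_h :: "(complex \<Rightarrow> 'v::ab_group_add \<Rightarrow> 'v) \<Rightarrow> ('v \<Rightarrow> int \<Rightarrow> 'v \<Rightarrow> 'v)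
    \<Rightarrow> complex \<Rightarrow> 'v \<Rightarrow> int \<Rightarrow> 'v \<Rightarrow> 'v" where
  "brmode_h sc Y k v n w = nzsum (\<lambda>m. sc (brc k n m) (Y v m w))"

definition brmode :: "(complex \<Rightarrow> 'v::ab_group_add \<Rightarrow> 'v) \<Rightarrow> ('v \<Rightarrow> int \<Rightarrow> 'v \<Rightarrow> 'v)
    \<Rightarrow> (int \<Rightarrow> 'v set) \<Rightarrow> 'v \<Rightarrow> int \<Rightarrow> 'v \<Rightarrow> 'v" where
  "brmode sc Y Vh v n w = nzsum (\<lambda>m. brmode_h sc Y (of_int m / 2) (comp sc Vh m v) n w)"

text \<open>L[n], where Y[om - c/24 vac, z] = sum L[n] z^{-n-2}.\<close>
definition Lbr :: "(complex \<Rightarrow> 'v::ab_group_add \<Rightarrow> 'v) \<Rightarrow> ('v \<Rightarrow> int \<Rightarrow> 'v \<Rightarrow> 'v) \<Rightarrow> 'v \<Rightarrow> 'v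
    \<Rightarrow> complex \<Rightarrow> (int \<Rightarrow> 'v set) \<Rightarrow> int \<Rightarrow> 'v \<Rightarrow> 'v" where
  "Lbr sc Y vac om c Vh n w = brmode sc Y Vh (om - sc (c / 24) vac) (n + 1) w"

definition Vbr :: "(complex \<Rightarrow> 'v::ab_group_add \<Rightarrow> 'v) \<Rightarrow> ('v \<Rightarrow> int \<Rightarrow> 'v \<Rightarrow> 'v) \<Rightarrow> 'v \<Rightarrow> 'v
    \<Rightarrow> complex \<Rightarrow> (int \<Rightarrow> 'v set) \<Rightarrow> complex \<Rightarrow> 'v set" where
  "Vbr sc Y vac om c Vh k = {v. Lbr sc Y vac om c Vh 0 v = sc k v}"

definition bernpoly :: "nat \<Rightarrow> real \<Rightarrow> real" where
  "bernpoly n x = fact n * fls_nth (fls_X * fps_to_fls (fps_exp x) / fps_to_fls (fps_exp 1 - 1)) (int n)"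

definition qpow :: "complex \<Rightarrow> real \<Rightarrow> complex" where
  "qpow \<tau> x = exp (2 * pi * \<i> * \<tau> * of_real x)"

definition divsum :: "nat \<Rightarrow> nat \<Rightarrow> nat" where
  "divsum r n = (\<Sum>d\<in>{d. d dvd n}. d ^ r)"

text \<open>Eis k = E_{2k}, k \<ge> 1.\<close>
definition Eis :: "nat \<Rightarrow> complex \<Rightarrow> complex" where
  "Eis k \<tau> = - of_real (bernpoly (2 * k) 0 / fact (2 * k))
     + 2 / fact (2 * k - 1) * (\<Sum>n. of_nat (divsum (2 * k - 1) (Suc n)) * qpow \<tau> (real (Suc n)))"

text \<open>Q k r lam tau = Q_k(mu, lam, tau) with mu = e^{2 pi i r}, r = j/M.\<close>
definition Qf :: "nat \<Rightarrow> real \<Rightarrow> complex \<Rightarrow> complex \<Rightarrow> complex" where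
  "Qf k r lam \<tau> = (if k = 0 then -1 else
      1 / fact (k - 1) * (\<Sum>n. lam * of_real ((real n + r) ^ (k - 1)) * qpow \<tau> (real n + r)
                                  / (1 - lam * qpow \<tau> (real n + r)))
    + (-1) ^ k / fact (k - 1) * (\<Sum>n. inverse lam * of_real ((real (Suc n) - r) ^ (k - 1)) * qpow \<tau> (real (Suc n) - r)
                                  / (1 - inverse lam * qpow \<tau> (real (Suc n) - r)))
    - of_real (bernpoly k r / fact k))"

definition root_of_unity :: "complex \<Rightarrow> bool" where
  "root_of_unity lam \<longleftrightarrow> (\<exists>n>0. lam ^ n = 1)"

definition upper :: "complex set" where
  "upper = {\<tau>. Im \<tau> > 0}"

text \<open>A map S : V(T,T_1) \<times> h \<rightarrow> C satisfying property 2 is determined by its restriction to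
  V = 1 \<otimes> V, via S(\<Sum> f_i \<otimes> v_i, \<tau>) = \<Sum> f_i(\<tau>) S(v_i,\<tau>). We represent S by this restriction.
  Vanishing on the M(T,T_1)-submodule O(g,h) is equivalent (by property 2) to vanishing on its
  generators, which we write out after applying S.\<close>

definition partialS :: "(complex \<Rightarrow> 'v::ab_group_add \<Rightarrow> 'v) \<Rightarrow> ('v \<Rightarrow> int \<Rightarrow> 'v \<Rightarrow> 'v) \<Rightarrow> 'v \<Rightarrow> 'v
    \<Rightarrow> complex \<Rightarrow> (int \<Rightarrow> 'v set) \<Rightarrow> ('v \<Rightarrow> complex \<Rightarrow> complex) \<Rightarrow> 'v \<Rightarrow> complex \<Rightarrow> complex" where
  "partialS sc Y vac om c Vh S v \<tau> =
     nzsum (\<lambda>k. let vk = comp sc (Vbr sc Y vac om c Vh) k v in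
        deriv (S vk) \<tau> / (2 * pi * \<i>) + k * Eis 1 \<tau> * S vk \<tau>)"

definition one_point ::
  "(complex \<Rightarrow> 'v::ab_group_add \<Rightarrow> 'v) \<Rightarrow> ('v \<Rightarrow> int \<Rightarrow> 'v \<Rightarrow> 'v) \<Rightarrow> 'v \<Rightarrow> 'v \<Rightarrow> complex
     \<Rightarrow> (int \<Rightarrow> 'v set) \<Rightarrow> ('v \<Rightarrow> 'v) \<Rightarrow> ('v \<Rightarrow> 'v) \<Rightarrow> ('v \<Rightarrow> complex \<Rightarrow> complex) \<Rightarrow> bool" where
  "one_point sc Y vac om c Vh g h S \<longleftrightarrow>
     \<comment> \<open>(1) holomorphic\<close>
     (\<forall>v. S v holomorphic_on upper) \<and>
     \<comment> \<open>(2) linear in v\<close>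
     (\<forall>\<tau>\<in>upper. Vector_Spaces.linear sc (*) (\<lambda>v. S v \<tau>)) \<and>
     \<comment> \<open>(3) vanishing on O(g,h): generators with (mu,lam) = (1,1)\<close>
     (\<forall>e v w. e \<in> {0,1} \<longrightarrow> v \<in> Vpar sc Vh e \<longrightarrow> g v = v \<longrightarrow> h v = v \<longrightarrow>
        (\<forall>\<tau>\<in>upper. S (brmode sc Y Vh v 0 w) \<tau> = 0 \<and>
           S (brmode sc Y Vh v (-2) w) \<tau>
           + nzsum (\<lambda>k::nat. if k \<ge> 2 then of_nat (2 * k - 1) * Eis k \<tau> * S (brmode sc Y Vh v (2 * int k - 2) w) \<tau> else 0) = 0)) \<and>
     \<comment> \<open>generators v with (eps_v, mu, lam) \<noteq> (1,1,1)\<close>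
     (\<forall>e v j M lam. e \<in> {0,1} \<longrightarrow> v \<in> Vpar sc Vh e \<longrightarrow> 0 < M \<longrightarrow> j < M \<longrightarrow> root_of_unity lam \<longrightarrow>
        g v = sc (inverse (exp (2 * pi * \<i> * of_nat j / of_nat M))) v \<longrightarrow> h v = sc (inverse lam) v \<longrightarrow>
        (e \<noteq> 0 \<or> j \<noteq> 0 \<or> lam \<noteq> 1) \<longrightarrow> (\<forall>\<tau>\<in>upper. S v \<tau> = 0)) \<and>
     \<comment> \<open>generators with (mu,lam) \<noteq> (1,1)\<close>
     (\<forall>e v w j M lam. e \<in> {0,1} \<longrightarrow> v \<in> Vpar sc Vh e \<longrightarrow> 0 < M \<longrightarrow> j < M \<longrightarrow> root_of_unity lam \<longrightarrow>
        g v = sc (inverse (exp (2 * pi * \<i> * of_nat j / of_nat M))) v \<longrightarrow> h v = sc (inverse lam) v \<longrightarrow>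
        (j \<noteq> 0 \<or> lam \<noteq> 1) \<longrightarrow>
        (\<forall>\<tau>\<in>upper. nzsum (\<lambda>k::nat. Qf k (real j / real M) lam \<tau> * S (brmode sc Y Vh v (int k - 1) w) \<tau>) = 0)) \<and>
     \<comment> \<open>(4)\<close>
     (\<forall>v. v \<in> Vpar sc Vh 0 \<longrightarrow> g v = v \<longrightarrow> h v = v \<longrightarrow>
        (\<forall>\<tau>\<in>upper. S (Lbr sc Y vac om c Vh (-2) v) \<tau> =
           partialS sc Y vac om c Vh S v \<tau>
           + nzsum (\<lambda>l::nat. if l \<ge> 2 then Eis l \<tau> * S (Lbr sc Y vac om c Vh (2 * int l - 2) v) \<tau> else 0)))"

definition moebius :: "int \<Rightarrow> int \<Rightarrow> int \<Rightarrow> int \<Rightarrow> complex \<Rightarrow> complex" where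
  "moebius a b c d \<tau> = (of_int a * \<tau> + of_int b) / (of_int c * \<tau> + of_int d)"

definition slash ::
  "(complex \<Rightarrow> 'v::ab_group_add \<Rightarrow> 'v) \<Rightarrow> ('v \<Rightarrow> int \<Rightarrow> 'v \<Rightarrow> 'v) \<Rightarrow> 'v \<Rightarrow> 'v \<Rightarrow> complex
     \<Rightarrow> (int \<Rightarrow> 'v set) \<Rightarrow> ('v \<Rightarrow> complex \<Rightarrow> complex) \<Rightarrow> int \<Rightarrow> int \<Rightarrow> int \<Rightarrow> int \<Rightarrow> 'v \<Rightarrow> complex \<Rightarrow> complex" where
  "slash sc Y vac om c Vh S a b cc d v \<tau> =
     nzsum (\<lambda>k. (of_int cc * \<tau> + of_int d) powr (- k)
                * S (comp sc (Vbr sc Y vac om c Vh) k v) (moebius a b cc d \<tau>))"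

end

theory Submission
  imports Defs
begin

text \<open>The series \<open>Q\<^sub>k(\<mu>, \<lambda>, \<tau>)\<close> are the Laurent coefficients at 0 of a function with a simple pole at
  each point of the lattice \<open>\<int> + \<int>\<tau>\<close> and with multipliers \<open>\<mu>\<close> and \<open>\<lambda>\<^sup>-\<^sup>1\<close> under the two periods. A modular
  substitution only changes the basis of the lattice, so Liouville's theorem identifies the
  functions attached to \<open>\<tau>\<close> and to \<open>\<gamma>\<tau>\<close> up to the scaling of z; for trivial multipliers it leaves a
  linear term, which is the anomaly of \<open>E\<^sub>2\<close>. Hence \<open>Q\<^sub>k\<close> and \<open>E\<^sub>2\<^sub>k\<close> transform with weights k and 2k.

  On the algebraic side \<open>L[0]\<close> is diagonalizable and \<open>[L[0], v[n]] = (L[0] v)[n] - (n + 1) v[n]\<close>, so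
  \<open>v[n] w\<close> has weight \<open>k + l - n - 1\<close> for v and w of weights k and l. All defining relations are
  therefore homogeneous, and each passes from \<open>\<gamma>\<tau>\<close> to \<open>\<tau>\<close> after multiplication by a power of \<open>c \<tau> + d\<close>.
  The derivative of that power in the Virasoro relation is absorbed by the anomaly of \<open>E\<^sub>2\<close>.\<close>

section \<open>Lambert series\<close>

text \<open>The kernel converges only on a strip around the real axis, so the function handed to
  Liouville has to be pieced together from translates of that strip. A rearrangement of geometric
  series makes neighbouring pieces agree on their overlaps.

  The formula for \<open>[L[0], v[n]]\<close> is obtained from the commutator formula for \<omega>
  alone. Under \<open>x = e^z - 1\<close> its binomial sums become Hasse derivatives of
  \<open>(1 + x) ln (1 + x)\<close>, and these collapse to \<open>z e^z\<close>,
  \<open>1 + z\<close> and multiples of \<open>e^(-(i - 1) z)\<close>.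

  Weights are complex eigenvalues and \<open>powr\<close> is the principal branch, which is not
  multiplicative in its base. The argument only compares terms of one relation, whose exponents
  differ by natural numbers, and such differences do not see the branch.

  The relations concern arbitrary v and w, whereas counting weights needs eigenvectors of
  \<open>L[0]\<close>. Splitting v respects parity and twist because a component is a polynomial in
  \<open>L[0]\<close> applied to v. An eigenvector of \<open>(g, h) \<gamma>\<close> is also one of
  \<open>(g, h)\<close>, with the pair of eigenvalues transformed by the inverse of \<gamma>; this
  is exactly the pair of multipliers of the kernel at \<open>\<gamma> \<tau>\<close>.\<close>

lemma sums_swap_norm:
  fixes f :: "nat \<Rightarrow> nat \<Rightarrow> complex"
  assumes "\<And>n. summable (\<lambda>k. norm (f n k))" "summable (\<lambda>n. \<Sum>k. norm (f n k))"
  shows "(\<lambda>k. \<Sum>n. f n k) sums (\<Sum>n. \<Sum>k. f n k)" "summable (\<lambda>n. f n k)"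
proof -
  have inner: "((\<lambda>k. norm (f n k)) has_sum (\<Sum>k. norm (f n k))) UNIV" for n
    using norm_summable_imp_has_sum[of "\<lambda>k. norm (f n k)"] assms(1)[of n] by (simp add: summable_sums)
  have "(\<lambda>(n,k). norm (f n k)) summable_on (UNIV \<times> UNIV)"
  proof (rule summable_on_SigmaI)
    show "(\<lambda>n. \<Sum>k. norm (f n k)) summable_on UNIV"
      by (rule norm_summable_imp_summable_on) (use assms in \<open>simp add: suminf_nonneg\<close>)
  qed (use inner in auto)
  then have abs: "(\<lambda>x. norm ((\<lambda>(n,k). f n k) x)) summable_on (UNIV \<times> UNIV)"
    by (simp add: case_prod_unfold)
  then have summ: "(\<lambda>(n,k). f n k) summable_on (UNIV \<times> UNIV)"
    using abs_summable_summable by blast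
  then obtain S where S: "((\<lambda>(n,k). f n k) has_sum S) (UNIV \<times> UNIV)" by (auto simp: summable_on_def)
  have r: "((\<lambda>k. f n k) has_sum (\<Sum>k. f n k)) UNIV" for n
    using norm_summable_imp_has_sum[of "f n"] assms(1)[of n] by (simp add: summable_sums summable_norm_cancel)
  have 1: "((\<lambda>n. \<Sum>k. f n k) has_sum S) UNIV"
    by (rule has_sum_SigmaD[OF S]) (use r in auto)
  have cols: "summable (\<lambda>n. norm (f n k))" for k
  proof (rule summable_comparison_test'[OF assms(2)])
    fix n :: nat
    have "(\<Sum>i\<in>{k}. norm (f n i)) \<le> (\<Sum>i. norm (f n i))"
      by (rule sum_le_suminf[OF assms(1)]) auto
    then show "norm (norm (f n k)) \<le> (\<Sum>k. norm (f n k))" by simp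
  qed
  then show "summable (\<lambda>n. f n k)" by (rule summable_norm_cancel)
  have c: "((\<lambda>n. f n k) has_sum (\<Sum>n. f n k)) UNIV" for k
    using norm_summable_imp_has_sum[of "\<lambda>n. f n k"] cols[of k] by (simp add: summable_sums summable_norm_cancel)
  have "((\<lambda>(k,n). f n k) has_sum S) (UNIV \<times> UNIV)"
    using S by (subst has_sum_swap) (simp add: case_prod_unfold)
  then have 2: "((\<lambda>k. \<Sum>n. f n k) has_sum S) UNIV"
    by (rule has_sum_SigmaD) (use c in auto)
  have "S = (\<Sum>n. \<Sum>k. f n k)"
    using has_sum_imp_sums[OF 1] by (simp add: sums_iff)
  then show "(\<lambda>k. \<Sum>n. f n k) sums (\<Sum>n. \<Sum>k. f n k)"
    using has_sum_imp_sums[OF 2] by simp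
qed

text \<open>Expand every exponential and interchange the sums. The double series converges
  absolutely as long as \<open>\<rho> * exp (norm t) < 1\<close>, which holds near 0. A series of
  exponentials thereby becomes the generating function of its moments.\<close>

lemma exponential_sum_expansion:
  fixes A :: "nat \<Rightarrow> complex" and s \<rho> C :: real
  assumes A: "\<And>n. norm (A n) \<le> C * \<rho> ^ n" and \<rho>: "0 \<le> \<rho>" "\<rho> < 1" and s: "0 \<le> s"
  shows "(\<lambda>t. \<Sum>n. A n * exp (of_real (real n + s) * t)) has_fps_expansion
           Abs_fps (\<lambda>k. (\<Sum>n. A n * of_real ((real n + s) ^ k)) / fact k)"
proof (rule has_fps_expansionI)
  have C: "0 \<le> C" using A[of 0] norm_ge_zero[of "A 0"] by (simp del: norm_ge_zero)
  have "((\<lambda>t. \<rho> * exp (norm t)) \<longlongrightarrow> \<rho> * exp (norm (0::complex))) (nhds (0::complex))"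
    by (intro tendsto_intros) (auto intro!: filterlim_ident)
  then have "\<forall>\<^sub>F t::complex in nhds 0. \<rho> * exp (norm t) < 1"
    by (rule order_tendstoD) (use \<rho> in simp)
  then show "\<forall>\<^sub>F t in nhds 0. (\<lambda>k. fps_nth (Abs_fps (\<lambda>k. (\<Sum>n. A n * of_real ((real n + s) ^ k)) / fact k)) k * t ^ k)
      sums (\<Sum>n. A n * exp (of_real (real n + s) * t))"
  proof eventually_elim
    case (elim t)
    define f where "f n k = A n * (of_real (real n + s) * t) ^ k / fact k" for n k
    have nf: "norm (f n k) = norm (A n) * (((real n + s) * norm t) ^ k / fact k)" for n k
      using s by (simp add: f_def norm_mult norm_divide norm_power abs_of_nonneg del: of_real_add)
    have es: "(\<lambda>k. x ^ k / fact k) sums exp x" for x :: real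
      using exp_converges[of x] by (simp add: field_simps scaleR_conv_of_real)
    have es': "(\<lambda>k. x ^ k / fact k) sums exp x" for x :: complex
      using exp_converges[of x] by (simp add: field_simps scaleR_conv_of_real)
    have s1: "(\<lambda>k. norm (f n k)) sums (norm (A n) * exp ((real n + s) * norm t))" for n
      unfolding nf by (intro sums_mult es)
    have s2: "(\<lambda>k. f n k) sums (A n * exp (of_real (real n + s) * t))" for n
      using sums_mult[OF es', of "A n" "of_real (real n + s) * t"] by (simp add: f_def)
    have bd: "norm (A n) * exp ((real n + s) * norm t) \<le> C * exp (s * norm t) * (\<rho> * exp (norm t)) ^ n" for n
    proof -
      have "norm (A n) * exp ((real n + s) * norm t) \<le> C * \<rho> ^ n * exp ((real n + s) * norm t)"
        using A by (intro mult_right_mono) auto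
      also have "\<dots> = C * exp (s * norm t) * (\<rho> * exp (norm t)) ^ n"
        by (simp add: power_mult_distrib exp_of_nat_mult [symmetric] ring_distribs exp_add)
      finally show ?thesis .
    qed
    have "summable (\<lambda>n. norm (A n) * exp ((real n + s) * norm t))"
      by (rule summable_comparison_test'[OF summable_mult[OF summable_geometric[of "\<rho> * exp (norm t)"]], of 0])
         (use bd elim \<rho> in \<open>auto simp: abs_mult\<close>)
    then have S: "summable (\<lambda>n. \<Sum>k. norm (f n k))" using s1 by (simp add: sums_iff)
    have fin: "summable (\<lambda>k. norm (f n k))" for n using s1 by (auto simp: sums_iff)
    note sw = sums_swap_norm[of f, OF fin S]
    \<comment> \<open>Summability over n is known for \<open>f n k\<close>, not directly for the
      moments. Dividing by \<open>t ^ k\<close> transfers it, so a vanishing power is treated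
      apart.\<close>
    have "(\<Sum>n. f n k) = (\<Sum>n. A n * of_real ((real n + s) ^ k)) / fact k * t ^ k" for k
    proof (cases "t ^ k = 0")
      case True
      then have "f n k = 0" for n by (auto simp: f_def power_mult_distrib)
      then show ?thesis using True by simp
    next
      case False
      then have eq: "A n * of_real ((real n + s) ^ k) = (fact k / t ^ k) * f n k" for n
        using False by (cases "k = 0") (auto simp: f_def power_mult_distrib)
      have "(\<Sum>n. A n * of_real ((real n + s) ^ k)) = (fact k / t ^ k) * (\<Sum>n. f n k)"
        unfolding eq by (rule suminf_mult) (rule sw(2))
      then show ?thesis using False by simp
    qed
    moreover have "(\<Sum>k. f n k) = A n * exp (of_real (real n + s) * t)" for n
      using s2 by (simp add: sums_iff)
    ultimately show ?case using sw(1) by simp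
  qed
qed

text \<open>A slightly larger ratio absorbs the polynomial: with \<open>x * exp e < 1\<close>, the
  single term of index p in the series of \<open>exp (e * m)\<close> bounds \<open>m ^ p\<close> by
  a multiple of \<open>exp e ^ m\<close>.\<close>

lemma summable_poly_geometric:
  fixes x :: real
  assumes "0 \<le> x" "x < 1"
  shows "summable (\<lambda>m. real m ^ p * x ^ m)"
proof -
  have "((\<lambda>e. x * exp e) \<longlongrightarrow> x * exp 0) (at_right 0)"
    by (intro tendsto_intros)
  then have "\<forall>\<^sub>F e in at_right 0. x * exp e < 1"
    by (rule order_tendstoD) (use assms in simp)
  moreover have "\<forall>\<^sub>F e in at_right 0. 0 < (e::real)" by (simp add: eventually_at_right_less)
  ultimately have "\<forall>\<^sub>F e in at_right 0. x * exp e < 1 \<and> 0 < e" by (rule eventually_conj)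
  from eventually_happens'[OF _ this] obtain e where e: "x * exp e < 1" "0 < e"
    by (auto simp: trivial_limit_at_right_real)
  have bd: "real m ^ p * x ^ m \<le> fact p / e ^ p * (x * exp e) ^ m" for m
  proof -
    have es: "(\<lambda>k. (e * real m) ^ k / fact k) sums exp (e * real m)"
      using exp_converges[of "e * real m"] by (simp add: field_simps scaleR_conv_of_real)
    have "(\<Sum>k\<in>{p}. (e * real m) ^ k / fact k) \<le> exp (e * real m)"
      unfolding sums_unique[OF es] by (rule sum_le_suminf[OF sums_summable[OF es]]) (use e in auto)
    then have "e ^ p * real m ^ p \<le> fact p * exp e ^ m"
      by (simp add: power_mult_distrib field_simps exp_of_nat2_mult)
    then have "real m ^ p \<le> fact p / e ^ p * exp e ^ m"
      using e by (simp add: field_simps)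
    then have "real m ^ p * x ^ m \<le> fact p / e ^ p * exp e ^ m * x ^ m"
      using assms by (intro mult_right_mono) auto
    then show ?thesis by (simp add: power_mult_distrib mult_ac)
  qed
  show ?thesis
    by (rule summable_comparison_test'[OF summable_mult[OF summable_geometric[of "x * exp e"], of "fact p / e ^ p"], of 0])
       (use bd assms e in \<open>auto simp: abs_mult\<close>)
qed

text \<open>Expanding each quotient as a geometric series gives a double series over (m, n), which
  is regrouped by the product of the two indices; the pairs with product N correspond to the
  divisors of N.\<close>

lemma lambert_sum:
  fixes q :: complex
  assumes "norm q < 1"
  shows "(\<Sum>n. of_nat (Suc n) ^ p * (q ^ Suc n / (1 - q ^ Suc n))) = (\<Sum>n. of_nat (divsum p (Suc n)) * q ^ Suc n)"
proof -
  define f where "f = (\<lambda>(m,n). of_nat (Suc m) ^ p * (q ^ Suc m) ^ Suc n)"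
  have nq: "norm (q ^ Suc m) < 1" for m using assms by (metis norm_ge_zero norm_power power_Suc_less_one power_less_one_iff zero_less_Suc)
  have geo: "(\<lambda>n. x ^ Suc n) sums (x / (1 - x))" if "norm x < 1" for x :: "'a::{real_normed_field,banach}"
    using sums_mult[OF geometric_sums[OF that], of x] by simp
  have r1: "((\<lambda>n. f (m,n)) has_sum (of_nat (Suc m) ^ p * (q ^ Suc m / (1 - q ^ Suc m)))) UNIV" for m
    unfolding f_def prod.case
  proof (intro norm_summable_imp_has_sum sums_mult geo nq)
    show "summable (\<lambda>n. norm (of_nat (Suc m) ^ p * (q ^ Suc m) ^ Suc n))"
      unfolding norm_mult norm_power[of _ "Suc _"]
      by (intro summable_mult sums_summable[OF geo]) (use nq[of m] in \<open>simp add: norm_power del: power_Suc\<close>)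
  qed
  have r2: "((\<lambda>n. norm (f (m,n))) has_sum (real (Suc m) ^ p * (norm q ^ Suc m / (1 - norm q ^ Suc m)))) UNIV" for m
  proof -
    have "(\<lambda>n. norm (f (m,n))) sums (real (Suc m) ^ p * (norm q ^ Suc m / (1 - norm q ^ Suc m)))"
    proof -
      have "norm (f (m,n)) = real (Suc m) ^ p * (norm q ^ Suc m) ^ Suc n" for n
        by (simp add: f_def norm_mult norm_power del: of_nat_Suc power_Suc)
      moreover have "norm (norm q ^ Suc m) < 1" using nq[of m] by (simp add: norm_power del: power_Suc)
      ultimately show ?thesis using sums_mult[OF geo[of "norm q ^ Suc m"]] by simp
    qed
    then show ?thesis by (intro norm_summable_imp_has_sum) (auto simp: sums_iff)
  qed
  have sm: "summable (\<lambda>m. real (Suc m) ^ p * norm q ^ Suc m)"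
  proof -
    have "summable (\<lambda>m. real m ^ p * norm q ^ m)"
      by (rule summable_poly_geometric) (use assms in auto)
    then show ?thesis by (subst summable_Suc_iff) 
  qed
  have "(\<lambda>x. norm (f x)) summable_on (UNIV \<times> UNIV)"
  proof (rule summable_on_SigmaI)
    show "(\<lambda>m. real (Suc m) ^ p * (norm q ^ Suc m / (1 - norm q ^ Suc m))) summable_on UNIV"
    proof (intro norm_summable_imp_summable_on summable_comparison_test'[OF summable_mult[OF sm, of "1/(1 - norm q)"], of 0])
      fix m
      have "norm q ^ Suc m \<le> norm q" using assms by (simp add: mult_left_le power_le_one)
      then have "norm q ^ Suc m / (1 - norm q ^ Suc m) \<le> norm q ^ Suc m / (1 - norm q)"
        using assms by (intro divide_left_mono mult_pos_pos) auto
      then have "real (Suc m) ^ p * (norm q ^ Suc m / (1 - norm q ^ Suc m)) \<le> real (Suc m) ^ p * (norm q ^ Suc m / (1 - norm q))"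
        by (intro mult_left_mono) auto
      moreover have "0 \<le> real (Suc m) ^ p * (norm q ^ Suc m / (1 - norm q ^ Suc m))"
        using nq[of m] by (intro mult_nonneg_nonneg divide_nonneg_nonneg) (auto simp: norm_power simp del: power_Suc of_nat_Suc)
      ultimately have "norm (norm (real (Suc m) ^ p * (norm q ^ Suc m / (1 - norm q ^ Suc m)))) \<le> real (Suc m) ^ p * (norm q ^ Suc m / (1 - norm q))"
        by (simp only: real_norm_def abs_of_nonneg)
      also have "\<dots> = 1 / (1 - norm q) * (real (Suc m) ^ p * norm q ^ Suc m)"
        by (simp del: power_Suc of_nat_Suc)
      finally show "norm (norm (real (Suc m) ^ p * (norm q ^ Suc m / (1 - norm q ^ Suc m)))) \<le> 1 / (1 - norm q) * (real (Suc m) ^ p * norm q ^ Suc m)" .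
    qed
  qed (use r2 in auto)
  then have "f summable_on (UNIV \<times> UNIV)" by (rule abs_summable_summable)
  then obtain S where S: "(f has_sum S) (UNIV \<times> UNIV)" by (auto simp: summable_on_def)
  have 1: "((\<lambda>m. of_nat (Suc m) ^ p * (q ^ Suc m / (1 - q ^ Suc m))) has_sum S) UNIV"
    by (rule has_sum_SigmaD[OF S]) (use r1 in auto)
  define g where "g = (\<lambda>(N,d). of_nat d ^ p * q ^ Suc N)"
  \<comment> \<open>All indices are offset by one: (m, n) stands for the factors m + 1 and n + 1,
    and N for the product N + 1, so d runs over the divisors of \<open>Suc N\<close>.\<close>
  have "(f has_sum S) (UNIV \<times> UNIV) \<longleftrightarrow> (g has_sum S) (SIGMA N:UNIV. {d. d dvd Suc N})"
  proof (rule has_sum_reindex_bij_witness[of _ "\<lambda>(N,d). (d - 1, Suc N div d - 1)" "\<lambda>(m,n). (Suc m * Suc n - 1, Suc m)"], goal_cases)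
    case (1 a)
    obtain m n where a: "a = (m, n)" by force
    have s: "Suc (Suc m * Suc n - 1) = Suc m * Suc n" by simp
    show ?case unfolding a prod.case s by (simp del: mult_Suc mult_Suc_right)
  next
    case (2 a)
    obtain m n where a: "a = (m, n)" by force
    have s: "Suc (Suc m * Suc n - 1) = Suc m * Suc n" by simp
    show ?case unfolding a prod.case mem_Sigma_iff mem_Collect_eq s by (simp del: mult_Suc mult_Suc_right)
  next
    case (4 b)
    then show ?case by auto
  next
    case (3 b)
    obtain N d where b: "b = (N,d)" by force
    then have "d dvd Suc N" using 3 by simp
    then obtain e where e: "Suc N = d * e" by auto
    then have "d > 0" "e > 0" by (auto intro: gr0I)
    then have eqs: "Suc (d - 1) = d" "Suc (Suc N div d - 1) = e" unfolding e by simp_all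
    show ?case unfolding b prod.case eqs unfolding e [symmetric] by simp
  next
    case (5 a)
    then show ?case by (auto simp: f_def g_def power_mult [symmetric] case_prod_unfold simp del: power_Suc of_nat_Suc)
  qed (auto)
  then have S': "(g has_sum S) (SIGMA N:UNIV. {d. d dvd Suc N})" using S by simp
  have "((\<lambda>N. of_nat (divsum p (Suc N)) * q ^ Suc N) has_sum S) UNIV"
  proof (rule has_sum_SigmaD[OF S'])
    fix N
    show "((\<lambda>d. g (N,d)) has_sum of_nat (divsum p (Suc N)) * q ^ Suc N) {d. d dvd Suc N}"
      by (rule has_sum_finiteI) (auto simp: g_def divsum_def sum_distrib_right)
  qed
  from has_sum_imp_sums[OF this] has_sum_imp_sums[OF 1] show ?thesis by (simp add: sums_iff)
qed

section \<open>Powers of q and the size of the Lambert coefficients\<close>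

lemma norm_qpow: "norm (qpow \<tau> x) = exp (- (2 * pi * x * Im \<tau>))"
  by (simp add: qpow_def)

lemma qpow_nonzero [simp]: "qpow \<tau> x \<noteq> 0"
  by (simp add: qpow_def)

lemma qpow_add_right: "qpow \<tau> (x + y) = qpow \<tau> x * qpow \<tau> y"
  by (simp add: qpow_def exp_add [symmetric] algebra_simps)

lemma qpow_add_left: "qpow (s + t) x = qpow s x * qpow t x"
  by (simp add: qpow_def exp_add [symmetric] algebra_simps)

lemma qpow_uminus_right: "qpow \<tau> (- x) = inverse (qpow \<tau> x)"
  by (simp add: qpow_def exp_minus)

lemma qpow_of_nat: "qpow \<tau> (real n) = qpow \<tau> 1 ^ n"
  by (simp add: qpow_def exp_of_nat_mult [symmetric] mult_ac)

lemma qpow_0_right [simp]: "qpow \<tau> 0 = 1"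
  by (simp add: qpow_def)

lemma qpow_of_int_mult: "qpow (of_int n * \<tau>) x = qpow \<tau> x powi n"
  by (simp add: qpow_def exp_power_int mult_ac)

lemma norm_qpow_less_1: "0 < Im \<tau> \<Longrightarrow> 0 < x \<Longrightarrow> norm (qpow \<tau> x) < 1"
  by (simp add: norm_qpow)

definition lambert_term :: "complex \<Rightarrow> complex" where
  "lambert_term x = x / (1 - x)"

abbreviation lambert_coeff :: "complex \<Rightarrow> complex \<Rightarrow> real \<Rightarrow> nat \<Rightarrow> complex" where
  "lambert_coeff lam \<tau> s n \<equiv> lambert_term (lam * qpow \<tau> (real n + s))"

lemma lambert_term_bound:
  assumes "norm lam = 1" "0 < Im \<tau>" "0 \<le> s"
  obtains C where "\<And>n. norm (lambert_coeff lam \<tau> s n) \<le> C * norm (qpow \<tau> 1) ^ n"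
proof
  define q where "q = norm (qpow \<tau> 1)"
  define A where "A n = lambert_coeff lam \<tau> s n" for n
  have q: "0 \<le> q" "q < 1" using assms by (auto simp: q_def norm_qpow_less_1)
  \<comment> \<open>The index 0 gets its own constant, because for s = 0 its argument lies on the
    unit circle and the denominator may be small or zero. From n = 1 on the denominator is at least
    1 - q.\<close>
  define C where "C = norm (A 0) + 1 / (1 - q)"
  fix n
  have "norm (A n) \<le> C * q ^ n"
  proof (cases n)
    case 0
    then show ?thesis using q by (simp add: C_def)
  next
    case (Suc m)
    have 1: "norm (lam * qpow \<tau> (real n + s)) \<le> q ^ n"
    proof -
      have "norm (lam * qpow \<tau> (real n + s)) = q ^ n * norm (qpow \<tau> s)"
        using assms by (simp add: qpow_add_right qpow_of_nat norm_mult norm_power q_def)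
      also have "\<dots> \<le> q ^ n * 1"
        using assms q by (intro mult_left_mono) (auto simp: norm_qpow)
      finally show ?thesis by simp
    qed
    have "q ^ n \<le> q" using q Suc by (simp add: mult_left_le power_le_one)
    then have "1 - q \<le> norm (1 - lam * qpow \<tau> (real n + s))"
      using 1 norm_triangle_ineq2[of 1 "lam * qpow \<tau> (real n + s)"] by simp
    then have "norm (A n) \<le> q ^ n / (1 - q)"
      unfolding A_def lambert_term_def norm_divide using 1 q by (intro frac_le) auto
    also have "\<dots> \<le> C * q ^ n" using q by (simp add: C_def ring_distribs)
    finally show ?thesis .
  qed
  then show "norm (lambert_coeff lam \<tau> s n) \<le> C * norm (qpow \<tau> 1) ^ n"
    by (simp add: A_def q_def)
qed

section \<open>The generating function of the Eisenstein-type series\<close>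

text \<open>This is the sum of \<open>Q\<^sub>k u\<^sup>k\<^sup>-\<^sup>1\<close>, \<open>u = 2 \<pi> i z\<close>, on the strip \<open>\<bar>Im z\<bar> < Im \<tau>\<close>;
  the three summands give the Bernoulli term and the two series of \<open>Qf\<close>.\<close>
definition strip_kernel :: "real \<Rightarrow> complex \<Rightarrow> complex \<Rightarrow> complex \<Rightarrow> complex" where
  "strip_kernel r lam \<tau> z = qpow z r *
     (1 / (1 - qpow z 1)
      + (\<Sum>n. lambert_coeff lam \<tau> r n * qpow z 1 ^ n)
      - (\<Sum>n. lambert_coeff (inverse lam) \<tau> (1 - r) n * inverse (qpow z 1) ^ n) * inverse (qpow z 1))"

lemma lambert_power_series:
  assumes "norm lam = 1" "0 < Im \<tau>" "0 \<le> s" "norm (qpow \<tau> 1) * norm w < 1"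
  shows "summable (\<lambda>n. lambert_coeff lam \<tau> s n * w ^ n)"
proof -
  obtain C where C: "\<And>n. norm (lambert_coeff lam \<tau> s n) \<le> C * norm (qpow \<tau> 1) ^ n"
    using lambert_term_bound assms by metis
  show ?thesis
  proof (rule summable_comparison_test'[OF summable_mult[OF summable_geometric[of "norm (qpow \<tau> 1) * norm w"]], of 0])
    fix n
    have "norm (lambert_coeff lam \<tau> s n * w ^ n) \<le> C * norm (qpow \<tau> 1) ^ n * norm w ^ n"
      unfolding norm_mult norm_power using C by (intro mult_right_mono) auto
    then show "norm (lambert_coeff lam \<tau> s n * w ^ n) \<le> C * (norm (qpow \<tau> 1) * norm w) ^ n"
      by (simp add: power_mult_distrib mult_ac)
  qed (use assms in auto)
qed

lemma lambert_power_series_holomorphic: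
  assumes "norm lam = 1" "0 < Im \<tau>" "0 \<le> s"
  shows "(\<lambda>w. \<Sum>n. lambert_coeff lam \<tau> s n * w ^ n) holomorphic_on
           {w. norm (qpow \<tau> 1) * norm w < 1}"
proof -
  have eq: "{w::complex. norm (qpow \<tau> 1) * norm w < 1} = ball 0 (1 / norm (qpow \<tau> 1))"
    by (auto simp: field_simps)
  show ?thesis unfolding eq
  proof (rule power_series_holomorphic)
    fix w :: complex assume "w \<in> ball 0 (1 / norm (qpow \<tau> 1))"
    then have "norm (qpow \<tau> 1) * norm w < 1" by (simp add: field_simps)
    from summable_sums[OF lambert_power_series[OF assms this]]
    show "(\<lambda>n. lambert_coeff lam \<tau> s n * (w - 0) ^ n) sums
      (\<Sum>n. lambert_coeff lam \<tau> s n * w ^ n)" by simp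
  qed
qed

lemma strip_bounds:
  assumes "\<bar>Im z\<bar> < Im \<tau>"
  shows "norm (qpow \<tau> 1) * norm (qpow z 1) < 1" "norm (qpow \<tau> 1) * norm (inverse (qpow z 1)) < 1"
proof -
  have "norm (qpow \<tau> 1) * norm (qpow z 1) = exp (- (2 * pi * (Im \<tau> + Im z)))"
    by (simp add: norm_qpow exp_add [symmetric] algebra_simps)
  moreover have "norm (qpow \<tau> 1) * norm (inverse (qpow z 1)) = exp (- (2 * pi * (Im \<tau> - Im z)))"
    by (simp add: norm_qpow norm_inverse exp_minus [symmetric] exp_add [symmetric] algebra_simps)
  moreover have "0 < 2 * pi * (Im \<tau> + Im z)" "0 < 2 * pi * (Im \<tau> - Im z)"
    using assms by (auto intro!: mult_pos_pos)
  ultimately show "norm (qpow \<tau> 1) * norm (qpow z 1) < 1" "norm (qpow \<tau> 1) * norm (inverse (qpow z 1)) < 1"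
    by simp_all
qed

lemma qpow_holomorphic [holomorphic_intros]: 
  "f holomorphic_on A \<Longrightarrow> (\<lambda>z. qpow (f z) x) holomorphic_on A"
  unfolding qpow_def by (intro holomorphic_intros)

lemma strip_kernel_holomorphic:
  assumes "norm lam = 1" "0 \<le> r" "r < 1"
  shows "strip_kernel r lam \<tau> holomorphic_on {z. \<bar>Im z\<bar> < Im \<tau> \<and> qpow z 1 \<noteq> 1}"
proof (cases "0 < Im \<tau>")
  case True
  have il: "norm (inverse lam) = 1" using assms by (simp add: norm_inverse)
  have 1: "(\<lambda>z. (\<Sum>n. lambert_coeff lam \<tau> r n * qpow z 1 ^ n)) holomorphic_on {z. \<bar>Im z\<bar> < Im \<tau> \<and> qpow z 1 \<noteq> 1}"
    by (rule holomorphic_on_compose_gen[OF _ lambert_power_series_holomorphic[OF assms(1) True assms(2)], of "\<lambda>z. qpow z 1", unfolded o_def])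
       (use strip_bounds in \<open>auto intro!: holomorphic_intros\<close>)
  have 2: "(\<lambda>z. (\<Sum>n. lambert_coeff (inverse lam) \<tau> (1 - r) n * inverse (qpow z 1) ^ n)) holomorphic_on {z. \<bar>Im z\<bar> < Im \<tau> \<and> qpow z 1 \<noteq> 1}"
    by (rule holomorphic_on_compose_gen[OF _ lambert_power_series_holomorphic[OF il True], of "\<lambda>z. inverse (qpow z 1)" _ "1 - r", unfolded o_def])
       (use strip_bounds(2) assms in \<open>auto intro!: holomorphic_intros\<close>)
  show ?thesis unfolding strip_kernel_def
    by (intro holomorphic_intros 1 2) auto
next
  case False
  then have empty: "{z. \<bar>Im z\<bar> < Im \<tau> \<and> qpow z 1 \<noteq> 1} = {}" by auto
  show ?thesis unfolding empty by (auto simp: holomorphic_on_def)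
qed

text \<open>For \<open>(\<mu>, \<lambda>) = (1, 1)\<close> the summand of index 0 is the junk value \<open>1 / 0 = 0\<close>; the missing
  term makes the generating function quasi-periodic with an additive constant.\<close>
definition kernel_defect :: "real \<Rightarrow> complex \<Rightarrow> complex" where
  "kernel_defect r lam = (if r = 0 \<and> lam = 1 then 1 else 0)"

text \<open>In the first series the identity \<open>x * x / (1 - x) = x / (1 - x) - x\<close> splits
  off a geometric series that cancels the pole term at z + \<tau>. In the second,
  \<open>1 / (1 - y) = 1 + y / (1 - y)\<close> splits off the one that supplies the pole term at
  z.\<close>

lemma strip_kernel_shift:
  assumes lam: "norm lam = 1" and r: "0 \<le> r" "r < 1" and z: "- Im \<tau> < Im z" "Im z < 0"
  shows "strip_kernel r lam \<tau> (z + \<tau>) = inverse lam * strip_kernel r lam \<tau> z + kernel_defect r lam"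
proof -
  have \<tau>: "0 < Im \<tau>" using z by simp
  have il: "norm (inverse lam) = 1" using lam by (simp add: norm_inverse)
  have lam0: "lam \<noteq> 0" using lam by auto
  define q where "q = qpow \<tau> 1"
  define w where "w = qpow z 1"
  define A where "A n = lambert_coeff lam \<tau> r n" for n
  define B where "B n = lambert_coeff (inverse lam) \<tau> (1 - r) n" for n
  define D where "D = kernel_defect r lam"
  have w: "norm w > 1" using z by (simp add: w_def norm_qpow mult_pos_neg)
  have w0: "w \<noteq> 0" and q0: "q \<noteq> 0" by (auto simp: w_def q_def)
  have wq: "norm (w * q) < 1" using strip_bounds(1)[of z \<tau>] z by (simp add: w_def q_def norm_mult mult_ac)
  have sh: "qpow (z + \<tau>) 1 = w * q" by (simp add: qpow_add_left w_def q_def)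
  have sb: "\<bar>Im (z + \<tau>)\<bar> < Im \<tau>" "\<bar>Im z\<bar> < Im \<tau>" using z by auto
  have sA: "summable (\<lambda>n. A n * w ^ n)" "summable (\<lambda>n. A n * (w * q) ^ n)"
    using lambert_power_series[OF lam \<tau> r(1) strip_bounds(1)[OF sb(2)]]
          lambert_power_series[OF lam \<tau> r(1) strip_bounds(1)[OF sb(1)]]
    by (simp_all add: A_def w_def qpow_add_left q_def)
  have sB: "summable (\<lambda>n. B n * inverse w ^ n)" "summable (\<lambda>n. B n * inverse (w * q) ^ n)"
    using lambert_power_series[OF il \<tau> _ strip_bounds(2)[OF sb(2)], of "1 - r"]
          lambert_power_series[OF il \<tau> _ strip_bounds(2)[OF sb(1)], of "1 - r"] r
    by (simp_all add: B_def w_def qpow_add_left q_def)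
  \<comment> \<open>The last summand repairs the recursion at \<open>x = 1\<close>, where the
    quotient is 0. Since the norm of x is below 1 unless n + r = 0, this happens only for n = 0, r =
    0, lam = 1.\<close>
  have recA: "lam * qpow \<tau> r * q ^ n * A n = A n - lam * qpow \<tau> r * q ^ n + (if n = 0 then D else 0)" for n
  proof -
    define x where "x = lam * qpow \<tau> (real n + r)"
    have x: "x = lam * qpow \<tau> r * q ^ n" by (simp add: x_def qpow_add_right qpow_of_nat q_def)
    show ?thesis
    proof (cases "x = 1")
      case True
      have "norm x = exp (- (2 * pi * (real n + r) * Im \<tau>))"
        by (simp add: x_def norm_mult lam norm_qpow)
      then have "2 * pi * (real n + r) * Im \<tau> = 0"
        using True by (metis exp_eq_one_iff neg_equal_0_iff_equal norm_one)
      then have nr: "n = 0" "r = 0" using \<tau> r by (auto simp: add_nonneg_eq_0_iff)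
      then have "lam = 1" using True by (simp add: x_def)
      then show ?thesis using nr True by (simp add: A_def lambert_term_def D_def kernel_defect_def)
    next
      case False
      have D0: "n = 0 \<Longrightarrow> D = 0" using False by (auto simp: D_def kernel_defect_def x_def)
      have "x * (x / (1 - x)) = x / (1 - x) - x" using False by (simp add: field_simps)
      then show ?thesis using D0 unfolding A_def lambert_term_def x [symmetric] x_def [symmetric] by auto
    qed
  qed
  have recB: "lam * qpow \<tau> r * inverse q * inverse q ^ n * B n = 1 + B n" for n
  proof -
    define y where "y = inverse lam * qpow \<tau> (real n + (1 - r))"
    have y: "lam * qpow \<tau> r * inverse q * inverse q ^ n = inverse y"
      by (simp add: y_def qpow_add_right qpow_of_nat q_def qpow_uminus_right [of _ r, simplified] diff_conv_add_uminus del: add_uminus_conv_diff) (simp add: field_simps)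
    have "norm y < 1" using r \<tau> by (simp add: y_def norm_mult il norm_qpow)
    then have "y \<noteq> 1" by auto
    moreover have "y \<noteq> 0" using lam0 by (simp add: y_def)
    ultimately show ?thesis unfolding y B_def lambert_term_def y_def [symmetric] by (simp add: field_simps)
  qed
  \<comment> \<open>Both geometric series converge because z lies below the real axis and z + \<tau>
    above it: \<open>norm w > 1\<close> while \<open>norm (w * q) < 1\<close>.\<close>
  have geo1: "(\<lambda>n. (w * q) ^ n) sums (1 / (1 - w * q))" using geometric_sums[OF wq] .
  have iw: "norm (inverse w) < 1" using w by (simp add: norm_inverse inverse_less_1_iff)
  have geo2: "(\<lambda>n. inverse w ^ n) sums (1 / (1 - inverse w))" using geometric_sums[OF iw] .
  have eqA: "lam * qpow \<tau> r * (\<Sum>n. A n * (w * q) ^ n) = (\<Sum>n. A n * w ^ n) - lam * qpow \<tau> r * (1 / (1 - w * q)) + D"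
  proof -
    have t: "lam * qpow \<tau> r * (A n * (w * q) ^ n) = (A n * w ^ n - lam * qpow \<tau> r * (w * q) ^ n) + (if n = 0 then D else 0)" for n
      using arg_cong[OF recA[of n], of "\<lambda>x. x * w ^ n"] by (simp add: power_mult_distrib algebra_simps)
    have "(\<lambda>n. (A n * w ^ n - lam * qpow \<tau> r * (w * q) ^ n) + (if n = 0 then D else 0)) sums
       ((\<Sum>n. A n * w ^ n) - lam * qpow \<tau> r * (1 / (1 - w * q)) + D)"
      by (intro sums_add sums_diff summable_sums sA sums_mult geo1 sums_single)
    then show ?thesis unfolding t [symmetric]
      using sums_mult[OF summable_sums[OF sA(2)], of "lam * qpow \<tau> r"] sums_unique2 by blast
  qed
  have eqB: "lam * qpow \<tau> r * inverse q * (\<Sum>n. B n * inverse (w * q) ^ n) = 1 / (1 - inverse w) + (\<Sum>n. B n * inverse w ^ n)"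
  proof -
    have t: "lam * qpow \<tau> r * inverse q * (B n * inverse (w * q) ^ n) = inverse w ^ n + B n * inverse w ^ n" for n
      using arg_cong[OF recB[of n], of "\<lambda>x. x * inverse w ^ n"] by (simp add: power_mult_distrib algebra_simps)
    have "(\<lambda>n. inverse w ^ n + B n * inverse w ^ n) sums (1 / (1 - inverse w) + (\<Sum>n. B n * inverse w ^ n))"
      by (intro sums_add summable_sums sB geo2)
    then show ?thesis unfolding t [symmetric]
      using sums_mult[OF summable_sums[OF sB(2)], of "lam * qpow \<tau> r * inverse q"] sums_unique2 by blast
  qed
  have w1: "w \<noteq> 1" "w * q \<noteq> 1" using w wq by auto
  have D: "qpow z r * D = D" "lam * D = D" by (auto simp: D_def kernel_defect_def)
  define a1 a2 b1 b2 where "a1 = (\<Sum>n. A n * w ^ n)" "a2 = (\<Sum>n. A n * (w * q) ^ n)"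
    "b1 = (\<Sum>n. B n * inverse w ^ n)" "b2 = (\<Sum>n. B n * inverse (w * q) ^ n)"
  have sk: "strip_kernel r lam \<tau> (z + \<tau>) = qpow z r * qpow \<tau> r * (1 / (1 - w * q) + a2 - b2 * inverse (w * q))"
    unfolding strip_kernel_def sh A_def [symmetric] B_def [symmetric] a1_a2_b1_b2_def by (simp add: qpow_add_left)
  have "lam * strip_kernel r lam \<tau> (z + \<tau>) = qpow z r * (lam * qpow \<tau> r * (1 / (1 - w * q)) + lam * qpow \<tau> r * a2 - (lam * qpow \<tau> r * inverse q * b2) * inverse w)"
    unfolding sk by (simp add: algebra_simps)
  also have "\<dots> = qpow z r * (a1 + D - (1 / (1 - inverse w) + b1) * inverse w)"
    using eqA eqB unfolding a1_a2_b1_b2_def by simp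
  also have "\<dots> = qpow z r * (1 / (1 - w) + a1 - b1 * inverse w) + D"
  proof -
    have e: "- (1 / (1 - inverse w) * inverse w) = 1 / (1 - w)" using w0 w1 by (simp add: field_simps)
    have "qpow z r * (a1 + D - (X + b1) * inverse w) = qpow z r * (- (X * inverse w) + a1 - b1 * inverse w) + qpow z r * D" for X
      by (simp add: algebra_simps)
    then show ?thesis unfolding D(1) e [symmetric] by blast
  qed
  also have "\<dots> = strip_kernel r lam \<tau> z + D"
    unfolding strip_kernel_def w_def [symmetric] A_def [symmetric] B_def [symmetric] a1_a2_b1_b2_def by simp
  finally have "strip_kernel r lam \<tau> (z + \<tau>) = inverse lam * (strip_kernel r lam \<tau> z + D)"
    using lam0 by (simp add: field_simps)
  then show ?thesis using D lam0 by (simp add: D_def [symmetric] field_simps)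
qed

section \<open>Quasi-periodic functions on the plane and Liouville's theorem\<close>

definition period_lattice :: "complex \<Rightarrow> complex set" where
  "period_lattice \<tau> = {z. \<exists>m n::int. z = of_int m + of_int n * \<tau>}"

lemma period_lattice_shift:
  "z + of_int m + of_int n * \<tau> \<in> period_lattice \<tau> \<longleftrightarrow> z \<in> period_lattice \<tau>"
proof
  assume "z \<in> period_lattice \<tau>"
  then obtain k l :: int where "z = of_int k + of_int l * \<tau>" by (auto simp: period_lattice_def)
  then have "z + of_int m + of_int n * \<tau> = of_int (k + m) + of_int (l + n) * \<tau>" by (simp add: algebra_simps)
  then show "z + of_int m + of_int n * \<tau> \<in> period_lattice \<tau>" unfolding period_lattice_def by blast
next
  assume "z + of_int m + of_int n * \<tau> \<in> period_lattice \<tau>"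
  then obtain k l :: int where "z + of_int m + of_int n * \<tau> = of_int k + of_int l * \<tau>" by (auto simp: period_lattice_def)
  then have "z = of_int (k - m) + of_int (l - n) * \<tau>" by (simp add: algebra_simps)
  then show "z \<in> period_lattice \<tau>" unfolding period_lattice_def by blast
qed

lemma lattice_point_far_from_0:
  assumes "0 < Im \<tau>" "z \<in> period_lattice \<tau>" "norm z < 1" "norm z < Im \<tau>"
  shows "z = 0"
proof -
  obtain m n :: int where z: "z = of_int m + of_int n * \<tau>" using assms by (auto simp: period_lattice_def)
  have "\<bar>real_of_int n * Im \<tau>\<bar> < Im \<tau>" using abs_Im_le_cmod[of z] assms by (simp add: z)
  then have "\<bar>real_of_int n\<bar> * Im \<tau> < 1 * Im \<tau>" using assms by (simp add: abs_mult)
  then have n: "n = 0" using assms(1) by (simp add: mult_less_cancel_right)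
  then have "\<bar>real_of_int m\<bar> < 1" using abs_Re_le_cmod[of z] assms by (simp add: z)
  then show ?thesis using n z by simp
qed

lemma eventually_not_period_lattice:
  assumes "0 < Im \<tau>"
  shows "\<forall>\<^sub>F z in at 0. z \<notin> period_lattice \<tau>"
  unfolding eventually_at
  using lattice_point_far_from_0[OF assms] assms by (intro exI[of _ "min 1 (Im \<tau>)"]) auto

lemma lattice_reduce:
  assumes "0 < Im \<tau>"
  obtains s t :: real and m n :: int where "0 \<le> s" "s \<le> 1" "0 \<le> t" "t \<le> 1"
    "z = (of_real s + of_real t * \<tau>) + of_int m + of_int n * \<tau>"
proof
  define t' where "t' = Im z / Im \<tau>"
  define s' where "s' = Re z - t' * Re \<tau>"
  have z: "z = of_real s' + of_real t' * \<tau>" using assms by (intro complex_eqI) (simp_all add: s'_def t'_def)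
  show "z = (of_real (frac s') + of_real (frac t') * \<tau>) + of_int \<lfloor>s'\<rfloor> + of_int \<lfloor>t'\<rfloor> * \<tau>"
    by (simp add: frac_def z algebra_simps)
qed (auto simp: frac_ge_0 less_imp_le[OF frac_lt_1])

lemma quasi_period_multiple:
  fixes G :: "complex \<Rightarrow> complex"
  assumes G: "\<And>z. G (z + p) = \<alpha> * G z" and \<alpha>: "\<alpha> \<noteq> 0"
  shows "G (z + of_int n * p) = \<alpha> powi n * G z"
proof (induction n rule: int_induct[of _ 0])
  case (step1 i)
  have "G (z + of_int (i + 1) * p) = G ((z + of_int i * p) + p)" by (simp add: algebra_simps)
  then show ?case using step1 \<alpha> by (simp only: G) (simp add: power_int_add)
next
  case (step2 i)
  have "G (z + of_int i * p) = G ((z + of_int (i - 1) * p) + p)" by (simp add: algebra_simps)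
  then show ?case using step2 \<alpha> by (simp only: G) (simp add: power_int_diff field_simps)
qed simp

text \<open>Quasi-periodicity carries the limit at 0 to every lattice point, so all singularities
  are removable. Multipliers of norm 1 make the norm periodic, hence bounded by its maximum on a
  compact parallelogram. The conclusion avoids lattice points, where G need not agree with its
  limit.\<close>

lemma quasi_elliptic_const:
  fixes G :: "complex \<Rightarrow> complex"
  assumes \<tau>: "0 < Im \<tau>" and ana: "G analytic_on - period_lattice \<tau>"
    and G1: "\<And>z. G (z + 1) = \<alpha> * G z" and G\<tau>: "\<And>z. G (z + \<tau>) = \<beta> * G z"
    and \<alpha>: "norm \<alpha> = 1" and \<beta>: "norm \<beta> = 1" and lim: "G \<midarrow>0\<rightarrow> L"
  obtains K where "\<And>z. z \<notin> period_lattice \<tau> \<Longrightarrow> G z = K" "\<alpha> * K = K" "\<beta> * K = K"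
proof -
  have nz: "\<alpha> \<noteq> 0" "\<beta> \<noteq> 0" using \<alpha> \<beta> by auto
  have s1: "G (z + of_int m) = \<alpha> powi m * G z" and s2: "G (z + of_int n * \<tau>) = \<beta> powi n * G z" for z m n
    using quasi_period_multiple[of G 1 \<alpha> z m, OF G1 nz(1)] quasi_period_multiple[of G \<tau> \<beta> z n, OF G\<tau> nz(2)] by simp_all
  have G_shift: "G (z + of_int m + of_int n * \<tau>) = \<beta> powi n * \<alpha> powi m * G z" for z m n
    by (simp add: s1 s2)
  define H where "H = remove_sings G"
  have H_off: "H z = G z" if "z \<notin> period_lattice \<tau>" for z
    unfolding H_def by (rule remove_sings_at_analytic) (use ana that in \<open>auto intro: analytic_on_subset\<close>)
  have H_lat: "H analytic_on {w} \<and> norm (H w) = norm L" if w: "w \<in> period_lattice \<tau>" for w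
  proof -
    obtain m n :: int where wmn: "w = of_int m + of_int n * \<tau>" using w by (auto simp: period_lattice_def)
    have "((\<lambda>z. \<beta> powi n * \<alpha> powi m * G z) \<longlongrightarrow> \<beta> powi n * \<alpha> powi m * L) (at 0)"
      by (intro tendsto_intros lim)
    then have "((\<lambda>z. G (z + w)) \<longlongrightarrow> \<beta> powi n * \<alpha> powi m * L) (at 0)"
      using G_shift[of _ m n] by (simp add: wmn algebra_simps)
    then have lw: "G \<midarrow>w\<rightarrow> \<beta> powi n * \<alpha> powi m * L"
      by (subst at_to_0) (simp add: filterlim_filtermap)
    have "\<forall>\<^sub>F z in at 0. z \<notin> period_lattice \<tau>" by (rule eventually_not_period_lattice[OF \<tau>])
    then have "\<forall>\<^sub>F z in at 0. z + w \<notin> period_lattice \<tau>"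
      using period_lattice_shift[of _ m n \<tau>] by (simp add: wmn add.assoc)
    then have "\<forall>\<^sub>F z in at w. z \<notin> period_lattice \<tau>"
      by (subst at_to_0) (simp add: eventually_filtermap)
    then obtain d where d: "d > 0" "\<And>z. z \<noteq> w \<Longrightarrow> dist z w < d \<Longrightarrow> z \<notin> period_lattice \<tau>"
      by (auto simp: eventually_at)
    have "G analytic_on ball w d - {w}"
      by (rule analytic_on_subset[OF ana]) (use d in \<open>auto simp: dist_commute\<close>)
    then have "isolated_singularity_at G w" using d(1) by (auto simp: isolated_singularity_at_def)
    then have "H analytic_on {w}" unfolding H_def using lw by (rule remove_sings_analytic_at)
    moreover have "H w = \<beta> powi n * \<alpha> powi m * L" unfolding H_def using lw by (rule remove_sings_eqI)
    ultimately show ?thesis using \<alpha> \<beta> by (simp add: norm_mult norm_power_int)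
  qed
  have "H analytic_on {w}" for w
  proof (cases "w \<in> period_lattice \<tau>")
    case False
    then have "G analytic_on {w}" using ana by (auto intro: analytic_on_subset)
    then show ?thesis unfolding H_def by (rule remove_sings_analytic_on)
  qed (use H_lat in auto)
  then have "H analytic_on UNIV" using analytic_on_analytic_at by blast
  then have hol: "H holomorphic_on UNIV" by (rule analytic_imp_holomorphic)
  \<comment> \<open>The closed parallelogram is compact but contains lattice points. There only the
    norm of \<open>H\<close> is controlled, by \<open>norm L\<close>, which is bounded through the
    point 0 of P.\<close>
  define P where "P = (\<lambda>(s,t). of_real s + of_real t * \<tau>) ` ({0..1} \<times> {0..1})"
  have "compact P" unfolding P_def case_prod_unfold
    by (intro compact_continuous_image compact_Times continuous_intros) auto
  then have "compact (H ` P)"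
    by (intro compact_continuous_image continuous_on_subset[OF holomorphic_on_imp_continuous_on[OF hol]]) auto
  then obtain B where B: "\<And>z. z \<in> P \<Longrightarrow> norm (H z) \<le> B"
    using compact_imp_bounded bounded_iff by (metis imageI)
  have "0 \<in> P" unfolding P_def by (force simp: image_iff)
  moreover have "0 \<in> period_lattice \<tau>" unfolding period_lattice_def by (auto intro!: exI[of _ 0])
  ultimately have LB: "norm L \<le> B" using B[of 0] H_lat[of 0] by auto
  have "norm (H z) \<le> B" for z
  proof (cases "z \<in> period_lattice \<tau>")
    case True
    then show ?thesis using H_lat[of z] LB by auto
  next
    case False
    obtain s t :: real and m n :: int where st: "0 \<le> s" "s \<le> 1" "0 \<le> t" "t \<le> 1"
      "z = (of_real s + of_real t * \<tau>) + of_int m + of_int n * \<tau>" using lattice_reduce[OF \<tau>] by metis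
    define z0 where "z0 = of_real s + of_real t * \<tau>"
    have z0: "z0 \<notin> period_lattice \<tau>" using False st(5) period_lattice_shift[of z0 m n \<tau>] by (simp add: z0_def)
    have "norm (H z) = norm (G z0)"
      using H_off[OF False] G_shift[of z0 m n] \<alpha> \<beta> by (simp add: st(5) z0_def norm_mult norm_power_int)
    also have "\<dots> = norm (H z0)" using H_off[OF z0] by simp
    also have "\<dots> \<le> B" by (rule B) (use st in \<open>auto simp: P_def z0_def intro!: image_eqI[of _ _ "(s, t)"]\<close>)
    finally show ?thesis .
  qed
  then have "bounded (range H)" by (auto simp: bounded_iff)
  from Liouville_theorem[OF hol this] obtain K where K: "\<And>z. H z = K" by (auto simp: constant_on_def)
  \<comment> \<open>A point off the lattice at which G can be compared with its two translates; this
    yields the two equations for K.\<close>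
  have half: "1/2 \<notin> period_lattice \<tau>"
  proof
    assume "1/2 \<in> period_lattice \<tau>"
    then obtain m n :: int where mn: "1/2 = of_int m + of_int n * \<tau>" by (auto simp: period_lattice_def)
    then have "n = 0" using \<tau> by (auto simp: complex_eq_iff)
    then have "1 = 2 * real_of_int m" using arg_cong[OF mn, of Re] by simp
    then have "1 = 2 * m" by linarith
    then show False by presburger
  qed
  have GK: "G z = K" if "z \<notin> period_lattice \<tau>" for z using H_off[OF that] K by simp
  have "G (1/2 + 1) = K" "G (1/2 + \<tau>) = K"
    using GK period_lattice_shift[of "1/2" 1 0 \<tau>] period_lattice_shift[of "1/2" 0 1 \<tau>] half by auto
  then have "\<alpha> * K = K" "\<beta> * K = K" using G1[of "1/2"] G\<tau>[of "1/2"] GK[OF half] by auto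
  with GK that show ?thesis by blast
qed

text \<open>The continuation forced by the shift rule: moving up n strips contributes
  \<open>lam powi (- n)\<close> and n defects. The defects simply add up, because a nonzero defect
  means lam = 1.\<close>

definition lattice_kernel :: "real \<Rightarrow> complex \<Rightarrow> complex \<Rightarrow> complex \<Rightarrow> complex" where
  "lattice_kernel r lam \<tau> z =
     (let n = \<lfloor>Im z / Im \<tau>\<rfloor> in
        lam powi (- n) * strip_kernel r lam \<tau> (z - of_int n * \<tau>) + of_int n * kernel_defect r lam)"

text \<open>The floor selects the upper half of an open strip, and \<open>strip_kernel_shift\<close>
  extends the formula to the lower half. Neighbouring open strips now overlap, which is what gives
  analyticity across the lines where the floor jumps.\<close>

lemma lattice_kernel_eq:
  assumes lam: "norm lam = 1" and r: "0 \<le> r" "r < 1" and z: "\<bar>Im z - of_int n * Im \<tau>\<bar> < Im \<tau>"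
  shows "lattice_kernel r lam \<tau> z =
    lam powi (- n) * strip_kernel r lam \<tau> (z - of_int n * \<tau>) + of_int n * kernel_defect r lam"
proof (cases "0 \<le> Im z - of_int n * Im \<tau>")
  case True
  have "\<lfloor>Im z / Im \<tau>\<rfloor> = n" using z True by (intro floor_unique) (auto simp: field_simps)
  then show ?thesis by (simp add: lattice_kernel_def)
next
  case False
  have lam0: "lam \<noteq> 0" using lam by auto
  have fl: "\<lfloor>Im z / Im \<tau>\<rfloor> = n - 1" using z False by (intro floor_unique) (auto simp: field_simps)
  have eq: "z - of_int (n - 1) * \<tau> = (z - of_int n * \<tau>) + \<tau>" by (simp add: algebra_simps)
  have sk: "strip_kernel r lam \<tau> ((z - of_int n * \<tau>) + \<tau>) = inverse lam * strip_kernel r lam \<tau> (z - of_int n * \<tau>) + kernel_defect r lam"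
    by (rule strip_kernel_shift) (use assms False in auto)
  have p: "lam powi (- (n - 1)) = lam powi (- n) * lam"
    using lam0 power_int_add_1[of lam "- n"] by (simp add: mult.commute)
  have d: "lam powi (- n) * lam * kernel_defect r lam = kernel_defect r lam"
    by (simp add: kernel_defect_def)
  have "lattice_kernel r lam \<tau> z = lam powi (- n) * lam * (inverse lam * strip_kernel r lam \<tau> (z - of_int n * \<tau>) + kernel_defect r lam) + of_int (n - 1) * kernel_defect r lam"
    unfolding lattice_kernel_def Let_def fl eq sk p ..
  also have "\<dots> = lam powi (- n) * (lam * inverse lam) * strip_kernel r lam \<tau> (z - of_int n * \<tau>)
      + lam powi (- n) * lam * kernel_defect r lam + of_int (n - 1) * kernel_defect r lam"
    by (simp only: ring_distribs mult.assoc)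
  finally show ?thesis unfolding d using lam0 by (simp add: left_diff_distrib)
qed

lemma qpow_int_1 [simp]: "qpow (of_int m) 1 = 1"
proof -
  have "qpow (of_int m) 1 = exp (complex_of_real (2 * of_int m * pi) * \<i>)"
    by (simp add: qpow_def mult_ac)
  also have "\<dots> = 1" by (subst exp_eq_1) auto
  finally show ?thesis .
qed

lemma qpow_1_eq_1_iff: "qpow z 1 = 1 \<longleftrightarrow> (\<exists>m::int. z = of_int m)"
proof
  assume "qpow z 1 = 1"
  then have "Re (2 * pi * \<i> * z) = 0 \<and> (\<exists>n::int. Im (2 * pi * \<i> * z) = of_int (2 * n) * pi)"
    unfolding qpow_def by (subst (asm) exp_eq_1) simp
  then obtain n :: int where "Im z = 0" "2 * pi * Re z = of_int (2 * n) * pi" by auto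
  then have "z = of_int n" by (auto simp: complex_eq_iff)
  then show "\<exists>m::int. z = of_int m" ..
qed auto

text \<open>The translation changes the floor by exactly n and leaves a horizontal shift by m, which
  only the factor \<open>qpow z r\<close> detects. The identity therefore holds at lattice points
  too, as \<open>quasi_elliptic_const\<close> expects.\<close>

lemma lattice_kernel_shift:
  assumes "0 < Im \<tau>" "norm lam = 1"
  shows "lattice_kernel r lam \<tau> (z + of_int m + of_int n * \<tau>) =
    qpow 1 r powi m * lam powi (- n) * lattice_kernel r lam \<tau> z + of_int n * kernel_defect r lam"
proof -
  have lam0: "lam \<noteq> 0" using assms by auto
  define N where "N = \<lfloor>Im z / Im \<tau>\<rfloor>"
  have fl: "\<lfloor>Im (z + of_int m + of_int n * \<tau>) / Im \<tau>\<rfloor> = N + n"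
    using assms(1) by (simp add: N_def add_divide_distrib)
  have sk: "strip_kernel r lam \<tau> (w + of_int m) = qpow 1 r powi m * strip_kernel r lam \<tau> w" for w
    unfolding strip_kernel_def qpow_add_left
    using qpow_of_int_mult[of m 1 r] by simp
  have eq: "z + of_int m + of_int n * \<tau> - of_int (N + n) * \<tau> = (z - of_int N * \<tau>) + of_int m"
    by (simp add: algebra_simps)
  have "lattice_kernel r lam \<tau> (z + of_int m + of_int n * \<tau>) = lam powi (- (N + n)) * (qpow 1 r powi m * strip_kernel r lam \<tau> (z - of_int N * \<tau>))
     + of_int (N + n) * kernel_defect r lam"
    unfolding lattice_kernel_def Let_def fl eq sk ..
  also have "\<dots> = qpow 1 r powi m * lam powi (- n) * (lam powi (- N) * strip_kernel r lam \<tau> (z - of_int N * \<tau>) + of_int N * kernel_defect r lam)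
     + of_int n * kernel_defect r lam"
    using lam0 by (auto simp: kernel_defect_def power_int_diff power_int_minus power_int_add field_simps)
  also have "lam powi (- N) * strip_kernel r lam \<tau> (z - of_int N * \<tau>) + of_int N * kernel_defect r lam = lattice_kernel r lam \<tau> z"
    by (simp only: lattice_kernel_def N_def Let_def)
  finally show ?thesis .
qed

lemma lattice_kernel_analytic:
  assumes lam: "norm lam = 1" and r: "0 \<le> r" "r < 1" and \<tau>: "0 < Im \<tau>"
  shows "lattice_kernel r lam \<tau> analytic_on - period_lattice \<tau>"
  unfolding analytic_on_analytic_at[of _ "- _"]
proof
  fix z assume z: "z \<in> - period_lattice \<tau>"
  define n where "n = \<lfloor>Im z / Im \<tau>\<rfloor>"
  define U where "U = {w. \<bar>Im w - of_int n * Im \<tau>\<bar> < Im \<tau>} \<inter> {w. qpow (w - of_int n * \<tau>) 1 \<noteq> 1}"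
  have "real_of_int n \<le> Im z / Im \<tau>" "Im z / Im \<tau> < real_of_int n + 1" by (auto simp: n_def)
  then have "\<bar>Im z - of_int n * Im \<tau>\<bar> < Im \<tau>" using \<tau> by (auto simp: field_simps)
  moreover have "qpow (z - of_int n * \<tau>) 1 \<noteq> 1"
  proof
    assume "qpow (z - of_int n * \<tau>) 1 = 1"
    then obtain m :: int where "z - of_int n * \<tau> = of_int m" by (auto simp: qpow_1_eq_1_iff)
    then have "z = of_int m + of_int n * \<tau>" by (simp add: algebra_simps)
    then show False using z unfolding period_lattice_def by blast
  qed
  ultimately have zU: "z \<in> U" by (simp add: U_def)
  have oU: "open U" unfolding U_def qpow_def
    by (intro open_Int open_Collect_less open_Collect_neq continuous_intros)
  have h1: "(\<lambda>w. strip_kernel r lam \<tau> (w - of_int n * \<tau>)) holomorphic_on U"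
    by (rule holomorphic_on_compose_gen[OF _ strip_kernel_holomorphic[OF lam r], of "\<lambda>w. w - of_int n * \<tau>", unfolded o_def])
       (auto simp: U_def intro!: holomorphic_intros)
  have "(\<lambda>w. lam powi (- n) * strip_kernel r lam \<tau> (w - of_int n * \<tau>) + of_int n * kernel_defect r lam) holomorphic_on U"
    by (intro holomorphic_intros h1)
  then have "lattice_kernel r lam \<tau> holomorphic_on U"
    by (rule holomorphic_transform) (use lattice_kernel_eq[OF lam r] in \<open>auto simp: U_def\<close>)
  then show "lattice_kernel r lam \<tau> analytic_on {z}"
    using oU zU analytic_at by blast
qed

section \<open>Taylor coefficients of the kernel at the origin\<close>

lemma subdegree_fps_exp_1_minus_1: "subdegree (fps_exp (1::'a::field_char_0) - 1) = 1"
  by (intro subdegreeI) auto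

lemma subdegree_fps_X_mult_exp: "subdegree (fps_X * fps_exp (x::'a::field_char_0)) = 1"
  by (intro subdegreeI) auto

lemma fps_exp_1_minus_1_nonzero: "fps_exp (1::'a::field_char_0) - 1 \<noteq> 0"
  using subdegree_fps_exp_1_minus_1 by (metis subdegree_0 zero_neq_one)

text \<open>\<open>bernpoly\<close> is read off a real Laurent series, whereas the expansion is that
  of a complex function. Multiplication by \<open>e^X - 1\<close> characterizes the series, and this
  identity embeds coefficientwise into the complex numbers.\<close>

lemma bernpoly_expansion:
  "(\<lambda>u. if u = 0 then 1 else u * exp (of_real r * u) / (exp u - 1)) has_fps_expansion
     Abs_fps (\<lambda>n. of_real (bernpoly n r / fact n) :: complex)"
proof -
  define B where "B = fps_X * fps_exp r / (fps_exp 1 - 1)"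
  note sd = subdegree_fps_exp_1_minus_1 and sdX = subdegree_fps_X_mult_exp and nz = fps_exp_1_minus_1_nonzero
  have B: "bernpoly n r = fact n * fps_nth B n" for n
    unfolding bernpoly_def B_def fps_X_to_fls [symmetric] fls_times_fps_to_fls [symmetric]
    by (subst fls_divide_fps_to_fls) (simp only: sd sdX order.refl, simp)
  have "B * (fps_exp 1 - 1) = fps_X * fps_exp r"
    unfolding B_def by (rule dvd_div_mult_self) (rule fps_dvd_iff[THEN iffD2], rule nz, simp, simp only: sd sdX order.refl)
  then have re: "(\<Sum>i=0..n. fps_nth B i * fps_nth (fps_exp 1 - 1) (n - i)) = fps_nth (fps_X * fps_exp r) n" for n
    by (simp only: fps_mult_nth [symmetric])
  define C where "C = Abs_fps (\<lambda>n. complex_of_real (fps_nth B n))"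
  have e: "fps_nth (fps_exp 1 - 1) k = complex_of_real (fps_nth (fps_exp 1 - 1) k)" for k
    by auto
  have "C * (fps_exp 1 - 1) = fps_X * fps_exp (of_real r)"
  proof (rule fps_ext)
    fix n
    have "fps_nth (C * (fps_exp 1 - 1)) n = of_real (\<Sum>i=0..n. fps_nth B i * fps_nth (fps_exp 1 - 1) (n - i))"
      unfolding fps_mult_nth C_def fps_nth_Abs_fps e by simp
    also have "\<dots> = fps_nth (fps_X * fps_exp (of_real r)) n"
      unfolding re by (auto simp: fps_exp_def)
    finally show "fps_nth (C * (fps_exp 1 - 1)) n = fps_nth (fps_X * fps_exp (of_real r)) n" .
  qed
  then have C: "C = fps_X * fps_exp (of_real r) / (fps_exp 1 - 1)"
    using nz by (metis nonzero_mult_div_cancel_right)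
  have "(\<lambda>u. if u = 0 then 1 else u * exp (of_real r * u) / (exp u - 1)) has_fps_expansion
      (fps_X * fps_exp (complex_of_real r) / (fps_exp 1 - 1))"
  proof (rule has_fps_expansion_divide, goal_cases)
    case 3 show ?case unfolding sd sdX by simp
  next
    case 4 show ?case by (rule nz)
  next
    case 5 show ?case unfolding sd by simp
  qed (intro fps_expansion_intros)+
  then show ?thesis unfolding C [symmetric] C_def by (simp add: B)
qed

text \<open>The factor u removes the simple pole of the kernel; it is also why index k carries
  moments of order k - 1. The value -1 at 0 is the limit of \<open>u / (1 - exp u)\<close> and
  matches \<open>Q_0 = -1\<close>.\<close>

lemma strip_kernel_expansion:
  assumes lam: "norm lam = 1" and r: "0 \<le> r" "r < 1" and \<tau>: "0 < Im \<tau>"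
  shows "(\<lambda>u. (if u = 0 then -1 else u * exp (of_real r * u) / (1 - exp u))
      + u * (\<Sum>n. lambert_coeff lam \<tau> r n * exp (of_real (real n + r) * u))
      - u * (\<Sum>n. lambert_coeff (inverse lam) \<tau> (1 - r) n * exp (of_real (real n + (1 - r)) * (- u))))
    has_fps_expansion Abs_fps (\<lambda>k. Qf k r lam \<tau>)"
proof -
  define A where "A n = lambert_coeff lam \<tau> r n" for n
  define B where "B n = lambert_coeff (inverse lam) \<tau> (1 - r) n" for n
  have il: "norm (inverse lam) = 1" using lam by (simp add: norm_inverse)
  obtain C1 where C1: "\<And>n. norm (A n) \<le> C1 * norm (qpow \<tau> 1) ^ n"
    unfolding A_def using lambert_term_bound[OF lam \<tau> r(1)] by metis
  obtain C2 where C2: "\<And>n. norm (B n) \<le> C2 * norm (qpow \<tau> 1) ^ n"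
    unfolding B_def using lambert_term_bound[OF il \<tau>, of "1 - r"] r by (metis diff_ge_0_iff_ge less_imp_le)
  have q: "0 \<le> norm (qpow \<tau> 1)" "norm (qpow \<tau> 1) < 1" using \<tau> by (auto simp: norm_qpow_less_1)
  have 1: "(\<lambda>u. if u = 0 then -1 else u * exp (of_real r * u) / (1 - exp u)) has_fps_expansion
     - Abs_fps (\<lambda>n. of_real (bernpoly n r / fact n) :: complex)"
  proof -
    have "(\<lambda>u. - (if u = 0 then 1 else u * exp (of_real r * u) / (exp u - 1))) has_fps_expansion
      - Abs_fps (\<lambda>n. of_real (bernpoly n r / fact n) :: complex)"
      by (intro has_fps_expansion_minus bernpoly_expansion)
    also have "(\<lambda>u. - (if u = 0 then 1 else u * exp (of_real r * u) / (exp u - 1))) =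
      (\<lambda>u::complex. if u = 0 then -1 else u * exp (of_real r * u) / (1 - exp u))"
      by (auto simp: fun_eq_iff minus_divide_right)
    finally show ?thesis .
  qed
  have "(\<lambda>u. if u = 0 then -1 else u * exp (of_real r * u) / (1 - exp u)) 0 = fps_nth (- Abs_fps (\<lambda>n. of_real (bernpoly n r / fact n) :: complex)) 0"
    by (rule has_fps_expansion_imp_0_eq_fps_nth_0[OF 1])
  then have "complex_of_real (bernpoly 0 r) = complex_of_real 1" by (simp add: equation_minus_iff)
  then have b0: "bernpoly 0 r = 1" unfolding of_real_eq_iff .
  note 2 = exponential_sum_expansion[OF C1 q r(1)]
  have 3: "(\<lambda>t. \<Sum>n. B n * exp (of_real (real n + (1 - r)) * t)) has_fps_expansion
           Abs_fps (\<lambda>k. (\<Sum>n. B n * of_real ((real n + (1 - r)) ^ k)) / fact k)" (is "?f has_fps_expansion ?F")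
    by (rule exponential_sum_expansion[OF C2 q]) (use r in auto)
  \<comment> \<open>The second series is evaluated at -u. Together with the leading minus sign and
    the factor u this produces the sign \<open>(-1) ^ k\<close> of \<open>Qf\<close>.\<close>
  have "(?f \<circ> (\<lambda>u. - u)) has_fps_expansion fps_compose ?F (- fps_X)"
    by (intro has_fps_expansion_compose 3 fps_expansion_intros) simp
  then have three_neg: "(\<lambda>u. ?f (- u)) has_fps_expansion fps_compose ?F (- fps_X)" by (simp add: o_def)
  have "(\<lambda>u. (if u = 0 then -1 else u * exp (of_real r * u) / (1 - exp u))
      + u * (\<Sum>n. A n * exp (of_real (real n + r) * u))
      - u * ?f (- u)) has_fps_expansion
     (- Abs_fps (\<lambda>n. of_real (bernpoly n r / fact n) :: complex)
       + fps_X * Abs_fps (\<lambda>k. (\<Sum>n. A n * of_real ((real n + r) ^ k)) / fact k)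
       - fps_X * fps_compose ?F (- fps_X))" (is "_ has_fps_expansion ?G")
    by (intro fps_expansion_intros 1 2 three_neg)
  also have "?G = Abs_fps (\<lambda>k. Qf k r lam \<tau>)"
  proof (rule fps_ext)
    fix k
    have cn: "fps_nth (fps_compose ?F (- fps_X)) j = (-1) ^ j * fps_nth ?F j" for j
      using fps_nth_compose_linear[of ?F "-1" j] by (simp only: fps_const_neg [symmetric] fps_const_1_eq_1) simp
    show "fps_nth ?G k = fps_nth (Abs_fps (\<lambda>k. Qf k r lam \<tau>)) k"
    proof (cases k)
      case 0
      then show ?thesis by (simp add: Qf_def b0)
    next
      case (Suc j)
      have a: "lam * of_real ((real n + r) ^ j) * qpow \<tau> (real n + r) / (1 - lam * qpow \<tau> (real n + r)) = A n * of_real ((real n + r) ^ j)" for n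
        by (simp add: A_def lambert_term_def mult_ac)
      have e: "real (Suc n) - r = real n + (1 - r)" for n by simp
      have b: "inverse lam * of_real ((real (Suc n) - r) ^ j) * qpow \<tau> (real (Suc n) - r) / (1 - inverse lam * qpow \<tau> (real (Suc n) - r)) = B n * of_real ((real n + (1 - r)) ^ j)" for n
        unfolding e B_def lambert_term_def by (simp only: times_divide_eq_left times_divide_eq_right mult_ac)
      have "Qf k r lam \<tau> = 1 / fact j * (\<Sum>n. A n * of_real ((real n + r) ^ j))
        + (-1) ^ Suc j / fact j * (\<Sum>n. B n * of_real ((real n + (1 - r)) ^ j)) - of_real (bernpoly k r / fact k)"
        unfolding Qf_def Suc diff_Suc_1 a b by simp
      then show ?thesis by (simp add: Suc cn del: of_real_add of_real_power of_real_diff) simp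
    qed
  qed
  finally show ?thesis unfolding A_def B_def .
qed

lemma lattice_kernel_expansion:
  assumes lam: "norm lam = 1" and r: "0 \<le> r" "r < 1" and \<tau>: "0 < Im \<tau>"
  shows "(\<lambda>z. if z = 0 then -1 else 2 * pi * \<i> * z * lattice_kernel r lam \<tau> z) has_fps_expansion
    Abs_fps (\<lambda>k. Qf k r lam \<tau> * (2 * pi * \<i>) ^ k)"
proof -
  define F where "F u = (if u = 0 then -1 else u * exp (of_real r * u) / (1 - exp u))
      + u * (\<Sum>n. lambert_coeff lam \<tau> r n * exp (of_real (real n + r) * u))
      - u * (\<Sum>n. lambert_coeff (inverse lam) \<tau> (1 - r) n * exp (of_real (real n + (1 - r)) * (- u)))" for u
  have F: "F has_fps_expansion Abs_fps (\<lambda>k. Qf k r lam \<tau>)"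
    unfolding F_def by (rule strip_kernel_expansion[OF assms])
  have "(F \<circ> (\<lambda>z. 2 * pi * \<i> * z)) has_fps_expansion fps_compose (Abs_fps (\<lambda>k. Qf k r lam \<tau>)) (fps_const (2 * pi * \<i>) * fps_X)"
    by (intro has_fps_expansion_compose F fps_expansion_intros) simp
  also have "fps_compose (Abs_fps (\<lambda>k. Qf k r lam \<tau>)) (fps_const (2 * pi * \<i>) * fps_X) = Abs_fps (\<lambda>k. Qf k r lam \<tau> * (2 * pi * \<i>) ^ k)"
    unfolding fps_compose_linear by (simp add: mult.commute)
  finally have G: "(F \<circ> (\<lambda>z. 2 * pi * \<i> * z)) has_fps_expansion Abs_fps (\<lambda>k. Qf k r lam \<tau> * (2 * pi * \<i>) ^ k)" .
  have near: "F (2 * pi * \<i> * z) = (if z = 0 then -1 else 2 * pi * \<i> * z * lattice_kernel r lam \<tau> z)"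
    if z: "\<bar>Im z\<bar> < Im \<tau>" for z
  proof (cases "z = 0")
    case True
    then show ?thesis by (simp add: F_def)
  next
    case False
    define u where "u = 2 * pi * \<i> * z"
    have u: "u \<noteq> 0" using False by (simp add: u_def)
    have e: "exp (of_real x * u) = qpow z x" for x by (simp add: qpow_def u_def mult_ac)
    have eu: "exp u = qpow z 1" using e[of 1] by simp
    have e1: "exp (of_real (real n + r) * u) = qpow z r * qpow z 1 ^ n" for n
      unfolding e qpow_add_right qpow_of_nat by (rule mult.commute)
    have e2: "exp (of_real (real n + (1 - r)) * - u) = qpow z r * (inverse (qpow z 1) ^ n * inverse (qpow z 1))" for n
    proof -
      have "exp (of_real (real n + (1 - r)) * - u) = qpow z (r + - (real n + 1))"
        by (simp add: e [symmetric] algebra_simps)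
      also have "\<dots> = qpow z r * inverse (qpow z 1 ^ n * qpow z 1)"
        unfolding qpow_add_right[of _ r] qpow_uminus_right by (simp add: qpow_add_right qpow_of_nat)
      finally show ?thesis by (simp add: power_inverse)
    qed
    have il: "norm (inverse lam) = 1" using lam by (simp add: norm_inverse)
    have s1: "summable (\<lambda>n. lambert_coeff lam \<tau> r n * qpow z 1 ^ n)"
      by (rule lambert_power_series[OF lam \<tau> r(1) strip_bounds(1)[OF z]])
    have s2: "summable (\<lambda>n. lambert_coeff (inverse lam) \<tau> (1 - r) n * inverse (qpow z 1) ^ n)"
      by (rule lambert_power_series[OF il \<tau> _ strip_bounds(2)[OF z]]) (use r in simp)
    have t1: "(\<Sum>n. lambert_coeff lam \<tau> r n * exp (of_real (real n + r) * u))
        = qpow z r * (\<Sum>n. lambert_coeff lam \<tau> r n * qpow z 1 ^ n)"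
      unfolding e1 using suminf_mult[OF s1, of "qpow z r"] by (simp only: mult_ac)
    have t2: "(\<Sum>n. lambert_coeff (inverse lam) \<tau> (1 - r) n * exp (of_real (real n + (1 - r)) * - u))
        = qpow z r * inverse (qpow z 1) * (\<Sum>n. lambert_coeff (inverse lam) \<tau> (1 - r) n * inverse (qpow z 1) ^ n)"
      unfolding e2 using suminf_mult[OF s2, of "qpow z r * inverse (qpow z 1)"] by (simp only: mult_ac)
    have "F u = u * strip_kernel r lam \<tau> z"
      unfolding F_def t1 t2 unfolding e eu strip_kernel_def using u by (simp add: algebra_simps)
    \<comment> \<open>Below the real axis the floor index is -1, but
      \<open>lattice_kernel_eq\<close> admits n = 0 on the whole strip around the axis.\<close>
    moreover have "strip_kernel r lam \<tau> z = lattice_kernel r lam \<tau> z"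
      using lattice_kernel_eq[OF lam r, of z 0 \<tau>] z by simp
    ultimately show ?thesis using False by (simp add: u_def)
  qed
  have near_0: "\<forall>\<^sub>F z in nhds 0. \<bar>Im z\<bar> < Im \<tau>"
  proof -
    have "((\<lambda>z. \<bar>Im z\<bar>) \<longlongrightarrow> \<bar>Im 0\<bar>) (nhds 0)" by (intro tendsto_intros filterlim_ident)
    then show ?thesis by (rule order_tendstoD) (use \<tau> in simp)
  qed
  have "\<forall>\<^sub>F z in nhds 0. (F \<circ> (\<lambda>z. 2 * pi * \<i> * z)) z = (if z = 0 then -1 else 2 * pi * \<i> * z * lattice_kernel r lam \<tau> z)"
    using near_0 unfolding o_def by (rule eventually_mono) (rule near)
  from has_fps_expansion_cong[OF this refl, THEN iffD1, OF G] show ?thesis .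
qed

section \<open>Modular transformation\<close>

lemma moebius_denominator_nonzero:
  assumes "0 < Im \<tau>" "a * d - b * c = (1::int)"
  shows "of_int c * \<tau> + of_int d \<noteq> 0"
proof
  assume "of_int c * \<tau> + of_int d = 0"
  then have "real_of_int c * Im \<tau> = 0" "real_of_int c * Re \<tau> + real_of_int d = 0" by (auto simp: complex_eq_iff)
  then have "c = 0" "d = 0" using assms(1) by auto
  then show False using assms(2) by simp
qed

lemma Im_moebius:
  assumes "0 < Im \<tau>" "a * d - b * c = 1"
  shows "0 < Im (moebius a b c d \<tau>)"
proof -
  define J where "J = of_int c * \<tau> + of_int d"
  have J: "J \<noteq> 0" using moebius_denominator_nonzero[OF assms] by (simp add: J_def)
  have det: "real_of_int a * of_int d - of_int b * of_int c = 1"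
    using arg_cong[OF assms(2), of real_of_int] by simp
  have "moebius a b c d \<tau> = (of_int a * \<tau> + of_int b) * cnj J / of_real ((norm J)\<^sup>2)"
    unfolding moebius_def J_def [symmetric] complex_norm_square[of J] using J by simp
  then have "Im (moebius a b c d \<tau>) = Im ((of_int a * \<tau> + of_int b) * cnj J) / (norm J)\<^sup>2"
    by (simp only: Im_divide_of_real)
  also have "Im ((of_int a * \<tau> + of_int b) * cnj J) = (real_of_int a * of_int d - of_int b * of_int c) * Im \<tau>"
    by (simp add: J_def algebra_simps)
  finally show ?thesis using J det assms(1) by simp
qed

lemma qpow_1_left_eq_1:
  assumes "0 \<le> r" "r < 1" "qpow 1 r = 1"
  shows "r = 0"
proof -
  have "exp (2 * pi * \<i> * 1 * of_real r) = (1::complex)" using assms(3) by (simp add: qpow_def)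
  then obtain n :: int where "Im (2 * pi * \<i> * 1 * of_real r) = of_int (2 * n) * pi"
    by (subst (asm) exp_eq_1) blast
  then have r: "r = of_int n" by simp
  then have "n = 0" using assms by linarith
  then show ?thesis using r by simp
qed

text \<open>The exponents of (x, y) are transformed by a matrix and by its inverse, so they multiply
  to the identity matrix.\<close>

lemma character_inverse:
  fixes x y :: "'a::field"
  assumes "x \<noteq> 0" "y \<noteq> 0" "a * d - b * c = 1"
  shows "(x powi d * y powi (- c)) powi a * (x powi (- b) * y powi a) powi c = x"
    and "(x powi d * y powi (- c)) powi b * (x powi (- b) * y powi a) powi d = y"
proof -
  have "(x powi d * y powi (- c)) powi a * (x powi (- b) * y powi a) powi c
     = (x powi (d * a) * x powi (- b * c)) * (y powi (- c * a) * y powi (a * c))"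
    by (simp only: power_int_mult_distrib power_int_mult [symmetric] mult_ac)
  also have "\<dots> = x powi (d * a + - b * c) * y powi (- c * a + a * c)"
    using assms by (simp add: power_int_add [symmetric])
  also have "d * a + - b * c = 1" using assms(3) by (simp add: algebra_simps)
  also have "- c * a + a * c = 0" by simp
  finally show "(x powi d * y powi (- c)) powi a * (x powi (- b) * y powi a) powi c = x" by simp
  have "(x powi d * y powi (- c)) powi b * (x powi (- b) * y powi a) powi d
     = (x powi (d * b) * x powi (- b * d)) * (y powi (- c * b) * y powi (a * d))"
    by (simp only: power_int_mult_distrib power_int_mult [symmetric] mult_ac)
  also have "\<dots> = x powi (d * b + - b * d) * y powi (- c * b + a * d)"
    using assms by (simp add: power_int_add [symmetric])
  also have "- c * b + a * d = 1" using assms(3) by (simp add: algebra_simps)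
  also have "d * b + - b * d = 0" by simp
  finally show "(x powi d * y powi (- c)) powi b * (x powi (- b) * y powi a) powi d = y" by simp
qed

text \<open>Both generating functions, rescaled by \<open>c \<tau> + d\<close>, have the same multipliers and the same
  simple poles, so their difference (corrected by a linear term for trivial multipliers) is constant;
  the identities are the Taylor coefficients at 0.\<close>
lemma Qf_modular:
  assumes \<tau>: "0 < Im \<tau>" and det: "a * d - b * c = 1"
    and lam: "norm lam = 1" "norm lam' = 1" and r: "0 \<le> r" "r < 1" "0 \<le> r'" "r' < 1"
    and mu': "qpow 1 r' = qpow 1 r powi d * lam powi (- c)"
    and lam': "lam' = qpow 1 r powi (- b) * lam powi a"
  obtains K where "\<And>k. Qf k r' lam' (moebius a b c d \<tau>) = (of_int c * \<tau> + of_int d) ^ k * Qf k r lam \<tau>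
      + (if k = 1 then K else 0)
      - (if k = 2 then kernel_defect r lam * of_int c * (of_int c * \<tau> + of_int d) / (2 * pi * \<i>) else 0)"
    "r \<noteq> 0 \<or> lam \<noteq> 1 \<Longrightarrow> K = 0"
proof -
  define J where "J = of_int c * \<tau> + of_int d"
  define \<tau>' where "\<tau>' = moebius a b c d \<tau>"
  define \<delta> where "\<delta> = kernel_defect r lam"
  have J: "J \<noteq> 0" using moebius_denominator_nonzero[OF \<tau> det] by (simp add: J_def)
  have \<tau>': "0 < Im \<tau>'" using Im_moebius[OF \<tau> det] by (simp add: \<tau>'_def)
  have detc: "of_int a * of_int d - of_int b * of_int c = (1::complex)"
    using arg_cong[OF det, of complex_of_int] by simp
  have J\<tau>': "\<tau>' * J = of_int a * \<tau> + of_int b"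
    using J by (simp add: \<tau>'_def moebius_def J_def)
  \<comment> \<open>Division by J carries the periods 1 and \<tau> to vectors of the lattice of
    \<tau>'. Their coordinates, entries of the inverse matrix, become the exponents of the
    multipliers.\<close>
  have per1: "1 / J = of_int a - of_int c * \<tau>'"
  proof -
    have "(of_int a - of_int c * \<tau>') * J = of_int a * J - of_int c * (\<tau>' * J)" by (simp add: algebra_simps)
    also have "\<dots> = 1" unfolding J\<tau>' using detc by (simp add: J_def algebra_simps)
    finally show ?thesis using J by (simp add: field_simps)
  qed
  have per\<tau>: "\<tau> / J = of_int d * \<tau>' - of_int b"
  proof -
    have "(of_int d * \<tau>' - of_int b) * J = of_int d * (\<tau>' * J) - of_int b * J" by (simp add: algebra_simps)
    also have "\<dots> = (of_int a * of_int d - of_int b * of_int c) * \<tau>" unfolding J\<tau>' by (simp add: J_def algebra_simps)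
    finally show ?thesis using J detc by (simp add: field_simps)
  qed
  define mu where "mu = qpow 1 r"
  have mu: "norm mu = 1" "mu \<noteq> 0" by (simp_all add: mu_def norm_qpow)
  have lam0: "lam \<noteq> 0" using lam by auto
  have ch1: "qpow 1 r' powi a * lam' powi c = mu"
    using character_inverse(1)[OF mu(2) lam0 det] by (simp add: mu' lam' mu_def)
  have ch2: "qpow 1 r' powi b * lam' powi d = lam"
    using character_inverse(2)[OF mu(2) lam0 det] by (simp add: mu' lam' mu_def)
  have trivial_iff: "r' = 0 \<and> lam' = 1 \<longleftrightarrow> r = 0 \<and> lam = 1"
  proof
    assume "r' = 0 \<and> lam' = 1"
    then have "mu = 1" "lam = 1" using ch1 ch2 by auto
    then show "r = 0 \<and> lam = 1" using qpow_1_left_eq_1[OF r(1,2)] by (simp add: mu_def)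
  next
    assume "r = 0 \<and> lam = 1"
    then show "r' = 0 \<and> lam' = 1" using mu' lam' qpow_1_left_eq_1[OF r(3,4)] by simp
  qed
  have \<delta>': "kernel_defect r' lam' = \<delta>" using trivial_iff by (simp add: \<delta>_def kernel_defect_def)
  have \<delta>mu: "mu * \<delta> = \<delta>" "inverse lam * \<delta> = \<delta>" by (auto simp: \<delta>_def kernel_defect_def mu_def)
  define P where "P = lattice_kernel r lam \<tau>"
  define P' where "P' = lattice_kernel r' lam' \<tau>'"
  \<comment> \<open>\<open>P' (z / J)\<close> and \<open>J * P z\<close> both have residue
    \<open>-J / (2 \<pi> i)\<close> at 0, so the pole cancels. The linear function removes the
    additive constants left for trivial multipliers: they are \<open>-c\<close> for the period 1 and
    \<open>d - J = -c \<tau>\<close> for the period \<tau>.\<close>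
  define G where "G z = P' (z / J) - J * P z + \<delta> * of_int c * z" for z
  have lat: "z / J \<in> period_lattice \<tau>' \<Longrightarrow> z \<in> period_lattice \<tau>" for z
  proof -
    assume "z / J \<in> period_lattice \<tau>'"
    then obtain m n :: int where "z / J = of_int m + of_int n * \<tau>'" by (auto simp: period_lattice_def)
    then have "z = of_int m * J + of_int n * (\<tau>' * J)" using J by (simp add: field_simps)
    then have "z = of_int (m * d + n * b) + of_int (m * c + n * a) * \<tau>" unfolding J\<tau>' by (simp add: J_def algebra_simps)
    then show "z \<in> period_lattice \<tau>" unfolding period_lattice_def by blast
  qed
  have G_ana: "G analytic_on - period_lattice \<tau>"
  proof -
    have "(P' \<circ> (\<lambda>z. z / J)) analytic_on - period_lattice \<tau>"
      unfolding P'_def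
      by (rule analytic_on_compose_gen[OF _ lattice_kernel_analytic[OF lam(2) r(3,4) \<tau>']])
         (use J lat in \<open>auto intro!: analytic_intros\<close>)
    then have 1: "(\<lambda>z. P' (z / J)) analytic_on - period_lattice \<tau>" by (simp add: o_def)
    show ?thesis unfolding G_def P_def
      by (intro analytic_intros 1 lattice_kernel_analytic[OF lam(1) r(1,2) \<tau>])
  qed
  have P1: "P (z + 1) = mu * P z" for z
    using lattice_kernel_shift[OF \<tau> lam(1), of r z 1 0] by (simp add: P_def mu_def)
  have P\<tau>: "P (z + \<tau>) = inverse lam * P z + \<delta>" for z
    using lattice_kernel_shift[OF \<tau> lam(1), of r z 0 1] by (simp add: P_def \<delta>_def power_int_minus)
  have P'1: "P' ((z + 1) / J) = mu * P' (z / J) - of_int c * \<delta>" for z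
  proof -
    have "(z + 1) / J = z / J + of_int a + of_int (- c) * \<tau>'" using per1 by (simp add: add_divide_distrib)
    then have "P' ((z + 1) / J) = qpow 1 r' powi a * lam' powi (- (- c)) * P' (z / J) + of_int (- c) * \<delta>"
      unfolding P'_def \<delta>' [symmetric] using lattice_kernel_shift[OF \<tau>' lam(2), of r' "z / J" a "- c"] by simp
    then show ?thesis using ch1 by simp
  qed
  have P'\<tau>: "P' ((z + \<tau>) / J) = inverse lam * P' (z / J) + of_int d * \<delta>" for z
  proof -
    have "(z + \<tau>) / J = z / J + of_int (- b) + of_int d * \<tau>'" using per\<tau> by (simp add: add_divide_distrib)
    then have "P' ((z + \<tau>) / J) = qpow 1 r' powi (- b) * lam' powi (- d) * P' (z / J) + of_int d * \<delta>"
      unfolding P'_def \<delta>' [symmetric] using lattice_kernel_shift[OF \<tau>' lam(2), of r' "z / J" "- b" d] by simp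
    moreover have "qpow 1 r' powi (- b) * lam' powi (- d) = inverse lam"
      unfolding ch2 [symmetric] by (simp add: power_int_minus)
    ultimately show ?thesis by simp
  qed
  have G1: "G (z + 1) = mu * G z" for z
  proof -
    have "G (z + 1) = mu * P' (z / J) - J * (mu * P z) + \<delta> * of_int c * z"
      unfolding G_def P1 P'1 by (simp add: algebra_simps)
    also have "\<dots> = mu * P' (z / J) - J * (mu * P z) + (mu * \<delta>) * of_int c * z" by (simp only: \<delta>mu)
    also have "\<dots> = mu * G z" by (simp add: G_def algebra_simps)
    finally show ?thesis .
  qed
  have G\<tau>: "G (z + \<tau>) = inverse lam * G z" for z
  proof -
    have "G (z + \<tau>) = inverse lam * P' (z / J) - J * (inverse lam * P z) + \<delta> * of_int c * z"
      unfolding G_def P\<tau> P'\<tau> by (simp add: algebra_simps J_def)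
    also have "\<dots> = inverse lam * P' (z / J) - J * (inverse lam * P z) + (inverse lam * \<delta>) * of_int c * z" by (simp only: \<delta>mu)
    also have "\<dots> = inverse lam * G z" by (simp add: G_def algebra_simps)
    finally show ?thesis .
  qed
  define E where "E z = (if z = 0 then -1 else 2 * pi * \<i> * z * P z)" for z
  define E' where "E' z = (if z = 0 then -1 else 2 * pi * \<i> * z * P' z)" for z
  have E: "E has_fps_expansion Abs_fps (\<lambda>k. Qf k r lam \<tau> * (2 * pi * \<i>) ^ k)"
    unfolding E_def P_def by (rule lattice_kernel_expansion[OF lam(1) r(1,2) \<tau>])
  have E': "E' has_fps_expansion Abs_fps (\<lambda>k. Qf k r' lam' \<tau>' * (2 * pi * \<i>) ^ k)"
    unfolding E'_def P'_def by (rule lattice_kernel_expansion[OF lam(2) r(3,4) \<tau>'])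
  \<comment> \<open>A multiple of z times the difference of the two kernels: it is analytic at 0,
    its Taylor coefficients are known, and its derivative there yields the limit of G.\<close>
  define H where "H z = E' (1 / J * z) - E z" for z
  have H: "H has_fps_expansion Abs_fps (\<lambda>k. Qf k r' lam' \<tau>' * (2 * pi * \<i>) ^ k * (1 / J) ^ k - Qf k r lam \<tau> * (2 * pi * \<i>) ^ k)"
  proof -
    have "(E' \<circ> (\<lambda>z. 1 / J * z)) has_fps_expansion fps_compose (Abs_fps (\<lambda>k. Qf k r' lam' \<tau>' * (2 * pi * \<i>) ^ k)) (fps_const (1 / J) * fps_X)"
      by (intro has_fps_expansion_compose E' fps_expansion_intros) simp
    then have "(\<lambda>z. (E' \<circ> (\<lambda>z. 1 / J * z)) z - E z) has_fps_expansion
        fps_compose (Abs_fps (\<lambda>k. Qf k r' lam' \<tau>' * (2 * pi * \<i>) ^ k)) (fps_const (1 / J) * fps_X) - Abs_fps (\<lambda>k. Qf k r lam \<tau> * (2 * pi * \<i>) ^ k)"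
      by (intro has_fps_expansion_diff E)
    also have "(\<lambda>z. (E' \<circ> (\<lambda>z. 1 / J * z)) z - E z) = H" by (simp add: H_def o_def fun_eq_iff)
    also have "fps_compose (Abs_fps (\<lambda>k. Qf k r' lam' \<tau>' * (2 * pi * \<i>) ^ k)) (fps_const (1 / J) * fps_X) - Abs_fps (\<lambda>k. Qf k r lam \<tau> * (2 * pi * \<i>) ^ k)
       = Abs_fps (\<lambda>k. Qf k r' lam' \<tau>' * (2 * pi * \<i>) ^ k * (1 / J) ^ k - Qf k r lam \<tau> * (2 * pi * \<i>) ^ k)"
      unfolding fps_compose_linear by (rule fps_ext) (simp add: mult_ac)
    finally show ?thesis .
  qed
  have H0: "H 0 = 0" by (simp add: H_def E_def E'_def)
  have GH: "G z = J / (2 * pi * \<i>) * (H z / z) + \<delta> * of_int c * z" if "z \<noteq> 0" for z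
    using that J by (simp add: G_def H_def E_def E'_def field_simps)
  obtain D where "(H has_field_derivative D) (at 0)"
    using has_fps_expansion_imp_analytic_0[OF H] analytic_on_imp_differentiable_at field_differentiable_def by blast
  then have "(\<lambda>h. H h / h) \<midarrow>0\<rightarrow> D" unfolding DERIV_def by (simp add: H0)
  then have "(\<lambda>z. J / (2 * pi * \<i>) * (H z / z) + \<delta> * of_int c * z) \<midarrow>0\<rightarrow> J / (2 * pi * \<i>) * D + \<delta> * of_int c * 0"
    by (intro tendsto_intros)
  then have Glim: "G \<midarrow>0\<rightarrow> J / (2 * pi * \<i>) * D + \<delta> * of_int c * 0"
    by (rule Lim_transform_eventually) (use GH in \<open>auto simp: eventually_at intro!: exI[of _ 1]\<close>)
  obtain K where K: "\<And>z. z \<notin> period_lattice \<tau> \<Longrightarrow> G z = K" "mu * K = K" "inverse lam * K = K"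
    by (rule quasi_elliptic_const[OF \<tau> G_ana G1 G\<tau> mu(1) _ Glim]) (use lam in \<open>auto simp: norm_inverse\<close>)
  have "\<forall>\<^sub>F z in at 0. H z = 2 * pi * \<i> / J * (K * z - \<delta> * of_int c * z ^ 2)"
    using eventually_not_period_lattice[OF \<tau>] eventually_neq_at_within[of 0]
  proof eventually_elim
    case (elim z)
    have "J * (H z / z) = (K - \<delta> * of_int c * z) * (2 * pi * \<i>)"
      using GH[OF elim(2)] K(1)[OF elim(1)] by (simp add: field_simps)
    then show ?case using elim(2) J by (simp add: field_simps power2_eq_square)
  qed
  then have ev: "\<forall>\<^sub>F z in nhds 0. H z = 2 * pi * \<i> / J * (K * z - \<delta> * of_int c * z ^ 2)"
    by (subst eventually_nhds_conv_at) (simp add: H0)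
  have "(\<lambda>z. 2 * pi * \<i> / J * (K * z - \<delta> * of_int c * z ^ 2)) has_fps_expansion
      fps_const (2 * pi * \<i> / J) * (fps_const K * fps_X - fps_const (\<delta> * of_int c) * fps_X ^ 2)"
    by (intro fps_expansion_intros)
  then have "H has_fps_expansion fps_const (2 * pi * \<i> / J) * (fps_const K * fps_X - fps_const (\<delta> * of_int c) * fps_X ^ 2)"
    using has_fps_expansion_cong[OF ev refl] by blast
  from fps_expansion_unique_complex[OF H this]
  have eq: "Qf k r' lam' \<tau>' * (2 * pi * \<i>) ^ k * (1 / J) ^ k - Qf k r lam \<tau> * (2 * pi * \<i>) ^ k
     = 2 * pi * \<i> / J * (K * (if k = 1 then 1 else 0) - \<delta> * of_int c * (if k = 2 then 1 else 0))" for k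
    unfolding fps_eq_iff by (simp add: fps_X_power_nth) 
  have Qk: "Qf k r' lam' \<tau>' = J ^ k * Qf k r lam \<tau> + (if k = 1 then K else 0)
      - (if k = 2 then \<delta> * of_int c * J / (2 * pi * \<i>) else 0)" for k
  proof -
    have "Qf k r' lam' \<tau>' * ((2 * pi * \<i>) / J) ^ k = Qf k r lam \<tau> * (2 * pi * \<i>) ^ k
       + 2 * pi * \<i> / J * (K * (if k = 1 then 1 else 0) - \<delta> * of_int c * (if k = 2 then 1 else 0))"
      using eq[of k] by (simp add: power_divide algebra_simps)
    then have "Qf k r' lam' \<tau>' = (J / (2 * pi * \<i>)) ^ k * (Qf k r lam \<tau> * (2 * pi * \<i>) ^ k
       + 2 * pi * \<i> / J * (K * (if k = 1 then 1 else 0) - \<delta> * of_int c * (if k = 2 then 1 else 0)))"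
      using J by (simp add: power_divide field_simps)
    also have "\<dots> = J ^ k * Qf k r lam \<tau> + (J / (2 * pi * \<i>)) ^ k * (2 * pi * \<i> / J * (K * (if k = 1 then 1 else 0) - \<delta> * of_int c * (if k = 2 then 1 else 0)))"
      by (simp add: power_divide ring_distribs)
    also have "(J / (2 * pi * \<i>)) ^ k * (2 * pi * \<i> / J * (K * (if k = 1 then 1 else 0) - \<delta> * of_int c * (if k = 2 then 1 else 0)))
      = (if k = 1 then K else 0) - (if k = 2 then \<delta> * of_int c * J / (2 * pi * \<i>) else 0)"
      using J by (simp add: field_simps power2_eq_square)
    finally show ?thesis by simp
  qed
  show ?thesis
  proof (rule that)
    show "Qf k r' lam' (moebius a b c d \<tau>) = (of_int c * \<tau> + of_int d) ^ k * Qf k r lam \<tau>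
      + (if k = 1 then K else 0)
      - (if k = 2 then kernel_defect r lam * of_int c * (of_int c * \<tau> + of_int d) / (2 * pi * \<i>) else 0)" for k
      using Qk[of k] unfolding J_def \<tau>'_def \<delta>_def .
    \<comment> \<open>A nontrivial multiplier fixes only the constant 0. For trivial multipliers K
      stays undetermined, but it occurs at index 1 alone, while the Eisenstein series have even
      index.\<close>
    assume "r \<noteq> 0 \<or> lam \<noteq> 1"
    then have "mu \<noteq> 1 \<or> inverse lam \<noteq> 1" using qpow_1_left_eq_1[OF r(1,2)] by (auto simp: mu_def)
    then show "K = 0" using K(2,3) by auto
  qed
qed

text \<open>At even index the two series of \<open>Qf\<close> have equal sign and the same terms
  apart from n = 0. This is the origin of the factor 2, and \<open>lambert_sum\<close> supplies the
  divisor sums.\<close>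

lemma Qf_trivial_eq_Eis:
  assumes "0 < Im \<tau>" "1 \<le> k"
  shows "Qf (2 * k) 0 1 \<tau> = Eis k \<tau>"
proof -
  define p where "p = 2 * k - 1"
  define q where "q = qpow \<tau> 1"
  have p: "2 * k - 1 = p" "p > 0" using assms by (auto simp: p_def)
  have q: "norm q < 1" using norm_qpow_less_1[OF assms(1), of 1] by (simp add: q_def)
  define f where "f n = of_nat n ^ p * (q ^ n / (1 - q ^ n))" for n :: nat
  have q1: "qpow \<tau> (real n) = q ^ n" for n by (simp add: q_def qpow_of_nat)
  have "(\<lambda>n. of_real ((real n + 0) ^ p) * qpow \<tau> (real n + 0) / (1 - qpow \<tau> (real n + 0))) = f"
    unfolding add_0_right q1 by (simp add: f_def fun_eq_iff)
  moreover have "(\<lambda>n. of_real ((real (Suc n) - 0) ^ p) * qpow \<tau> (real (Suc n) - 0) / (1 - qpow \<tau> (real (Suc n) - 0))) = (\<lambda>n. f (Suc n))"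
    unfolding diff_zero q1 by (simp add: f_def fun_eq_iff del: of_nat_Suc power_Suc)
  moreover have "(\<Sum>n. f n) = (\<Sum>n. f (Suc n))"
  proof -
    \<comment> \<open>The extra term of the first series pairs \<open>0 ^ p\<close>, which vanishes
      as p > 0, with the quotient \<open>1 / 0\<close>.\<close>
    have f0: "f 0 = 0" using p by (simp add: f_def)
    have "summable (\<lambda>m. norm (of_real ((real m) ^ p) * q ^ m))"
      using summable_poly_geometric[of "norm q" p] q by (simp add: norm_mult norm_power)
    then have "summable (\<lambda>m. 1 / (1 - norm q) * norm (of_real ((real m) ^ p) * q ^ m))" by (rule summable_mult)
    then have "summable f"
    proof (rule summable_comparison_test'[of _ 1])
      fix n :: nat assume n: "1 \<le> n"
      have "norm (q ^ n) \<le> norm q" using q n by (cases n) (auto simp: norm_mult norm_power mult_left_le power_le_one)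
      then have "1 - norm q \<le> norm (1 - q ^ n)" using norm_triangle_ineq2[of 1 "q ^ n"] by simp
      then have "norm (q ^ n) / norm (1 - q ^ n) \<le> norm (q ^ n) / (1 - norm q)"
        using q by (intro divide_left_mono mult_pos_pos) (auto intro: order.strict_trans2[of 0 "1 - norm q"])
      then have "real n ^ p * (norm (q ^ n) / norm (1 - q ^ n)) \<le> real n ^ p * (norm (q ^ n) / (1 - norm q))"
        by (intro mult_left_mono) auto
      then show "norm (f n) \<le> 1 / (1 - norm q) * norm (of_real ((real n) ^ p) * q ^ n)"
        by (simp add: f_def norm_mult norm_divide norm_power)
    qed
    then show ?thesis using suminf_split_head[of f] f0 by simp
  qed
  moreover have "(\<Sum>n. f (Suc n)) = (\<Sum>n. of_nat (divsum p (Suc n)) * qpow \<tau> (real (Suc n)))"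
    unfolding f_def q1 by (rule lambert_sum[OF q])
  moreover have "2 * k \<noteq> 0" using assms(2) by simp
  ultimately show ?thesis
    unfolding Qf_def Eis_def p by (simp del: of_nat_Suc)
qed

lemma Eis_modular:
  assumes "0 < Im \<tau>" "a * d - b * c = 1" "1 \<le> k"
  shows "Eis k (moebius a b c d \<tau>) = (of_int c * \<tau> + of_int d) ^ (2 * k) * Eis k \<tau>
    - (if k = 1 then of_int c * (of_int c * \<tau> + of_int d) / (2 * pi * \<i>) else 0)"
proof -
  obtain K where "\<And>k. Qf k 0 1 (moebius a b c d \<tau>) = (of_int c * \<tau> + of_int d) ^ k * Qf k 0 1 \<tau>
      + (if k = 1 then K else 0)
      - (if k = 2 then kernel_defect 0 1 * of_int c * (of_int c * \<tau> + of_int d) / (2 * pi * \<i>) else 0)"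
    by (rule Qf_modular[OF assms(1,2), of 1 1 0 0]) auto
  from this[of "2 * k"] show ?thesis
    using assms Im_moebius[OF assms(1,2)] by (simp add: Qf_trivial_eq_Eis kernel_defect_def)
qed

section \<open>Coefficients of the square bracket modes\<close>

definition expm1_fls :: "complex fls" where
  "expm1_fls = fps_to_fls (fps_exp 1 - 1)"

text \<open>Working with the whole Laurent series turns relations between the coefficients
  \<open>brc\<close> into products with powers of \<open>e^z - 1\<close> and exponentials.\<close>

definition brc_series :: "complex \<Rightarrow> int \<Rightarrow> complex fls" where
  "brc_series k s = expm1_fls powi (- s - 1) * fps_to_fls (fps_exp k)"

lemma brc_eq_nth: "brc k n s = fls_nth (brc_series k s) (- n - 1)"
  by (simp add: brc_def brc_series_def expm1_fls_def)

lemma subdegree_expm1: "subdegree (fps_exp 1 - 1 :: complex fps) = 1"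
  by (intro subdegreeI) auto

lemma expm1_fls_nonzero [simp]: "expm1_fls \<noteq> 0"
  unfolding expm1_fls_def using subdegree_expm1
  by (metis fps_to_fls_eq_0_iff subdegree_0 zero_neq_one)

lemma fls_subdegree_expm1: "fls_subdegree expm1_fls = 1"
  unfolding expm1_fls_def fls_subdegree_fls_to_fps subdegree_expm1 by simp

lemma fps_exp_nonzero: "fps_exp (k::complex) \<noteq> 0"
proof
  assume "fps_exp k = 0"
  then have "fps_nth (fps_exp k) 0 = 0" by simp
  then show False by simp
qed

lemma brc_series_nonzero [simp]: "brc_series k s \<noteq> 0"
  by (simp add: brc_series_def fps_exp_nonzero)

lemma fls_subdegree_brc_series: "fls_subdegree (brc_series k s) = - s - 1"
proof -
  have "subdegree (fps_exp k) = 0" by (intro subdegreeI) auto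
  then show ?thesis
    by (simp add: brc_series_def fls_subdegree_expm1 fps_exp_nonzero fls_subdegree_fls_to_fps)
qed

lemma brc_eq_0: "s < n \<Longrightarrow> brc k n s = 0"
  unfolding brc_eq_nth by (rule fls_eq0_below_subdegree) (simp add: fls_subdegree_brc_series)

lemma exp_mult_brc_series: "fps_to_fls (fps_exp l) * brc_series k s = brc_series (k + l) s"
  by (simp add: brc_series_def fps_exp_add_mult fls_times_fps_to_fls mult_ac)

lemma expm1_power_mult_brc_series: "expm1_fls ^ j * brc_series k s = brc_series k (s - int j)"
proof -
  have "expm1_fls powi int j * expm1_fls powi (- s - 1) = expm1_fls powi (int j + (- s - 1))"
    by (rule power_int_add [symmetric]) simp
  also have "int j + (- s - 1) = - (s - int j) - 1" by simp
  finally show ?thesis by (simp add: brc_series_def mult.assoc [symmetric])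
qed

lemma fps_to_fls_sum: "fps_to_fls (sum f A) = (\<Sum>x\<in>A. fps_to_fls (f x))"
  by (induction A rule: infinite_finite_induct) simp_all

text \<open>Each factor \<open>e^z - 1\<close> lowers s by one, so multiplication by
  \<open>F (e^z - 1)\<close> is a convolution in s. The series starts in degree -s - 1; hence powers
  beyond \<open>J \<ge> s - n\<close> cannot reach degree -n - 1, and a finite sum suffices.\<close>

lemma brc_series_compose_nth:
  assumes J: "s - n \<le> int J"
  shows "fls_nth (fps_to_fls (F oo (fps_exp 1 - 1)) * brc_series k s) (- n - 1)
     = (\<Sum>j\<le>J. fps_nth F j * brc k n (s - int j))"
proof -
  let ?G = "fps_exp 1 - 1 :: complex fps"
  define P where "P = (\<Sum>j\<le>J. fps_const (fps_nth F j) * ?G ^ j)"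
  define R where "R = (F oo ?G) - P"
  have R0: "fps_nth R i = 0" if "i \<le> J" for i
  proof -
    have z: "fps_nth (?G ^ j) i = 0" if "i < j" for j
      using that by (intro startsby_zero_power_prefix[rule_format]) auto
    have "fps_nth (F oo ?G) i = (\<Sum>j = 0..i. fps_nth F j * fps_nth (?G ^ j) i)" by (simp add: fps_compose_nth)
    also have "\<dots> = (\<Sum>j\<le>J. fps_nth F j * fps_nth (?G ^ j) i)"
      using that z by (intro sum.mono_neutral_left) auto
    also have "\<dots> = fps_nth P i" by (simp add: P_def fps_sum_nth)
    finally show ?thesis by (simp add: R_def)
  qed
  have "fls_nth (fps_to_fls R * brc_series k s) (- n - 1) = 0"
  proof (cases "R = 0")
    case False
    then have "int J < int (subdegree R)" using R0 nth_subdegree_nonzero[OF False] by (metis linorder_not_less zle_int)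
    then show ?thesis using False J
      by (intro fls_eq0_below_subdegree) (simp add: fls_subdegree_brc_series fls_subdegree_fls_to_fps)
  qed simp
  moreover have "F oo ?G = P + R" by (simp add: R_def)
  moreover have "fps_to_fls P * brc_series k s = (\<Sum>j\<le>J. fls_const (fps_nth F j) * brc_series k (s - int j))"
  proof -
    have "fps_to_fls P = (\<Sum>j\<le>J. fls_const (fps_nth F j) * expm1_fls ^ j)"
      by (simp add: P_def fps_to_fls_sum fls_times_fps_to_fls fps_to_fls_power expm1_fls_def)
    then show ?thesis by (simp add: sum_distrib_right mult.assoc expm1_power_mult_brc_series)
  qed
  ultimately show ?thesis
    by (simp add: fps_to_fls_plus ring_distribs fls_nth_sum brc_eq_nth)
qed

text \<open>Substituting \<open>x = e\<^sup>z - 1\<close> gives \<open>L[0] = Res\<^sub>x (1 + x) ln (1 + x) Y(\<omega>, x)\<close>.\<close>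
definition L0_symbol :: "complex fps" where
  "L0_symbol = (1 + fps_X) * fps_ln 1"

abbreviation L0c :: "nat \<Rightarrow> complex" where "L0c p \<equiv> fps_nth L0_symbol p"

lemma ln_compose: "fps_ln (1::complex) oo (fps_exp 1 - 1) = fps_X"
  unfolding fps_ln_fps_exp_inv[OF one_neq_zero] by (rule fps_inv) auto

lemma one_plus_X_compose: "(1 + fps_X) oo (fps_exp 1 - 1) = fps_exp (1::complex)"
  by (simp add: fps_compose_add_distrib)

lemma L0_symbol_compose: "L0_symbol oo (fps_exp 1 - 1) = fps_X * fps_exp 1"
  unfolding L0_symbol_def by (subst fps_compose_mult_distrib) (simp_all only: one_plus_X_compose ln_compose mult.commute, simp)

lemma L0_symbol_deriv_compose: "fps_deriv L0_symbol oo (fps_exp 1 - 1) = 1 + fps_X"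
proof -
  have "(1 + fps_X) * inverse (1 + fps_X :: complex fps) = 1"
    by (rule inverse_mult_eq_1') simp
  then have "fps_deriv L0_symbol = fps_ln 1 + 1"
    by (simp add: L0_symbol_def fps_ln_deriv)
  then show ?thesis by (simp add: fps_compose_add_distrib ln_compose add.commute)
qed

lemma L0c_0 [simp]: "L0c 0 = 0" and L0c_1 [simp]: "L0c (Suc 0) = 1"
  by (simp_all add: L0_symbol_def fps_ln_nth ring_distribs)

lemma L0c_ge_2: "L0c (p + 2) = (-1) ^ p / of_nat (Suc (Suc p) * Suc p)"
proof -
  have "L0c (Suc (Suc p)) = fps_nth (fps_ln 1) (Suc (Suc p)) + fps_nth (fps_ln 1) (Suc p)"
    by (simp add: L0_symbol_def ring_distribs)
  also have "\<dots> = (-1) ^ p * (1 / of_nat (p + 1) - 1 / of_nat (p + 2))"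
    by (simp add: fps_ln_nth algebra_simps del: of_nat_Suc of_nat_add) 
  also have "1 / of_nat (p + 1) - 1 / of_nat (p + 2) = (1::complex) / (of_nat (p + 1) * of_nat (p + 2))"
  proof -
    have "complex_of_nat (p + 1) \<noteq> 0" "complex_of_nat (p + 2) \<noteq> 0" unfolding of_nat_eq_0_iff by simp_all
    moreover have "complex_of_nat (p + 2) - of_nat (p + 1) = 1" by simp
    ultimately show ?thesis by (metis diff_frac_eq mult_1)
  qed
  finally have "L0c (Suc (Suc p)) = (-1) ^ p / (of_nat (p + 1) * of_nat (p + 2))" by simp
  moreover have "of_nat (p + 1) * of_nat (p + 2) = complex_of_nat (Suc (Suc p) * Suc p)"
    unfolding of_nat_mult [symmetric] by (simp only: add_2_eq_Suc' Suc_eq_plus1 [symmetric] mult.commute)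
  ultimately show ?thesis by (simp only: add_2_eq_Suc')
qed

text \<open>The symbol becomes \<open>z e^z\<close>: the exponential raises k by one and the factor
  z raises n by one. This and the next two sums over \<open>L0c\<close> are the cases i = 0, i = 1
  and i \<ge> 2 of the commutator with \<open>L[0]\<close>.\<close>

lemma brc_L0:
  assumes "J \<ge> nat (s - n)"
  shows "(\<Sum>j\<le>J. L0c j * brc k n (s - int j)) = brc (k + 1) (n + 1) s"
proof -
  have "(\<Sum>j\<le>J. L0c j * brc k n (s - int j)) = fls_nth (fps_to_fls (fps_X * fps_exp 1) * brc_series k s) (- n - 1)"
    using brc_series_compose_nth[of s n J L0_symbol k] assms by (simp add: L0_symbol_compose)
  also have "\<dots> = fls_nth (fls_X * brc_series (k + 1) s) (- n - 1)"
    by (simp add: fls_times_fps_to_fls mult.assoc exp_mult_brc_series)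
  also have "\<dots> = brc (k + 1) (n + 1) s"
    by (simp add: brc_eq_nth fls_X_times_conv_shift)
  finally show ?thesis .
qed

lemma brc_L0_deriv:
  assumes "J \<ge> nat (s - n)"
  shows "(\<Sum>j\<le>J. of_nat (Suc j) * L0c (Suc j) * brc k n (s - int j)) = brc k n s + brc k (n + 1) s"
proof -
  have "(\<Sum>j\<le>J. of_nat (Suc j) * L0c (Suc j) * brc k n (s - int j))
     = fls_nth (fps_to_fls (1 + fps_X) * brc_series k s) (- n - 1)"
    using brc_series_compose_nth[of s n J "fps_deriv L0_symbol" k] assms by (simp add: L0_symbol_deriv_compose)
  also have "\<dots> = brc k n s + brc k (n + 1) s"
    by (simp add: brc_eq_nth fps_to_fls_plus ring_distribs fls_X_times_conv_shift)
  finally show ?thesis .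
qed

text \<open>From the second derivative on, the Hasse derivatives of
  \<open>(1 + x) ln (1 + x)\<close> are multiples of negative powers of 1 + x; for order m + 2 the
  power is -(m + 1). This is the comparison of coefficients.\<close>

lemma L0c_hasse:
  "L0c (j + (m + 2)) * of_nat ((j + (m + 2)) choose (m + 2)) = L0c (m + 2) * ((-1) ^ j * of_nat ((m + j) choose j))"
proof -
  have c: "(Suc (Suc m) * Suc m) * ((j + (m + 2)) choose (m + 2)) = (Suc (Suc (j + m)) * Suc (j + m)) * ((m + j) choose m)"
  proof -
    define X1 X2 X3 where "X1 = (Suc (Suc (j + m)) choose Suc (Suc m))" "X2 = (Suc (j + m) choose Suc m)" "X3 = ((j + m) choose m)"
    have 1: "Suc (Suc m) * X1 = Suc (Suc (j + m)) * X2" "Suc m * X2 = Suc (j + m) * X3"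
      unfolding X1_X2_X3_def by (rule Suc_times_binomial)+
    have "Suc (Suc m) * Suc m * X1 = Suc m * (Suc (Suc m) * X1)" by (simp only: mult_ac)
    also have "\<dots> = Suc (Suc (j + m)) * (Suc m * X2)" unfolding 1(1) by (simp only: mult_ac)
    also have "\<dots> = Suc (Suc (j + m)) * Suc (j + m) * X3" unfolding 1(2) by (simp only: mult_ac)
    finally show ?thesis unfolding X1_X2_X3_def by (simp add: add.commute)
  qed
  have sym: "(m + j) choose m = (m + j) choose j" using binomial_symmetric[of m "m + j"] by simp
  define A B :: complex where "A = of_nat (Suc (Suc m) * Suc m)" and "B = of_nat (Suc (Suc (j + m)) * Suc (j + m))"
  have AB: "A \<noteq> 0" "B \<noteq> 0" unfolding A_def B_def of_nat_eq_0_iff by auto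
  have c': "A * of_nat ((j + (m + 2)) choose (m + 2)) = B * of_nat ((m + j) choose j)"
    using arg_cong[OF c, of "of_nat :: nat \<Rightarrow> complex"] unfolding sym A_def B_def of_nat_mult .
  have a: "L0c (m + 2) = (-1) ^ m / A" "L0c (j + (m + 2)) = (-1) ^ (j + m) / B"
    using L0c_ge_2[of m] L0c_ge_2[of "j + m"] unfolding A_def B_def by (simp_all only: add.assoc)
  have "of_nat ((j + (m + 2)) choose (m + 2)) = B * of_nat ((m + j) choose j) / A"
    using c' AB by (simp add: field_simps)
  then show ?thesis unfolding a using AB by (simp add: power_add)
qed

text \<open>The power of 1 + x turns into \<open>e^(-(m + 1) z)\<close> and lowers k by m + 1,
  exactly as the mode \<open>om(m + 2)\<close> lowers the weight of the vector it acts on.\<close>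

lemma brc_L0_hasse:
  assumes "J \<ge> nat (s - n)"
  shows "(\<Sum>j\<le>J. L0c (j + (m + 2)) * of_nat ((j + (m + 2)) choose (m + 2)) * brc k n (s - int j))
     = L0c (m + 2) * brc (k - of_nat (m + 1)) n s"
proof -
  define F where "F = Abs_fps (\<lambda>j. (-1) ^ j * complex_of_nat ((m + j) choose j))"
  have F: "F = inverse ((1 + fps_X) ^ Suc m)"
  proof -
    have "inverse ((1 + fps_X :: complex fps) ^ Suc m) = inverse ((1 - fps_const (-1) * fps_X) ^ Suc m)"
      by (simp flip: fps_const_neg)
    also have "\<dots> = F" unfolding F_def by (subst one_minus_const_fps_X_neg_power') (simp_all add: fps_eq_iff mult.commute)
    finally show ?thesis ..
  qed
  have "F oo (fps_exp 1 - 1) = inverse (fps_exp 1 ^ Suc m)"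
    unfolding F by (subst fps_inverse_compose) (simp_all add: fps_compose_power [symmetric] one_plus_X_compose del: power_Suc)
  also have "fps_exp (1::complex) ^ Suc m = fps_exp (of_nat (Suc m))"
    unfolding fps_exp_power_mult by simp
  also have "inverse (fps_exp (of_nat (Suc m) :: complex)) = fps_exp (- of_nat (Suc m))"
    by (rule fps_exp_neg [symmetric])
  finally have comp: "F oo (fps_exp 1 - 1) = fps_exp (- of_nat (Suc m))" .
  have "(\<Sum>j\<le>J. L0c (j + (m + 2)) * of_nat ((j + (m + 2)) choose (m + 2)) * brc k n (s - int j))
    = L0c (m + 2) * (\<Sum>j\<le>J. fps_nth F j * brc k n (s - int j))"
    unfolding L0c_hasse by (simp add: sum_distrib_left F_def mult_ac)
  also have "(\<Sum>j\<le>J. fps_nth F j * brc k n (s - int j)) = fls_nth (fps_to_fls (F oo (fps_exp 1 - 1)) * brc_series k s) (- n - 1)"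
    using brc_series_compose_nth[of s n J F k] assms by simp
  also have "\<dots> = brc (k - of_nat (m + 1)) n s"
  proof -
    have e: "k + - of_nat (Suc m) = k - of_nat (m + 1)" by simp
    show ?thesis unfolding comp exp_mult_brc_series brc_eq_nth e ..
  qed
  finally show ?thesis .
qed

lemma fls_deriv_power_int:
  fixes f :: "complex fls"
  assumes "f \<noteq> 0"
  shows "fls_deriv (f powi m) = of_int m * f powi (m - 1) * fls_deriv f"
proof (induction m rule: int_induct[of _ 0])
  case base
  then show ?case by simp
next
  case (step1 i)
  have "fls_deriv (f powi (i + 1)) = fls_deriv (f powi i * f)" using assms by (simp add: power_int_add)
  also have "\<dots> = f powi i * fls_deriv f + of_int i * (f powi (i - 1) * f) * fls_deriv f"
    unfolding fls_deriv_mult step1 by (simp add: mult_ac)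
  also have "f powi (i - 1) * f = f powi i" using power_int_add_1[of f "i - 1"] assms by simp
  finally show ?case by (simp add: algebra_simps)
next
  case (step2 i)
  have "fls_deriv (f powi i) = fls_deriv (f powi (i - 1) * f)" using power_int_add_1[of f "i - 1"] assms by simp
  also have "\<dots> = f powi (i - 1) * fls_deriv f + fls_deriv (f powi (i - 1)) * f"
    unfolding fls_deriv_mult ..
  finally have "fls_deriv (f powi (i - 1)) * f = of_int (i - 1) * f powi (i - 1) * fls_deriv f"
    unfolding step2 by (simp add: algebra_simps)
  moreover have "of_int (i - 1) * f powi (i - 1) * fls_deriv f = (of_int (i - 1) * f powi (i - 1 - 1) * fls_deriv f) * f"
    using power_int_add_1[of f "i - 1 - 1"] assms by (simp add: mult_ac)
  ultimately have "fls_deriv (f powi (i - 1)) * f = (of_int (i - 1) * f powi (i - 1 - 1) * fls_deriv f) * f"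
    by (rule trans)
  then show ?case using assms mult_right_cancel[of f] by blast
qed

lemma fls_deriv_expm1: "fls_deriv expm1_fls = fps_to_fls (fps_exp 1)"
  by (simp add: expm1_fls_def fls_deriv_fps_to_fls)

text \<open>Differentiate \<open>(e^z - 1)^(-s) e^(k z)\<close> and compare coefficients. It is used
  to rewrite modes of L(-1) v, which satisfy \<open>(L(-1) v)(s) = -s v(s - 1)\<close>.\<close>

lemma brc_translation:
  "of_int s * brc (k + 1) (n + 1) s = k * brc k (n + 1) (s - 1) + of_int (n + 1) * brc k n (s - 1)"
proof -
  have e: "- (s - 1) - 1 = - s" by simp
  have "fls_deriv (brc_series k (s - 1)) = - of_int s * brc_series (k + 1) s + fls_const k * brc_series k (s - 1)"
  proof -
    have "fls_deriv (brc_series k (s - 1)) = expm1_fls powi (- s) * (fls_const k * fps_to_fls (fps_exp k))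
        + of_int (- s) * (expm1_fls powi (- s - 1) * fps_to_fls (fps_exp k)) * fps_to_fls (fps_exp 1)"
      unfolding brc_series_def e fls_deriv_mult fls_deriv_power_int[OF expm1_fls_nonzero] fls_deriv_expm1
      by (simp add: fls_deriv_fps_to_fls fls_times_fps_to_fls mult_ac)
    also have "\<dots> = fls_const k * brc_series k (s - 1) + of_int (- s) * (fps_to_fls (fps_exp 1) * brc_series k s)"
      by (simp add: brc_series_def mult_ac)
    finally show ?thesis unfolding exp_mult_brc_series by simp
  qed
  moreover have "fls_nth (fls_deriv F) (- n - 2) = of_int (- n - 1) * fls_nth F (- n - 1)" for F :: "complex fls"
  proof -
    have "- n - 2 + 1 = - n - 1" by simp
    then show ?thesis by (simp only: fls_deriv_nth)
  qed
  ultimately have "of_int (- n - 1) * fls_nth (brc_series k (s - 1)) (- n - 1)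
      = fls_nth (- of_int s * brc_series (k + 1) s + fls_const k * brc_series k (s - 1)) (- n - 2)"
    by metis
  moreover have "brc l (n + 1) t = fls_nth (brc_series l t) (- n - 2)" for l t
  proof -
    have "- (n + 1) - 1 = - n - 2" by simp
    then show ?thesis by (simp only: brc_eq_nth)
  qed
  moreover have "brc k n (s - 1) = fls_nth (brc_series k (s - 1)) (- n - 1)" by (rule brc_eq_nth)
  ultimately have "of_int (- n - 1) * brc k n (s - 1) = - of_int s * brc (k + 1) (n + 1) s + k * brc k (n + 1) (s - 1)"
    by (simp add: fls_of_int)
  then show ?thesis by (simp add: algebra_simps)
qed

text \<open>Change of variables in a residue: for \<open>x = e^z - 1\<close> one has
  \<open>dx = e^z dz\<close>, and the powers of x other than -1 are derivatives, hence without
  residue. So the modes of \<omega> enter \<open>L[0]\<close> with the coefficients of the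
  symbol.\<close>

lemma brc_2_1: "brc 2 1 p = (if p < 0 then 0 else L0c (nat p))"
proof (cases "p < 0")
  case True
  then show ?thesis by (simp add: brc_eq_0)
next
  case False
  have res: "fls_nth (brc_series 1 s) (-1) = (if s = 0 then 1 else 0)" for s
  proof -
    have ser: "brc_series 1 s = expm1_fls powi (- s - 1) * fls_deriv expm1_fls"
      by (simp add: brc_series_def fls_deriv_expm1)
    show ?thesis
    proof (cases "s = 0")
      case True
      have "brc_series 1 0 = inverse expm1_fls * (1 + expm1_fls)"
        by (simp add: brc_series_def expm1_fls_def power_int_minus)
      also have "\<dots> = inverse expm1_fls + 1" by (simp add: ring_distribs)
      finally have "fls_nth (brc_series 1 0) (-1) = fls_nth (inverse expm1_fls) (-1)" by simp
      moreover have "fls_nth (inverse expm1_fls) (- fls_subdegree expm1_fls) = inverse (fls_nth expm1_fls (fls_subdegree expm1_fls))"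
        by (simp add: fls_inverse_def' fls_lr_inverse_base)
      ultimately show ?thesis using True by (simp add: fls_subdegree_expm1) (simp add: expm1_fls_def)
    next
      case False
      have "of_int (- s) * fls_nth (brc_series 1 s) (-1) = fls_nth (fls_deriv (expm1_fls powi (- s))) (-1)"
        unfolding ser fls_deriv_power_int[OF expm1_fls_nonzero]
        by (simp add: mult.assoc fls_of_int del: fls_deriv_nth)
      also have "\<dots> = 0" by simp
      finally show ?thesis using False by simp
    qed
  qed
  define J where "J = nat p"
  have "brc 2 1 p = fls_nth (fps_to_fls (L0_symbol oo (fps_exp 1 - 1)) * brc_series 1 p) (-1)"
  proof -
    have "fps_to_fls (fps_X * fps_exp 1) * brc_series 1 p = fls_X * brc_series (1 + 1) p"
      by (simp only: fls_times_fps_to_fls mult.assoc exp_mult_brc_series fps_X_to_fls)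
    then show ?thesis unfolding L0_symbol_compose by (simp add: brc_eq_nth fls_X_times_conv_shift)
  qed
  also have "\<dots> = (\<Sum>j\<le>J. L0c j * brc 1 0 (p - int j))"
    using brc_series_compose_nth[of p 0 J L0_symbol 1] False by (simp add: J_def)
  also have "\<dots> = (\<Sum>j\<le>J. if j = J then L0c j else 0)"
    using False by (intro sum.cong) (auto simp: brc_eq_nth res J_def)
  also have "\<dots> = L0c J" by simp
  finally show ?thesis using False by (simp add: J_def)
qed

section \<open>Direct sums and eigenspaces\<close>

lemma nzsum_eq_sum:
  assumes "finite T" "\<And>i. i \<notin> T \<Longrightarrow> f i = 0"
  shows "nzsum f = sum f T"
  unfolding nzsum_def using assms by (intro sum.mono_neutral_left) auto

lemma nzsum_zero [simp]: "nzsum (\<lambda>_. 0) = 0"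
  by (simp add: nzsum_def)

lemma nzsum_add:
  assumes "finite {i. f i \<noteq> 0}" "finite {i. g i \<noteq> 0}"
  shows "nzsum (\<lambda>i. f i + g i) = nzsum f + nzsum g"
proof -
  let ?T = "{i. f i \<noteq> 0} \<union> {i. g i \<noteq> 0}"
  have "nzsum f = sum f ?T" "nzsum g = sum g ?T" "nzsum (\<lambda>i. f i + g i) = sum (\<lambda>i. f i + g i) ?T"
    using assms by (auto intro!: nzsum_eq_sum)
  then show ?thesis by (simp add: sum.distrib)
qed

lemma nzsum_single:
  assumes "\<And>i. i \<noteq> a \<Longrightarrow> f i = 0"
  shows "nzsum f = f a"
  using nzsum_eq_sum[of "{a}" f] assms by auto

lemma nzsum_mult_left:
  fixes f :: "'i \<Rightarrow> complex"
  shows "nzsum (\<lambda>i. c * f i) = c * nzsum f"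
proof (cases "c = 0")
  case False
  then have "{i. c * f i \<noteq> 0} = {i. f i \<noteq> 0}" by auto
  then show ?thesis by (simp add: nzsum_def sum_distrib_left)
qed (simp add: nzsum_def)

lemma vector_space_complex: "vector_space ((*) :: complex \<Rightarrow> complex \<Rightarrow> complex)"
  by unfold_locales (simp_all add: algebra_simps)

locale complex_vs = vector_space sc for sc :: "complex \<Rightarrow> 'v::ab_group_add \<Rightarrow> 'v"
begin

abbreviation lin :: "('v \<Rightarrow> 'v) \<Rightarrow> bool" where "lin \<equiv> Vector_Spaces.linear sc sc"
abbreviation linf :: "('v \<Rightarrow> complex) \<Rightarrow> bool" where "linf \<equiv> Vector_Spaces.linear sc (*)"

lemma lin_iff: "lin f \<longleftrightarrow> (\<forall>x y. f (x + y) = f x + f y) \<and> (\<forall>c x. f (sc c x) = sc c (f x))"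
  using vector_space_axioms by (auto simp: Vector_Spaces.linear_iff)

lemma linf_iff: "linf f \<longleftrightarrow> (\<forall>x y. f (x + y) = f x + f y) \<and> (\<forall>c x. f (sc c x) = c * f x)"
  using vector_space_axioms vector_space_complex by (auto simp: Vector_Spaces.linear_iff)

lemma lin_add: "lin f \<Longrightarrow> f (x + y) = f x + f y" and lin_scale: "lin f \<Longrightarrow> f (sc c x) = sc c (f x)"
  by (auto simp: lin_iff)

lemma linf_add: "linf f \<Longrightarrow> f (x + y) = f x + f y" and linf_scale: "linf f \<Longrightarrow> f (sc c x) = c * f x"
  by (auto simp: linf_iff)

lemma lin_0: "lin f \<Longrightarrow> f 0 = 0"
  using lin_scale[of f 0 0] by simp

lemma linf_0: "linf f \<Longrightarrow> f 0 = 0"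
  using linf_scale[of f 0 0] by simp

lemma lin_sum: "lin f \<Longrightarrow> f (sum g A) = (\<Sum>a\<in>A. f (g a))"
  by (induction A rule: infinite_finite_induct) (auto simp: lin_0 lin_add)

lemma linf_sum: "linf f \<Longrightarrow> f (sum g A) = (\<Sum>a\<in>A. f (g a))"
  by (induction A rule: infinite_finite_induct) (auto simp: linf_0 linf_add)

lemma lin_diff: "lin f \<Longrightarrow> f (x - y) = f x - f y"
  using lin_add[of f "x - y" y] by simp

lemma lin_scaled: "lin f \<Longrightarrow> lin (\<lambda>x. sc r (f x))"
  by (simp add: lin_iff scale_right_distrib scale_left_commute mult.commute)

lemma nzsum_lin:
  assumes f: "\<And>i. lin (f i)" and fin: "\<And>x. finite {i. f i x \<noteq> 0}"
  shows "lin (\<lambda>x. nzsum (\<lambda>i. f i x))"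
  unfolding lin_iff
proof (intro conjI allI)
  show "nzsum (\<lambda>i. f i (x + y)) = nzsum (\<lambda>i. f i x) + nzsum (\<lambda>i. f i y)" for x y
    unfolding lin_add[OF f] by (rule nzsum_add[OF fin fin])
  show "nzsum (\<lambda>i. f i (sc r x)) = sc r (nzsum (\<lambda>i. f i x))" for r x
    using nzsum_eq_sum[OF fin, of x "\<lambda>i. f i (sc r x)"] by (simp add: lin_scale[OF f] scale_sum_right nzsum_def[of "\<lambda>i. f i x"])
qed

lemma nzsum_linf:
  assumes f: "\<And>i. linf (f i)" and fin: "\<And>x. finite {i. f i x \<noteq> 0}"
  shows "linf (\<lambda>x. nzsum (\<lambda>i. f i x))"
  unfolding linf_iff
  by (simp add: linf_add[OF f] linf_scale[OF f] nzsum_add[OF fin fin] nzsum_mult_left)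

lemma lin_subspace_vimage: "lin f \<Longrightarrow> subspace U \<Longrightarrow> subspace {x. f x \<in> U}"
  by (simp add: subspace_def lin_0 lin_add lin_scale)

lemma lin_subspace_image: "lin f \<Longrightarrow> subspace U \<Longrightarrow> subspace (f ` U)"
  by (rule module_hom.subspace_image[OF module_hom_linearI])

context
  fixes F :: "'i \<Rightarrow> 'v set"
  assumes F: "dirsum sc F"
begin

lemma dirsum_subspace: "subspace (F i)"
  and dirsum_span: "v \<in> span (\<Union>i. F i)"
  and dirsum_Int: "F i \<inter> span (\<Union>j\<in>-{i}. F j) = {0}"
  using F unfolding dirsum_def by auto

lemma comp_exists: "\<exists>x. x \<in> F i \<and> v - x \<in> span (\<Union>j\<in>-{i}. F j)"
proof -
  have "(\<Union>i. F i) = F i \<union> (\<Union>j\<in>-{i}. F j)" by auto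
  then have "v \<in> span (F i \<union> (\<Union>j\<in>-{i}. F j))" using dirsum_span[of v] by simp
  then obtain x y where "x \<in> span (F i)" "y \<in> span (\<Union>j\<in>-{i}. F j)" "v = x + y" unfolding span_Un by auto
  moreover have "span (F i) = F i" by (rule span_eq_iff[THEN iffD2, OF dirsum_subspace])
  ultimately show ?thesis by (intro exI[of _ x]) simp
qed

lemma comp_unique:
  assumes "x \<in> F i" "v - x \<in> span (\<Union>j\<in>-{i}. F j)" "y \<in> F i" "v - y \<in> span (\<Union>j\<in>-{i}. F j)"
  shows "x = y"
proof -
  have "(v - y) - (v - x) \<in> span (\<Union>j\<in>-{i}. F j)" by (intro span_diff assms)
  then have "x - y \<in> span (\<Union>j\<in>-{i}. F j)" by simp
  moreover have "x - y \<in> F i" by (intro subspace_diff[OF dirsum_subspace] assms)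
  ultimately show ?thesis using dirsum_Int by (metis IntI eq_iff_diff_eq_0 singletonD)
qed

lemma comp_props: "comp sc F i v \<in> F i" "v - comp sc F i v \<in> span (\<Union>j\<in>-{i}. F j)"
proof -
  have "\<exists>!x. x \<in> F i \<and> v - x \<in> span (\<Union>j\<in>-{i}. F j)" using comp_exists comp_unique by metis
  from theI'[OF this] show "comp sc F i v \<in> F i" "v - comp sc F i v \<in> span (\<Union>j\<in>-{i}. F j)"
    unfolding comp_def by auto
qed

lemma comp_eqI:
  assumes "x \<in> F i" "v - x \<in> span (\<Union>j\<in>-{i}. F j)"
  shows "comp sc F i v = x"
  using comp_unique[OF comp_props assms] .

lemma comp_same: "v \<in> F i \<Longrightarrow> comp sc F i v = v"
  by (rule comp_eqI) (simp_all add: span_zero)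

lemma comp_other: "v \<in> F j \<Longrightarrow> j \<noteq> i \<Longrightarrow> comp sc F i v = 0"
  by (rule comp_eqI) (auto intro: subspace_0[OF dirsum_subspace] span_base)

lemma comp_linear: "lin (comp sc F i)"
  unfolding lin_iff
proof (intro conjI allI)
  fix x y
  have "(x - comp sc F i x) + (y - comp sc F i y) \<in> span (\<Union>j\<in>-{i}. F j)" by (intro span_add comp_props)
  moreover have "(x - comp sc F i x) + (y - comp sc F i y) = x + y - (comp sc F i x + comp sc F i y)" by simp
  ultimately show "comp sc F i (x + y) = comp sc F i x + comp sc F i y"
    by (intro comp_eqI subspace_add[OF dirsum_subspace] comp_props) (simp only:)
next
  fix c x
  have "sc c (x - comp sc F i x) \<in> span (\<Union>j\<in>-{i}. F j)" by (intro span_scale comp_props)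
  then show "comp sc F i (sc c x) = sc c (comp sc F i x)"
    by (intro comp_eqI subspace_scale[OF dirsum_subspace] comp_props) (simp add: scale_right_diff_distrib)
qed

lemma comp_finite_sum: "finite {i. comp sc F i v \<noteq> 0} \<and> v = (\<Sum>i\<in>{i. comp sc F i v \<noteq> 0}. comp sc F i v)"
proof -
  let ?P = "\<lambda>v. \<exists>T. finite T \<and> (\<forall>i. i \<notin> T \<longrightarrow> comp sc F i v = 0) \<and> v = (\<Sum>i\<in>T. comp sc F i v)"
  have ext: "v = (\<Sum>i\<in>T'. comp sc F i v)" if "finite T'" "T \<subseteq> T'" "\<forall>i. i \<notin> T \<longrightarrow> comp sc F i v = 0" "v = (\<Sum>i\<in>T. comp sc F i v)" for T T' v
    using that by (metis DiffE sum.mono_neutral_left)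
  have "subspace (Collect ?P)"
    unfolding subspace_def
  proof (intro conjI ballI allI CollectI)
    show "?P 0" by (intro exI[of _ "{}"]) (simp add: lin_0[OF comp_linear])
  next
    fix x y assume "x \<in> Collect ?P" "y \<in> Collect ?P"
    then obtain T T' where T: "finite T" "\<forall>i. i \<notin> T \<longrightarrow> comp sc F i x = 0" "x = (\<Sum>i\<in>T. comp sc F i x)"
      "finite T'" "\<forall>i. i \<notin> T' \<longrightarrow> comp sc F i y = 0" "y = (\<Sum>i\<in>T'. comp sc F i y)" by auto
    have "x = (\<Sum>i\<in>T\<union>T'. comp sc F i x)" by (rule ext[of "T \<union> T'" T]) (use T in auto)
    moreover have "y = (\<Sum>i\<in>T\<union>T'. comp sc F i y)" by (rule ext[of "T \<union> T'" T']) (use T in auto)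
    moreover have "(\<Sum>i\<in>T\<union>T'. comp sc F i (x + y)) = (\<Sum>i\<in>T\<union>T'. comp sc F i x) + (\<Sum>i\<in>T\<union>T'. comp sc F i y)"
      by (simp add: lin_add[OF comp_linear] sum.distrib)
    ultimately have s: "x + y = (\<Sum>i\<in>T\<union>T'. comp sc F i (x + y))"
      by (simp only:)
    have z: "\<forall>i. i \<notin> T \<union> T' \<longrightarrow> comp sc F i (x + y) = 0"
      using T(2,5) by (simp add: lin_add[OF comp_linear])
    have f: "finite (T \<union> T')" using T(1,4) by simp
    show "?P (x + y)" by (rule exI[of _ "T \<union> T'"]) (use s z f in blast)
  next
    fix c x assume "x \<in> Collect ?P"
    then obtain T where T: "finite T" "\<forall>i. i \<notin> T \<longrightarrow> comp sc F i x = 0" "x = (\<Sum>i\<in>T. comp sc F i x)" by auto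
    have s: "sc c x = (\<Sum>i\<in>T. comp sc F i (sc c x))"
      unfolding lin_scale[OF comp_linear] scale_sum_right [symmetric] using T(3) by (rule arg_cong)
    have z: "\<forall>i. i \<notin> T \<longrightarrow> comp sc F i (sc c x) = 0"
      using T(2) by (simp add: lin_scale[OF comp_linear])
    show "?P (sc c x)" by (rule exI[of _ T]) (use s z T(1) in blast)
  qed
  moreover have "?P x" if x: "x \<in> (\<Union>i. F i)" for x
  proof -
    obtain j where "x \<in> F j" using x by auto
    then show ?thesis by (intro exI[of _ "{j}"]) (auto simp: comp_same comp_other)
  qed
  ultimately have "?P v" using span_subspace_induct[OF dirsum_span, of "Collect ?P" v] by blast
  then obtain T where T: "finite T" "\<forall>i. i \<notin> T \<longrightarrow> comp sc F i v = 0" "v = (\<Sum>i\<in>T. comp sc F i v)" by auto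
  have sub: "{i. comp sc F i v \<noteq> 0} \<subseteq> T" using T by auto
  then have "finite {i. comp sc F i v \<noteq> 0}" using T(1) finite_subset by blast
  moreover have "(\<Sum>i\<in>{i. comp sc F i v \<noteq> 0}. comp sc F i v) = (\<Sum>i\<in>T. comp sc F i v)"
    using T sub by (intro sum.mono_neutral_left) auto
  ultimately show ?thesis using T(3) by simp
qed

lemma comp_finite: "finite {i. comp sc F i v \<noteq> 0}"
  using comp_finite_sum by blast

lemma comp_sum: "v = (\<Sum>i\<in>{i. comp sc F i v \<noteq> 0}. comp sc F i v)"
  using comp_finite_sum by blast

lemma dirsum_induct:
  assumes "\<And>x y. P x \<Longrightarrow> P y \<Longrightarrow> P (x + y)" "P 0" "\<And>i x. x \<in> F i \<Longrightarrow> P x"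
  shows "P v"
proof -
  have "P (sum (\<lambda>i. comp sc F i v) A)" for A
    by (induction A rule: infinite_finite_induct) (auto intro: assms(1,2) assms(3)[OF comp_props(1)])
  then show ?thesis by (metis comp_sum)
qed

end

text \<open>A polynomial in L given by its list of roots, so that simple roots mean
  \<open>distinct js\<close> and leaving out a root k means
  \<open>k \<notin> set js\<close>.\<close>

definition annihilator :: "('v \<Rightarrow> 'v) \<Rightarrow> complex list \<Rightarrow> 'v \<Rightarrow> 'v" where
  "annihilator L js v = foldr (\<lambda>j u. L u - sc j u) js v"

lemma annihilator_simps [simp]:
  "annihilator L [] v = v" "annihilator L (j # js) v = L (annihilator L js v) - sc j (annihilator L js v)"
  "annihilator L (xs @ ys) v = annihilator L xs (annihilator L ys v)"
  by (simp_all add: annihilator_def)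

context
  fixes L :: "'v \<Rightarrow> 'v"
  assumes L: "lin L"
begin

lemma annihilator_linear: "lin (annihilator L js)"
  by (induction js) (auto simp: lin_iff lin_add[OF L] lin_scale[OF L] scale_right_distrib scale_right_diff_distrib scale_left_commute)

lemma annihilator_commute1: "annihilator L js (L v - sc j v) = L (annihilator L js v) - sc j (annihilator L js v)"
proof (induction js)
  case (Cons a js)
  show ?case unfolding annihilator_simps Cons.IH
    by (simp add: lin_diff[OF L] lin_scale[OF L] scale_right_diff_distrib scale_left_commute[of a j])
qed simp

lemma annihilator_commute: "annihilator L xs (annihilator L ys v) = annihilator L ys (annihilator L xs v)"
  by (induction ys) (auto simp: annihilator_commute1)

lemma annihilator_eigenvector: "L v = sc k v \<Longrightarrow> annihilator L js v = sc (\<Prod>j\<leftarrow>js. k - j) v"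
  by (induction js) (auto simp: lin_scale[OF L] scale_left_diff_distrib algebra_simps)

lemma annihilator_invariant:
  assumes "subspace U" "\<And>u. u \<in> U \<Longrightarrow> L u \<in> U" "u \<in> U"
  shows "annihilator L js u \<in> U"
  by (induction js) (auto intro!: subspace_diff[OF assms(1)] subspace_scale[OF assms(1)] assms)

lemma eigenspace_subspace: "subspace {v. L v = sc k v}"
  by (auto simp: subspace_def lin_0[OF L] lin_add[OF L] lin_scale[OF L] scale_right_distrib scale_left_commute)

text \<open>The vectors killed by some product avoiding the root k form a subspace: factors commute,
  so the lists for two summands can be concatenated.\<close>

lemma span_eigenspaces_annihilated:
  assumes "w \<in> span (\<Union>j\<in>-{k}. {v. L v = sc j v})"
  shows "\<exists>js. k \<notin> set js \<and> annihilator L js w = 0"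
proof -
  let ?P = "{w. \<exists>js. k \<notin> set js \<and> annihilator L js w = 0}"
  have "subspace ?P"
    unfolding subspace_def
  proof (intro conjI ballI allI)
    show "0 \<in> ?P" by (auto intro!: exI[of _ "[]"])
  next
    fix x y assume "x \<in> ?P" "y \<in> ?P"
    then obtain xs ys where "k \<notin> set xs" "annihilator L xs x = 0" "k \<notin> set ys" "annihilator L ys y = 0" by auto
    then have "k \<notin> set (xs @ ys)" "annihilator L (xs @ ys) (x + y) = 0"
      using annihilator_commute[of xs ys x] by (auto simp: lin_add[OF annihilator_linear] lin_0[OF annihilator_linear])
    then show "x + y \<in> ?P" by blast
  next
    fix c x assume "x \<in> ?P"
    then show "sc c x \<in> ?P" by (auto simp: lin_scale[OF annihilator_linear])
  qed
  moreover have "x \<in> ?P" if x: "x \<in> (\<Union>j\<in>-{k}. {v. L v = sc j v})" for x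
  proof -
    obtain j where "j \<noteq> k" "L x = sc j x" using x by auto
    then show ?thesis by (auto intro!: exI[of _ "[j]"])
  qed
  ultimately have "w \<in> ?P" using span_subspace_induct[OF assms] by blast
  then show ?thesis by simp
qed

lemma prod_list_diff_nonzero: "k \<notin> set js \<Longrightarrow> (\<Prod>j\<leftarrow>js. k - j) \<noteq> (0::complex)"
  by (induction js) auto

text \<open>On eigenspaces for roots other than j the operator L - j is invertible. Thus (L - j) v,
  which lies in their span by induction, has a preimage w there, and v - w is an eigenvector for
  j.\<close>

lemma annihilated_in_span:
  assumes "distinct js" "annihilator L js v = 0"
  shows "v \<in> span (\<Union>j\<in>set js. {v. L v = sc j v})"
  using assms
proof (induction js arbitrary: v)
  case Nil
  then show ?case by (simp add: span_zero)
next
  case (Cons j js)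
  let ?W = "span (\<Union>i\<in>set js. {v. L v = sc i v})"
  have "annihilator L js (L v - sc j v) = 0" using Cons.prems by (simp add: annihilator_commute1)
  then have "L v - sc j v \<in> ?W" using Cons by simp
  moreover have "?W \<subseteq> (\<lambda>w. L w - sc j w) ` ?W"
  proof (rule span_minimal)
    show "(\<Union>i\<in>set js. {v. L v = sc i v}) \<subseteq> (\<lambda>w. L w - sc j w) ` ?W"
    proof
      fix x assume x: "x \<in> (\<Union>i\<in>set js. {v. L v = sc i v})"
      then obtain i where i: "i \<in> set js" "L x = sc i x" by auto
      have ij: "i \<noteq> j" using i Cons.prems by auto
      have "L (sc t x) - sc j (sc t x) = sc ((i - j) * t) x" for t
        by (simp add: lin_scale[OF L] i(2) left_diff_distrib scale_left_diff_distrib mult.commute[of t])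
      from this[of "1 / (i - j)"] show "x \<in> (\<lambda>w. L w - sc j w) ` ?W"
        using ij span_scale[OF span_base[OF x], of "1 / (i - j)"] by (intro image_eqI) auto
    qed
    show "subspace ((\<lambda>w. L w - sc j w) ` ?W)"
    proof (rule lin_subspace_image[OF _ subspace_span])
      have "annihilator L [j] = (\<lambda>w. L w - sc j w)" by (rule ext) simp
      then show "lin (\<lambda>w. L w - sc j w)" using annihilator_linear[of "[j]"] by (simp only:)
    qed
  qed
  ultimately obtain w where w: "w \<in> ?W" "L w - sc j w = L v - sc j v" by force
  have "L (v - w) = sc j (v - w)" using w(2) by (simp add: lin_diff[OF L] scale_right_diff_distrib algebra_simps)
  then have "v - w \<in> span (\<Union>i\<in>set (j # js). {v. L v = sc i v})" by (intro span_base) auto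
  moreover have "w \<in> span (\<Union>i\<in>set (j # js). {v. L v = sc i v})"
    using w(1) span_mono[of "\<Union>i\<in>set js. {v. L v = sc i v}" "\<Union>i\<in>set (j # js). {v. L v = sc i v}"] by auto
  ultimately have "(v - w) + w \<in> span (\<Union>i\<in>set (j # js). {v. L v = sc i v})" by (rule span_add)
  then show ?case by simp
qed

lemma eigenspaces_dirsum:
  assumes "\<And>v. \<exists>js. distinct js \<and> annihilator L js v = 0"
  shows "dirsum sc (\<lambda>k. {v. L v = sc k v})"
  unfolding dirsum_def
proof (intro conjI allI)
  fix v
  obtain js where "distinct js" "annihilator L js v = 0" using assms by blast
  then have "v \<in> span (\<Union>j\<in>set js. {v. L v = sc j v})" by (rule annihilated_in_span)
  then show "v \<in> span (\<Union>k. {v. L v = sc k v})"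
    using span_mono[of "\<Union>j\<in>set js. {v. L v = sc j v}" "\<Union>k. {v. L v = sc k v}"] by auto
next
  fix k
  show "{v. L v = sc k v} \<inter> span (\<Union>j\<in>-{k}. {v. L v = sc j v}) = {0}"
  proof (intro equalityI subsetI)
    fix x assume x: "x \<in> {v. L v = sc k v} \<inter> span (\<Union>j\<in>-{k}. {v. L v = sc j v})"
    then obtain js where js: "k \<notin> set js" "annihilator L js x = 0" using span_eigenspaces_annihilated by blast
    have "L x = sc k x" using x by simp
    then have "sc (\<Prod>j\<leftarrow>js. k - j) x = 0" using js(2) annihilator_eigenvector by metis
    then show "x \<in> {0}" using prod_list_diff_nonzero[OF js(1)] by (simp add: scale_eq_0_iff)
  qed (auto simp: lin_0[OF L] span_zero)
qed (rule eigenspace_subspace)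

text \<open>A product that kills the other components of v acts on the component for k by a nonzero
  scalar, so this component is a polynomial in L applied to v.\<close>

lemma comp_eigenspace_invariant:
  assumes D: "dirsum sc (\<lambda>k. {v. L v = sc k v})" and U: "subspace U" "\<And>u. u \<in> U \<Longrightarrow> L u \<in> U" and v: "v \<in> U"
  shows "comp sc (\<lambda>k. {v. L v = sc k v}) k v \<in> U"
proof -
  let ?x = "comp sc (\<lambda>k. {v. L v = sc k v}) k v"
  have x: "L ?x = sc k ?x" "v - ?x \<in> span (\<Union>j\<in>-{k}. {v. L v = sc j v})" using comp_props[OF D, where i = k and v = v] by auto
  obtain js where js: "k \<notin> set js" "annihilator L js (v - ?x) = 0" using span_eigenspaces_annihilated[OF x(2)] by blast
  have "annihilator L js v = annihilator L js ?x" using js(2) lin_diff[OF annihilator_linear] by simp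
  also have "\<dots> = sc (\<Prod>j\<leftarrow>js. k - j) ?x" by (rule annihilator_eigenvector[OF x(1)])
  finally have "sc (\<Prod>j\<leftarrow>js. k - j) ?x \<in> U" using annihilator_invariant[OF U v] by metis
  then have "sc (1 / (\<Prod>j\<leftarrow>js. k - j)) (sc (\<Prod>j\<leftarrow>js. k - j) ?x) \<in> U" by (rule subspace_scale[OF U(1)])
  then show ?thesis using prod_list_diff_nonzero[OF js(1)] by simp
qed

end

end

section \<open>Square bracket modes\<close>

locale vosa_data =
  fixes sc :: "complex \<Rightarrow> 'v::ab_group_add \<Rightarrow> 'v"
    and Y :: "'v \<Rightarrow> int \<Rightarrow> 'v \<Rightarrow> 'v"
    and vac om :: 'v and c :: complex and Vh :: "int \<Rightarrow> 'v set"
  assumes vosa: "vosa sc Y vac om c Vh"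
begin

sublocale complex_vs sc
  using vosa unfolding vosa_def complex_vs_def by (elim conjE)

abbreviation brm :: "'v \<Rightarrow> int \<Rightarrow> 'v \<Rightarrow> 'v" where "brm \<equiv> brmode sc Y Vh"
abbreviation brh :: "complex \<Rightarrow> 'v \<Rightarrow> int \<Rightarrow> 'v \<Rightarrow> 'v" where "brh \<equiv> brmode_h sc Y"
abbreviation Lb :: "int \<Rightarrow> 'v \<Rightarrow> 'v" where "Lb \<equiv> Lbr sc Y vac om c Vh"

lemma Vh_dirsum: "dirsum sc Vh"
  using vosa unfolding vosa_def by (elim conjE)

lemma Vh_bounded: "\<exists>m0. \<forall>m<m0. Vh m = {0}"
  using vosa unfolding vosa_def by (elim conjE)

lemmas vosa_conj = vosa[unfolded vosa_def, THEN conjunct2, THEN conjunct2, THEN conjunct2, THEN conjunct2]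
lemmas vosa_vacuum_conj = vosa_conj[THEN conjunct2, THEN conjunct2, THEN conjunct2, THEN conjunct2]
lemmas vosa_conformal_conj = vosa_vacuum_conj[THEN conjunct2, THEN conjunct2, THEN conjunct2, THEN conjunct2, THEN conjunct2]

lemmas Y_lin_right = vosa_conj[THEN conjunct1, rule_format]
  and Y_lin_left = vosa_conj[THEN conjunct2, THEN conjunct1, rule_format]
  and Y_truncation = vosa_conj[THEN conjunct2, THEN conjunct2, THEN conjunct1, rule_format]
  and Y_vac = vosa_vacuum_conj[THEN conjunct1, rule_format]
  and Y_on_vac = vosa_vacuum_conj[THEN conjunct2, THEN conjunct1, rule_format]
    vosa_vacuum_conj[THEN conjunct2, THEN conjunct2, THEN conjunct1, rule_format]
  and Jacobi = vosa_vacuum_conj[THEN conjunct2, THEN conjunct2, THEN conjunct2, THEN conjunct1, rule_format]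
  and Virasoro = vosa_conformal_conj[THEN conjunct1, rule_format]
  and L0_weight = vosa_conformal_conj[THEN conjunct2, THEN conjunct1, rule_format]
  and translation_mode = vosa_conformal_conj[THEN conjunct2, THEN conjunct2, rule_format]

lemma vac_weight: "vac \<in> Vh 0" and om_weight: "om \<in> Vh 4"
  using vosa unfolding vosa_def by - (elim conjE, assumption)+

lemma Vh_Vpar: "v \<in> Vh m \<Longrightarrow> v \<in> Vpar sc Vh (m mod 2)"
  unfolding Vpar_def by (rule span_base) auto

lemma Y_0 [simp]: "Y 0 n w = 0" "Y u n 0 = 0"
  using lin_0[OF Y_lin_left] lin_0[OF Y_lin_right] by auto

lemma Y_uniform_bound:
  assumes "finite A"
  shows "\<exists>M\<ge>M0. \<forall>p\<in>A. \<forall>m>M. Y (fst p) m (snd p) = 0"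
  using assms
proof (induction A)
  case (insert a A)
  then obtain M where M: "M \<ge> M0" "\<forall>p\<in>A. \<forall>m>M. Y (fst p) m (snd p) = 0" by auto
  obtain N where N: "\<forall>n\<ge>N. Y (fst a) n (snd a) = 0" using Y_truncation by blast
  show ?case using M N by (intro exI[of _ "max M N"]) auto
qed auto

text \<open>Coefficients vanish below n and modes above M, so the window may start at any n' up to
  n. Brackets with different n can then share one range of summation.\<close>

lemma brmode_h_eq:
  assumes "\<And>m. m > M \<Longrightarrow> Y v m w = 0" "n' \<le> n"
  shows "brh k v n w = (\<Sum>m\<in>{n'..M}. sc (brc k n m) (Y v m w))"
  unfolding brmode_h_def
proof (rule nzsum_eq_sum)
  fix i assume "i \<notin> {n'..M}"
  then have "i < n \<or> i > M" using assms(2) by auto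
  then show "sc (brc k n i) (Y v i w) = 0" using assms(1) brc_eq_0 by auto
qed simp

lemma brmode_h_finite: "finite {m. sc (brc k n m) (Y v m w) \<noteq> 0}"
proof -
  obtain N where N: "\<forall>m\<ge>N. Y v m w = 0" using Y_truncation by blast
  have "{m. sc (brc k n m) (Y v m w) \<noteq> 0} \<subseteq> {n..N}"
  proof
    fix m assume "m \<in> {m. sc (brc k n m) (Y v m w) \<noteq> 0}"
    then have "\<not> m < n" "\<not> N \<le> m" using N brc_eq_0 by auto
    then show "m \<in> {n..N}" by simp
  qed
  then show ?thesis using finite_subset by blast
qed

lemma brmode_h_lin_left: "lin (\<lambda>v. brh k v n w)"
  unfolding brmode_h_def by (rule nzsum_lin[OF lin_scaled[OF Y_lin_left] brmode_h_finite])

lemma brmode_h_lin_right: "lin (brh k v n)"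
  unfolding brmode_h_def by (rule nzsum_lin[OF lin_scaled[OF Y_lin_right] brmode_h_finite])

lemma brmode_h_0 [simp]: "brh k 0 n w = 0"
  by (rule lin_0[OF brmode_h_lin_left])

lemma brmode_eq:
  assumes "finite T" "\<And>m. m \<notin> T \<Longrightarrow> comp sc Vh m v = 0"
  shows "brm v n w = (\<Sum>m\<in>T. brh (of_int m / 2) (comp sc Vh m v) n w)"
  unfolding brmode_def using assms by (intro nzsum_eq_sum) auto

lemma brmode_homogeneous: "v \<in> Vh m \<Longrightarrow> brm v n w = brh (of_int m / 2) v n w"
  using brmode_eq[of "{m}" v n w] by (auto simp: comp_same[OF Vh_dirsum] comp_other[OF Vh_dirsum])

lemma brmode_finite: "finite {m. brh (of_int m / 2) (comp sc Vh m v) n w \<noteq> 0}"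
  by (rule finite_subset[OF _ comp_finite[OF Vh_dirsum, of v]]) auto

lemma brmode_lin_left: "lin (\<lambda>v. brm v n w)"
  unfolding brmode_def
  by (rule nzsum_lin[OF _ brmode_finite])
     (simp add: lin_iff lin_add[OF comp_linear[OF Vh_dirsum]] lin_scale[OF comp_linear[OF Vh_dirsum]]
       lin_add[OF brmode_h_lin_left] lin_scale[OF brmode_h_lin_left])

lemma brmode_lin_right: "lin (brm v n)"
  unfolding brmode_def by (rule nzsum_lin[OF brmode_h_lin_right brmode_finite])

lemma brmode_truncation: "\<exists>N. \<forall>n\<ge>N. brm v n w = 0"
proof (rule dirsum_induct[OF Vh_dirsum, of "\<lambda>v. \<exists>N. \<forall>n\<ge>N. brm v n w = 0" v])
  fix x y assume "\<exists>N. \<forall>n\<ge>N. brm x n w = 0" "\<exists>N. \<forall>n\<ge>N. brm y n w = 0"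
  then obtain N N' where "\<forall>n\<ge>N. brm x n w = 0" "\<forall>n\<ge>N'. brm y n w = 0" by auto
  then show "\<exists>N. \<forall>n\<ge>N. brm (x + y) n w = 0"
    by (intro exI[of _ "max N N'"]) (auto simp: lin_add[OF brmode_lin_left])
next
  show "\<exists>N. \<forall>n\<ge>N. brm 0 n w = 0" by (simp add: lin_0[OF brmode_lin_left])
next
  fix m x assume x: "x \<in> Vh m"
  obtain N where N: "\<forall>n\<ge>N. Y x n w = 0" using Y_truncation by blast
  then have "brm x n w = 0" if "n > N" for n
    using brmode_h_eq[of N x w n n] that by (simp add: brmode_homogeneous[OF x])
  then show "\<exists>N. \<forall>n\<ge>N. brm x n w = 0" by (intro exI[of _ "N + 1"]) auto
qed

lemma L0_eq:
  assumes "\<And>p. p > int P \<Longrightarrow> Y om p w = 0"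
  shows "Lb 0 w = (\<Sum>p\<le>P. sc (L0c p) (Y om (int p) w))"
proof -
  have v: "brm vac 1 w = 0"
    unfolding brmode_homogeneous[OF vac_weight] using brmode_h_eq[of 0 vac w 1 1] by (simp add: Y_vac)
  have "brm om 1 w = brh 2 om 1 w" by (simp add: brmode_homogeneous[OF om_weight])
  also have "\<dots> = (\<Sum>m\<in>{1..int P}. sc (brc 2 1 m) (Y om m w))"
    by (rule brmode_h_eq) (use assms in auto)
  also have "\<dots> = (\<Sum>p\<in>{1..P}. sc (L0c p) (Y om (int p) w))"
    by (rule sum.reindex_bij_witness[of _ int nat]) (auto simp: brc_2_1)
  also have "\<dots> = (\<Sum>p\<le>P. sc (L0c p) (Y om (int p) w))"
    by (rule sum.mono_neutral_left) (auto simp: not_less_eq_eq)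
  finally show ?thesis
    unfolding Lbr_def by (simp add: lin_diff[OF brmode_lin_left] lin_scale[OF brmode_lin_left] v)
qed

lemma L0_lin: "lin (Lb n)"
  using brmode_lin_right unfolding Lbr_def by (simp add: lin_iff)

lemma om_bound:
  assumes "finite A"
  shows "\<exists>P::nat. P \<ge> P0 \<and> (\<forall>w\<in>A. \<forall>p>int P. Y om p w = 0)"
proof -
  have "finite (Pair om ` A)" using assms by simp
  from Y_uniform_bound[OF this, of "int P0"]
  obtain M where "M \<ge> int P0" "\<forall>p\<in>(Pair om ` A). \<forall>m>M. Y (fst p) m (snd p) = 0" by blast
  then show ?thesis by (intro exI[of _ "nat M"]) auto
qed

text \<open>The axioms give one inclusion. Conversely the projections to the weight spaces commute
  with \<open>om(1)\<close>, so an eigenvector has only one component. Weights can now be verified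
  by eigenvalue equations, as in \<open>om_mode_weight\<close>.\<close>

lemma Vh_eq: "Vh m = {v. Y om 1 v = sc (of_int m / 2) v}"
proof (intro equalityI subsetI)
  fix v assume "v \<in> {v. Y om 1 v = sc (of_int m / 2) v}"
  then have v: "Y om 1 v = sc (of_int m / 2) v" by simp
  let ?C = "\<lambda>i. comp sc Vh i"
  note C = comp_linear[OF Vh_dirsum]
  have key: "?C i (Y om 1 u) = sc (of_int i / 2) (?C i u)" for i u
  proof (rule dirsum_induct[OF Vh_dirsum, of "\<lambda>u. ?C i (Y om 1 u) = sc (of_int i / 2) (?C i u)"])
    fix x y assume "?C i (Y om 1 x) = sc (of_int i / 2) (?C i x)" "?C i (Y om 1 y) = sc (of_int i / 2) (?C i y)"
    then show "?C i (Y om 1 (x + y)) = sc (of_int i / 2) (?C i (x + y))"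
      by (simp add: lin_add[OF C] lin_add[OF Y_lin_right] scale_right_distrib)
  next
    show "?C i (Y om 1 0) = sc (of_int i / 2) (?C i 0)" by (simp add: lin_0[OF C])
  next
    fix j x assume x: "x \<in> Vh j"
    show "?C i (Y om 1 x) = sc (of_int i / 2) (?C i x)"
      by (cases "j = i") (use x in \<open>auto simp: L0_weight lin_scale[OF C] comp_other[OF Vh_dirsum]\<close>)
  qed
  have z: "?C i v = 0" if "i \<noteq> m" for i
  proof -
    have "sc (of_int i / 2) (?C i v) = sc (of_int m / 2) (?C i v)"
      using key[of i v] unfolding v lin_scale[OF C] by (rule sym)
    then have "sc ((of_int i - of_int m) / 2) (?C i v) = 0"
      by (simp only: diff_divide_distrib scale_left_diff_distrib diff_self)
    then show ?thesis using that by simp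
  qed
  have "v = (\<Sum>i\<in>{m}. ?C i v)"
  proof -
    have "(\<Sum>i\<in>{i. ?C i v \<noteq> 0}. ?C i v) = (\<Sum>i\<in>{m}. ?C i v)"
      using z by (intro sum.mono_neutral_left) auto
    then show ?thesis using comp_sum[OF Vh_dirsum, of v] by simp
  qed
  then show "v \<in> Vh m" using comp_props(1)[OF Vh_dirsum, of m v] by simp
qed (simp add: L0_weight)

lemma om_mode_weight: "v \<in> Vh m \<Longrightarrow> Y om n v \<in> Vh (m + 2 - 2 * n)"
proof -
  assume v: "v \<in> Vh m"
  have "Y om 1 (Y om n v) - Y om n (Y om 1 v) = sc (of_int (1 - n)) (Y om n v)"
    using Virasoro[of 0 "n - 1" v] by (auto split: if_splits)
  then have "Y om 1 (Y om n v) = sc (of_int (1 - n)) (Y om n v) + sc (of_int m / 2) (Y om n v)"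
    by (simp add: L0_weight[OF v] lin_scale[OF Y_lin_right] algebra_simps)
  also have "\<dots> = sc (of_int (m + 2 - 2 * n) / 2) (Y om n v)"
    unfolding scale_left_distrib [symmetric] by (simp add: field_simps)
  finally show ?thesis by (simp add: Vh_eq)
qed

text \<open>The Jacobi identity with r = 0, where only i = 0 survives on the right. No sign occurs
  because om is even, and the binomials end the other sum at i = p.\<close>

lemma om_commutator:
  assumes v: "v \<in> Vh m"
  shows "Y om (int p) (Y v q w) - Y v q (Y om (int p) w) =
    (\<Sum>i\<le>p. sc (of_nat (p choose i)) (Y (Y om (int i) v) (int p + q - int i) w))"
proof -
  have om: "om \<in> Vpar sc Vh 0" using Vh_Vpar[OF om_weight] by simp
  have "m mod 2 \<in> {0, 1}" by auto
  from eventually_conj[OF Jacobi[OF _ this om Vh_Vpar[OF v], of "int p" 0 q w] eventually_ge_at_top[of p]]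
  obtain M where J: "(\<Sum>i\<le>M. sc (of_int (int p) gchoose i) (Y (Y om (0 + int i) v) (int p + q - int i) w)) =
           (\<Sum>i\<le>M. sc ((-1) ^ i * (of_int 0 gchoose i))
               (Y om (int p + 0 - int i) (Y v (q + int i) w)
                - sc ((-1) powi 0 * (-1) ^ nat (0 * (m mod 2))) (Y v (q + 0 - int i) (Y om (int p + int i) w))))"
    and M: "p \<le> M"
    using eventually_happens[of _ sequentially] by fastforce
  have "(\<Sum>i\<le>M. sc (of_int (int p) gchoose i) (Y (Y om (0 + int i) v) (int p + q - int i) w))
    = (\<Sum>i\<le>p. sc (of_nat (p choose i)) (Y (Y om (int i) v) (int p + q - int i) w))"
    using M by (intro sum.mono_neutral_cong_right) (auto simp: binomial_gbinomial [symmetric] binomial_eq_0)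
  moreover have "(\<Sum>i\<le>M. sc ((-1) ^ i * (of_int 0 gchoose i))
               (Y om (int p + 0 - int i) (Y v (q + int i) w)
                - sc ((-1) powi 0 * (-1) ^ nat (0 * (m mod 2))) (Y v (q + 0 - int i) (Y om (int p + int i) w))))
    = (\<Sum>i\<in>{0::nat}. Y om (int p) (Y v q w) - Y v q (Y om (int p) w))"
    by (intro sum.mono_neutral_cong_right) (auto simp: gbinomial_0_left)
  ultimately show ?thesis using J by simp
qed
end

context vosa_data begin

text \<open>Regrouping by s = q + j. The shifted range can be moved back because the modes vanish
  above M and the coefficients below n.\<close>

lemma convolution_sum:
  fixes u :: "int \<Rightarrow> 'v" and a :: "nat \<Rightarrow> complex" and \<beta> :: "int \<Rightarrow> complex"
  assumes "\<And>s. s > M \<Longrightarrow> u s = 0" "\<And>q. q < n \<Longrightarrow> \<beta> q = 0"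
  shows "(\<Sum>j\<le>J. \<Sum>q\<in>{n..M}. sc (a j * \<beta> q) (u (q + int j)))
    = (\<Sum>s\<in>{n..M}. sc (\<Sum>j\<le>J. a j * \<beta> (s - int j)) (u s))"
proof -
  have "(\<Sum>q\<in>{n..M}. sc (a j * \<beta> q) (u (q + int j))) = (\<Sum>s\<in>{n..M}. sc (a j * \<beta> (s - int j)) (u s))" for j
  proof -
    have "(\<Sum>q\<in>{n..M}. sc (a j * \<beta> q) (u (q + int j))) = (\<Sum>s\<in>{n + int j..M + int j}. sc (a j * \<beta> (s - int j)) (u s))"
      by (rule sum.reindex_bij_witness[of _ "\<lambda>s. s - int j" "\<lambda>q. q + int j"]) auto
    also have "\<dots> = (\<Sum>s\<in>{n..M}. sc (a j * \<beta> (s - int j)) (u s))"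
      by (rule sum.mono_neutral_cong) (use assms in auto)
    finally show ?thesis .
  qed
  then have "(\<Sum>j\<le>J. \<Sum>q\<in>{n..M}. sc (a j * \<beta> q) (u (q + int j)))
      = (\<Sum>j\<le>J. \<Sum>s\<in>{n..M}. sc (a j * \<beta> (s - int j)) (u s))" by simp
  also have "\<dots> = (\<Sum>s\<in>{n..M}. \<Sum>j\<le>J. sc (a j * \<beta> (s - int j)) (u s))" by (rule sum.swap)
  finally show ?thesis by (simp add: scale_sum_left)
qed

lemma sum_triangle:
  fixes f :: "nat \<Rightarrow> nat \<Rightarrow> 'v"
  shows "(\<Sum>p\<le>P. \<Sum>i\<le>p. f p i) = (\<Sum>i\<le>P. \<Sum>j\<le>P - i. f (i + j) i)"
proof -
  have "(\<Sum>p\<le>P. \<Sum>i\<le>p. f p i) = (\<Sum>(p,i)\<in>(SIGMA p:{..P}. {..p}). f p i)" by (rule sum.Sigma) auto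
  also have "\<dots> = (\<Sum>(i,j)\<in>(SIGMA i:{..P}. {..P - i}). f (i + j) i)"
    by (rule sum.reindex_bij_witness[of _ "\<lambda>(i,j). (i + j, i)" "\<lambda>(p,i). (i, p - i)"]) auto
  also have "\<dots> = (\<Sum>i\<le>P. \<Sum>j\<le>P - i. f (i + j) i)" by (rule sum.Sigma [symmetric]) auto
  finally show ?thesis .
qed

text \<open>The modes of \<open>om(i) v\<close> in the commutator formula are weighted by the i-th
  Hasse derivative of the symbol. For i \<ge> 2 this reproduces the corresponding term of
  \<open>(L[0] v)[n]\<close>. For i = 1 there is an excess \<open>k v[n + 1]\<close>, which the term
  i = 0 cancels by the translation property, leaving \<open>-(n + 1) v[n]\<close>.\<close>

lemma L0_commutator_homogeneous:
  assumes v: "v \<in> Vh m"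
  shows "Lb 0 (brm v n w) = brm v n (Lb 0 w) + brm (Lb 0 v) n w - sc (of_int (n + 1)) (brm v n w)"
proof -
  define k :: complex where "k = of_int m / 2"
  define u where "u i = Y om (int i) v" for i
  have uV: "u i \<in> Vh (m + 2 - 2 * int i)" for i unfolding u_def by (rule om_mode_weight[OF v])
  obtain P0 where P0: "\<And>p. p > int P0 \<Longrightarrow> Y om p w = 0" "\<And>p. p > int P0 \<Longrightarrow> Y om p v = 0"
    using om_bound[of "{w, v}" 0] by auto
  define A where "A = insert (v, w) ((\<lambda>p. (v, Y om (int p) w)) ` {..P0} \<union> (\<lambda>i. (u i, w)) ` {..P0})"
  have "finite A" by (simp add: A_def)
  from Y_uniform_bound[OF this, of n] obtain M0 where M0: "M0 \<ge> n" "\<forall>p\<in>A. \<forall>m>M0. Y (fst p) m (snd p) = 0" by blast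
  \<comment> \<open>The extra 1 makes \<open>Y v s w\<close> vanish already at s = M, as the shift
    of the summation range in the term i = 0 requires.\<close>
  define M where "M = M0 + 1"
  have vM: "Y v s w = 0" if "s \<ge> M" for s using M0(2) that by (auto simp: A_def M_def)
  have vomM: "Y v s (Y om (int p) w) = 0" if "s > M" for s p
    by (cases "p \<le> P0") (use M0(2)[rule_format, of "(v, Y om (int p) w)" s] P0(1)[of "int p"] that in \<open>auto simp: A_def M_def\<close>)
  have uM: "Y (u i) s w = 0" if "s > M" for s i
    by (cases "i \<le> P0") (use M0(2)[rule_format, of "(u i, w)" s] P0(2)[of "int i"] that in \<open>auto simp: A_def M_def u_def\<close>)
  \<comment> \<open>Every inner sum over j \<le> P - i with i \<le> P0 + 1 must reach s - n for all
    s \<le> M, as the lemmas on \<open>brc\<close> demand. The bound P0 + 1 includes i = 1 also when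
    P0 = 0.\<close>
  obtain P where P: "P \<ge> P0 + nat (M - n) + 1" "\<And>q p. q \<in> {n..M} \<Longrightarrow> p > int P \<Longrightarrow> Y om p (Y v q w) = 0"
    using om_bound[of "(\<lambda>q. Y v q w) ` {n..M}" "P0 + nat (M - n) + 1"] by auto
  have u0: "u i = 0" if "i > P0" for i using P0(2)[of "int i"] that by (simp add: u_def)
  define \<beta> where "\<beta> q = brc k n q" for q
  have \<beta>0: "\<And>q. q < n \<Longrightarrow> \<beta> q = 0" by (simp add: \<beta>_def brc_eq_0)
  have B: "brm v n w = (\<Sum>q\<in>{n..M}. sc (\<beta> q) (Y v q w))"
    unfolding brmode_homogeneous[OF v] k_def [symmetric] \<beta>_def by (rule brmode_h_eq) (use vM in auto)
  have LB: "Lb 0 (brm v n w) = (\<Sum>p\<le>P. \<Sum>q\<in>{n..M}. sc (L0c p * \<beta> q) (Y om (int p) (Y v q w)))"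
  proof -
    have om: "Y om p (brm v n w) = (\<Sum>q\<in>{n..M}. sc (\<beta> q) (Y om p (Y v q w)))" for p
      unfolding B by (simp add: lin_sum[OF Y_lin_right] lin_scale[OF Y_lin_right])
    have "Lb 0 (brm v n w) = (\<Sum>p\<le>P. sc (L0c p) (Y om (int p) (brm v n w)))"
      by (rule L0_eq) (use P(2) in \<open>auto simp: om\<close>)
    then show ?thesis unfolding om by (simp add: scale_sum_right)
  qed
  have BL: "brm v n (Lb 0 w) = (\<Sum>p\<le>P. \<Sum>q\<in>{n..M}. sc (L0c p * \<beta> q) (Y v q (Y om (int p) w)))"
  proof -
    have "Lb 0 w = (\<Sum>p\<le>P. sc (L0c p) (Y om (int p) w))"
      by (rule L0_eq) (use P(1) P0(1) in auto)
    then have "brm v n (Lb 0 w) = (\<Sum>p\<le>P. sc (L0c p) (brm v n (Y om (int p) w)))"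
      by (simp add: lin_sum[OF brmode_lin_right] lin_scale[OF brmode_lin_right])
    moreover have "brm v n (Y om (int p) w) = (\<Sum>q\<in>{n..M}. sc (\<beta> q) (Y v q (Y om (int p) w)))" for p
      unfolding brmode_homogeneous[OF v] k_def [symmetric] \<beta>_def by (rule brmode_h_eq) (use vomM in auto)
    ultimately show ?thesis by (simp add: scale_sum_right)
  qed
  define W where "W i = (\<Sum>s\<in>{n..M}. sc (\<Sum>j\<le>P - i. (L0c (i + j) * of_nat ((i + j) choose i)) * \<beta> (s - int j)) (Y (u i) s w))" for i
  have D: "Lb 0 (brm v n w) - brm v n (Lb 0 w) = (\<Sum>i\<le>P. W i)"
  proof -
    have "Lb 0 (brm v n w) - brm v n (Lb 0 w)
       = (\<Sum>p\<le>P. \<Sum>q\<in>{n..M}. sc (L0c p * \<beta> q) (Y om (int p) (Y v q w) - Y v q (Y om (int p) w)))"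
      unfolding LB BL by (simp add: sum_subtractf scale_right_diff_distrib)
    also have "\<dots> = (\<Sum>p\<le>P. \<Sum>q\<in>{n..M}. \<Sum>i\<le>p. sc (L0c p * of_nat (p choose i) * \<beta> q) (Y (u i) (q + int (p - i)) w))"
    proof (intro sum.cong refl)
      fix p q
      show "sc (L0c p * \<beta> q) (Y om (int p) (Y v q w) - Y v q (Y om (int p) w))
        = (\<Sum>i\<le>p. sc (L0c p * of_nat (p choose i) * \<beta> q) (Y (u i) (q + int (p - i)) w))"
        unfolding om_commutator[OF v] scale_sum_right u_def
        by (intro sum.cong refl) (auto simp: algebra_simps of_nat_diff)
    qed
    also have "\<dots> = (\<Sum>p\<le>P. \<Sum>i\<le>p. \<Sum>q\<in>{n..M}. sc (L0c p * of_nat (p choose i) * \<beta> q) (Y (u i) (q + int (p - i)) w))"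
      by (intro sum.cong refl sum.swap)
    also have "\<dots> = (\<Sum>i\<le>P. \<Sum>j\<le>P - i. \<Sum>q\<in>{n..M}. sc (L0c (i + j) * of_nat ((i + j) choose i) * \<beta> q) (Y (u i) (q + int (i + j - i)) w))"
      by (rule sum_triangle)
    also have "\<dots> = (\<Sum>i\<le>P. W i)"
      unfolding W_def add_diff_cancel_left'
      by (intro sum.cong refl convolution_sum) (use uM \<beta>0 in auto)
    finally show ?thesis .
  qed
  define Z where "Z i = brm (u i) n w" for i
  have Z: "Z i = (\<Sum>s\<in>{n..M}. sc (brc (k + 1 - of_nat i) n s) (Y (u i) s w))" for i
  proof -
    have "Z i = brh (of_int (m + 2 - 2 * int i) / 2) (u i) n w"
      unfolding Z_def by (rule brmode_homogeneous[OF uV])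
    also have "of_int (m + 2 - 2 * int i) / 2 = k + 1 - of_nat i"
      by (simp add: k_def field_simps)
    also have "brh (k + 1 - of_nat i) (u i) n w = (\<Sum>s\<in>{n..M}. sc (brc (k + 1 - of_nat i) n s) (Y (u i) s w))"
      by (rule brmode_h_eq) (use uM in auto)
    finally show ?thesis .
  qed
  have LZ: "brm (Lb 0 v) n w = (\<Sum>i\<le>P. sc (L0c i) (Z i))"
  proof -
    have "Lb 0 v = (\<Sum>p\<le>P. sc (L0c p) (u p))"
      unfolding u_def by (rule L0_eq) (use P(1) P0(2) in auto)
    then show ?thesis unfolding Z_def by (simp add: lin_sum[OF brmode_lin_left] lin_scale[OF brmode_lin_left])
  qed
  have big: "P - i \<ge> nat (s - n)" if "i \<le> P0 + 1" "s \<le> M" for i s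
    using P(1) that by linarith
  have next_mode: "brm v (n + 1) w = (\<Sum>s\<in>{n..M}. sc (brc k (n + 1) s) (Y v s w))"
    unfolding brmode_homogeneous[OF v] k_def [symmetric] by (rule brmode_h_eq) (use vM in auto)
  have W_ge2: "W (i + 2) = sc (L0c (i + 2)) (Z (i + 2))" for i
  proof (cases "i + 2 \<le> P0")
    case True
    have "(\<Sum>j\<le>P - (i + 2). (L0c (i + 2 + j) * of_nat ((i + 2 + j) choose (i + 2))) * \<beta> (s - int j)) = L0c (i + 2) * brc (k + 1 - of_nat (i + 2)) n s"
      if "s \<le> M" for s
    proof -
      have "(\<Sum>j\<le>P - (i + 2). L0c (j + (i + 2)) * of_nat ((j + (i + 2)) choose (i + 2)) * brc k n (s - int j)) = L0c (i + 2) * brc (k - of_nat (i + 1)) n s"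
        by (rule brc_L0_hasse) (rule big, use True that in auto)
      moreover have "k - of_nat (i + 1) = k + 1 - of_nat (i + 2)" by simp
      ultimately show ?thesis unfolding \<beta>_def by (simp only: add.commute[of "i + 2"])
    qed
    then show ?thesis unfolding W_def Z by (simp add: scale_sum_right)
  qed (simp add: W_def Z u0)
  have W1: "W 1 = Z 1 + sc k (brm v (n + 1) w)"
  proof -
    have "(\<Sum>j\<le>P - 1. (L0c (1 + j) * of_nat ((1 + j) choose 1)) * \<beta> (s - int j)) = brc k n s + brc k (n + 1) s"
      if "s \<le> M" for s
    proof -
      have "(\<Sum>j\<le>P - 1. of_nat (Suc j) * L0c (Suc j) * brc k n (s - int j)) = brc k n s + brc k (n + 1) s"
        by (rule brc_L0_deriv) (rule big, use that in auto)
      then show ?thesis unfolding \<beta>_def by (simp add: mult_ac del: of_nat_Suc)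
    qed
    then have "W 1 = (\<Sum>s\<in>{n..M}. sc (brc k n s) (Y (u 1) s w)) + (\<Sum>s\<in>{n..M}. sc (brc k (n + 1) s) (Y (u 1) s w))"
      unfolding W_def by (simp add: scale_left_distrib sum.distrib)
    also have "(\<Sum>s\<in>{n..M}. sc (brc k n s) (Y (u 1) s w)) = Z 1" by (simp add: Z)
    also have "u 1 = sc k v" using L0_weight[OF v] by (simp add: u_def k_def)
    also have "(\<Sum>s\<in>{n..M}. sc (brc k (n + 1) s) (Y (sc k v) s w)) = sc k (brm v (n + 1) w)"
      unfolding next_mode by (simp add: lin_scale[OF Y_lin_left] scale_sum_right mult.commute)
    finally show ?thesis .
  qed
  have W0: "W 0 = - sc k (brm v (n + 1) w) - sc (of_int (n + 1)) (brm v n w)"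
  proof -
    have "(\<Sum>j\<le>P - 0. (L0c (0 + j) * of_nat ((0 + j) choose 0)) * \<beta> (s - int j)) = brc (k + 1) (n + 1) s"
      if "s \<le> M" for s
    proof -
      have "(\<Sum>j\<le>P - 0. L0c j * brc k n (s - int j)) = brc (k + 1) (n + 1) s"
        by (rule brc_L0) (rule big, use that in auto)
      then show ?thesis unfolding \<beta>_def by simp
    qed
    then have "W 0 = (\<Sum>s\<in>{n..M}. sc (brc (k + 1) (n + 1) s) (Y (u 0) s w))"
      unfolding W_def by (intro sum.cong refl) simp
    also have "\<dots> = (\<Sum>s\<in>{n..M}. - sc (k * brc k (n + 1) (s - 1) + of_int (n + 1) * brc k n (s - 1)) (Y v (s - 1) w))"
    proof (intro sum.cong refl)
      fix s
      have "sc (brc (k + 1) (n + 1) s) (Y (u 0) s w) = - sc (of_int s * brc (k + 1) (n + 1) s) (Y v (s - 1) w)"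
        unfolding u_def using translation_mode[of v s w] by (simp add: mult.commute)
      then show "sc (brc (k + 1) (n + 1) s) (Y (u 0) s w) = - sc (k * brc k (n + 1) (s - 1) + of_int (n + 1) * brc k n (s - 1)) (Y v (s - 1) w)"
        unfolding brc_translation .
    qed
    also have "\<dots> = (\<Sum>t\<in>{n - 1..M - 1}. - sc (k * brc k (n + 1) t + of_int (n + 1) * brc k n t) (Y v t w))"
      by (rule sum.reindex_bij_witness[of _ "\<lambda>t. t + 1" "\<lambda>s. s - 1"]) auto
    also have "\<dots> = (\<Sum>t\<in>{n..M}. - sc (k * brc k (n + 1) t + of_int (n + 1) * brc k n t) (Y v t w))"
      by (rule sum.mono_neutral_cong) (use vM[of M] in \<open>auto simp: brc_eq_0 not_le\<close>)
    also have "\<dots> = - sc k (brm v (n + 1) w) - sc (of_int (n + 1)) (brm v n w)"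
      unfolding next_mode B \<beta>_def
      by (simp add: scale_left_distrib sum.distrib sum_negf sum_subtractf scale_sum_right)
    finally show ?thesis .
  qed
  have split: "(\<Sum>i\<le>P. f i) = f 0 + f 1 + (\<Sum>i\<in>{2..P}. f i)" for f :: "nat \<Rightarrow> 'v"
  proof -
    have "{..P} = insert 0 (insert 1 {2..P})" using P(1) by auto
    then show ?thesis by (simp add: add.assoc)
  qed
  have "(\<Sum>i\<in>{2..P}. W i) = (\<Sum>i\<in>{2..P}. sc (L0c i) (Z i))"
  proof (intro sum.cong refl)
    fix i assume "i \<in> {2..P}"
    then obtain j where "i = j + 2" by (metis atLeastAtMost_iff le_add_diff_inverse2)
    then show "W i = sc (L0c i) (Z i)" using W_ge2 by simp
  qed
  then have "(\<Sum>i\<le>P. W i) = (\<Sum>i\<le>P. sc (L0c i) (Z i)) - sc (of_int (n + 1)) (brm v n w)"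
    unfolding split W0 W1 by simp
  then show ?thesis using D LZ by (simp add: algebra_simps)
qed

lemma L0_commutator:
  "Lb 0 (brm v n w) = brm v n (Lb 0 w) + brm (Lb 0 v) n w - sc (of_int (n + 1)) (brm v n w)"
proof (rule dirsum_induct[OF Vh_dirsum, of "\<lambda>v. Lb 0 (brm v n w) = brm v n (Lb 0 w) + brm (Lb 0 v) n w - sc (of_int (n + 1)) (brm v n w)"])
  fix x y
  assume "Lb 0 (brm x n w) = brm x n (Lb 0 w) + brm (Lb 0 x) n w - sc (of_int (n + 1)) (brm x n w)"
    "Lb 0 (brm y n w) = brm y n (Lb 0 w) + brm (Lb 0 y) n w - sc (of_int (n + 1)) (brm y n w)"
  then show "Lb 0 (brm (x + y) n w) = brm (x + y) n (Lb 0 w) + brm (Lb 0 (x + y)) n w - sc (of_int (n + 1)) (brm (x + y) n w)"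
    by (simp add: lin_add[OF L0_lin] lin_add[OF brmode_lin_left] scale_right_distrib)
next
  show "Lb 0 (brm 0 n w) = brm 0 n (Lb 0 w) + brm (Lb 0 0) n w - sc (of_int (n + 1)) (brm 0 n w)"
    by (simp add: lin_0[OF L0_lin] lin_0[OF brmode_lin_left])
qed (rule L0_commutator_homogeneous)

lemma brmode_weight:
  assumes "Lb 0 v = sc k v" "Lb 0 w = sc l w"
  shows "Lb 0 (brm v n w) = sc (k + l - of_int n - 1) (brm v n w)"
  unfolding L0_commutator assms lin_scale[OF brmode_lin_right] lin_scale[OF brmode_lin_left]
  by (simp add: scale_left_distrib scale_left_diff_distrib algebra_simps)
end

section \<open>The grading by L[0]\<close>

lemma zpow_0 [simp]: "zpow g 0 x = x"
  by (simp add: zpow_def)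

lemma zpow_1 [simp]: "zpow g 1 x = g x"
  by (simp add: zpow_def)

lemma zpow_Suc:
  assumes "bij g"
  shows "zpow g (i + 1) x = g (zpow g i x)"
proof (cases "i \<ge> 0")
  case True
  then have "nat (i + 1) = Suc (nat i)" by simp
  then show ?thesis using True by (simp add: zpow_def)
next
  case False
  then have n: "nat (- i) = Suc (nat (- i - 1))" by simp
  have "g (zpow g i x) = (inv g ^^ nat (- i - 1)) x"
    using False assms by (simp add: zpow_def n bij_is_surj surj_f_inv_f)
  also have "\<dots> = zpow g (i + 1) x"
  proof (cases "i = -1")
    case False
    then show ?thesis using \<open>\<not> i \<ge> 0\<close> by (simp add: zpow_def)
  qed (simp add: zpow_def)
  finally show ?thesis by simp
qed

lemma zpow_pred: "bij g \<Longrightarrow> g (zpow g (i - 1) x) = zpow g i x"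
  using zpow_Suc[of g "i - 1" x] by simp

lemma zpow_add:
  assumes "bij g"
  shows "zpow g (i + j) x = zpow g i (zpow g j x)"
proof (induction i rule: int_induct[of _ 0])
  case (step1 i)
  have "zpow g (i + 1 + j) x = g (zpow g (i + j) x)"
    using zpow_Suc[OF assms, of "i + j" x] by (simp add: algebra_simps)
  then show ?case using step1 by (simp add: zpow_Suc[OF assms])
next
  case (step2 i)
  have "g (zpow g (i - 1 + j) x) = zpow g (i + j) x"
    using zpow_pred[OF assms, of "i + j" x] by (simp add: algebra_simps)
  also have "\<dots> = g (zpow g (i - 1) (zpow g j x))" using step2 by (simp add: zpow_pred[OF assms])
  finally show ?case using assms by (meson bij_is_inj injD)
qed simp

lemma zpow_commute1:
  assumes "bij g" "g \<circ> h = h \<circ> g"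
  shows "zpow g i (h x) = h (zpow g i x)"
proof (induction i rule: int_induct[of _ 0])
  case (step1 i)
  then show ?case using fun_cong[OF assms(2)] by (simp add: zpow_Suc[OF assms(1)])
next
  case (step2 i)
  have "g (zpow g (i - 1) (h x)) = g (h (zpow g (i - 1) x))"
    using step2 fun_cong[OF assms(2)] by (simp add: zpow_pred[OF assms(1)])
  then show ?case using assms(1) by (meson bij_is_inj injD)
qed simp

lemma zpow_commute:
  assumes "bij g" "bij h" "g \<circ> h = h \<circ> g"
  shows "zpow g i (zpow h j x) = zpow h j (zpow g i x)"
proof -
  have "h \<circ> zpow g i = zpow g i \<circ> h"
    using zpow_commute1[OF assms(1,3)] by (simp add: fun_eq_iff)
  from zpow_commute1[OF assms(2) this] show ?thesis by simp
qed

lemma bij_zpow: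
  assumes "bij g"
  shows "bij (zpow g i)"
proof (rule o_bij)
  show "zpow g i \<circ> zpow g (- i) = id" "zpow g (- i) \<circ> zpow g i = id"
    using zpow_add[OF assms, of i "- i"] zpow_add[OF assms, of "- i" i] by (auto simp: fun_eq_iff)
qed

lemma zpow_comp_zpow:
  assumes g: "bij g" and h: "bij h" and gh: "g \<circ> h = h \<circ> g"
  shows "zpow (zpow g a \<circ> zpow h b) d x = zpow g (a * d) (zpow h (b * d) x)"
proof -
  let ?k = "zpow g a \<circ> zpow h b"
  have k: "bij ?k" using bij_zpow g h bij_comp by blast
  have step: "?k (zpow g (a * i) (zpow h (b * i) x)) = zpow g (a * (i + 1)) (zpow h (b * (i + 1)) x)" for i
    by (simp add: zpow_commute[OF g h gh, symmetric] distrib_left zpow_add[OF g] zpow_add[OF h])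
       (simp add: zpow_add[OF g, symmetric] zpow_add[OF h, symmetric] add.commute)
  show ?thesis
  proof (induction d rule: int_induct[of _ 0])
    case (step1 i)
    then show ?case using step[of i] by (simp add: zpow_Suc[OF k] del: o_apply)
  next
    case (step2 i)
    have "?k (zpow g (a * (i - 1)) (zpow h (b * (i - 1)) x)) = zpow g (a * i) (zpow h (b * i) x)"
      using step[of "i - 1"] by (simp del: o_apply)
    then have "?k (zpow ?k (i - 1) x) = ?k (zpow g (a * (i - 1)) (zpow h (b * (i - 1)) x))"
      using step2 by (simp only: zpow_pred[OF k])
    then show ?case using k by (meson bij_is_inj injD)
  qed simp
qed

text \<open>\<open>\<gamma>\<^sup>-\<^sup>1\<close> takes \<open>(g, h) \<gamma>\<close> back to \<open>(g, h)\<close>.\<close>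
lemma zpow_recover:
  assumes g: "bij g" and h: "bij h" and gh: "g \<circ> h = h \<circ> g" and det: "a * d - b * c = 1"
  defines "G \<equiv> zpow g a \<circ> zpow h c" and "H \<equiv> zpow g b \<circ> zpow h d"
  shows "zpow G d (zpow H (- c) x) = g x" "zpow G (- b) (zpow H a x) = h x"
proof -
  have "zpow G d (zpow H (- c) x) = zpow g (a * d) (zpow h (c * d) (zpow g (b * - c) (zpow h (d * - c) x)))"
    unfolding G_def H_def zpow_comp_zpow[OF g h gh] ..
  also have "\<dots> = zpow g (a * d + b * - c) (zpow h (c * d + d * - c) x)"
    by (simp only: zpow_commute[OF g h gh, symmetric] zpow_add[OF g] zpow_add[OF h])
  also have "a * d + b * - c = 1" using det by simp
  also have "c * d + d * - c = 0" by simp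
  finally show "zpow G d (zpow H (- c) x) = g x" by simp
  have "zpow G (- b) (zpow H a x) = zpow g (a * - b) (zpow h (c * - b) (zpow g (b * a) (zpow h (d * a) x)))"
    unfolding G_def H_def zpow_comp_zpow[OF g h gh] ..
  also have "\<dots> = zpow g (a * - b + b * a) (zpow h (c * - b + d * a) x)"
    by (simp only: zpow_commute[OF g h gh, symmetric] zpow_add[OF g] zpow_add[OF h])
  also have "a * - b + b * a = 0" by simp
  also have "c * - b + d * a = 1" using det by (simp add: algebra_simps)
  finally show "zpow G (- b) (zpow H a x) = h x" by simp
qed

context complex_vs begin

lemma zpow_eigenvector:
  assumes g: "lin g" "bij g" and v: "g v = sc \<alpha> v" and \<alpha>: "\<alpha> \<noteq> 0"
  shows "zpow g i v = sc (\<alpha> powi i) v"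
proof (induction i rule: int_induct[of _ 0])
  case (step1 i)
  then show ?case using \<alpha> by (simp add: zpow_Suc[OF g(2)] lin_scale[OF g(1)] v power_int_add)
next
  case (step2 i)
  have "g (zpow g (i - 1) v) = sc (\<alpha> powi (i - 1 + 1)) v" using step2 by (simp add: zpow_pred[OF g(2)])
  also have "\<dots> = g (sc (\<alpha> powi (i - 1)) v)"
    using \<alpha> by (subst power_int_add_1) (simp_all add: lin_scale[OF g(1)] v)
  finally show ?case using g(2) by (meson bij_is_inj injD)
qed simp

lemma lin_zpow:
  assumes g: "lin g" "bij g"
  shows "lin (zpow g i)"
proof (induction i rule: int_induct[of _ 0])
  case base
  show ?case by (simp add: lin_iff)
next
  case (step1 i)
  then show ?case by (simp add: zpow_Suc[OF g(2)] lin_iff lin_add[OF g(1)] lin_scale[OF g(1)])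
next
  case (step2 i)
  have inj: "x = y" if "g x = g y" for x y using that g(2) by (meson bij_is_inj injD)
  show ?case unfolding lin_iff
  proof (intro conjI allI; rule inj)
    show "g (zpow g (i - 1) (x + y)) = g (zpow g (i - 1) x + zpow g (i - 1) y)" for x y
      using step2 by (simp add: lin_add[OF g(1)] zpow_pred[OF g(2)] lin_add)
    show "g (zpow g (i - 1) (sc r x)) = g (sc r (zpow g (i - 1) x))" for r x
      using step2 by (simp add: lin_scale[OF g(1)] zpow_pred[OF g(2)] lin_scale)
  qed
qed

end

section \<open>Diagonalization of \<open>L[0]\<close> and its compatibility with parity and
  automorphisms\<close>

context vosa_data begin

text \<open>The symbol starts with x, so \<open>L[0]\<close> is \<open>L(0) = om(1)\<close> plus
  multiples of \<open>om(p)\<close> with p \<ge> 2, and these lower the index m by 2 p - 2.\<close>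

lemma L0_diff_weight_lower:
  assumes v: "v \<in> Vh m"
  shows "Lb 0 v - sc (of_int m / 2) v \<in> span (\<Union>i\<in>{..<m}. Vh i)"
proof -
  obtain P where P: "P \<ge> 1" "\<And>p. p > int P \<Longrightarrow> Y om p v = 0" using om_bound[of "{v}" 1] by auto
  have "Lb 0 v = (\<Sum>p\<le>P. sc (L0c p) (Y om (int p) v))"
    by (rule L0_eq) (use P in auto)
  moreover have "{..P} = insert 0 (insert 1 {2..P})" using P(1) by auto
  ultimately have "Lb 0 v = Y om 1 v + (\<Sum>p\<in>{2..P}. sc (L0c p) (Y om (int p) v))"
    by simp
  then have "Lb 0 v - sc (of_int m / 2) v = (\<Sum>p\<in>{2..P}. sc (L0c p) (Y om (int p) v))"
    by (simp add: L0_weight[OF v])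
  also have "\<dots> \<in> span (\<Union>i\<in>{..<m}. Vh i)"
    by (intro span_sum span_scale span_base) (use om_mode_weight[OF v] in force)
  finally show ?thesis .
qed

text \<open>\<open>L[0] - L(0)\<close> lowers the \<open>L(0)\<close>-weight and the weights are bounded below, so \<open>L[0]\<close> is locally
  annihilated by a polynomial with simple roots.\<close>
lemma L0_annihilated: "\<exists>js. distinct js \<and> annihilator (Lb 0) js v = 0"
proof -
  obtain m0 where m0: "\<And>m. m < m0 \<Longrightarrow> Vh m = {0}" using Vh_bounded by auto
  \<comment> \<open>A filtration by the lowest d weights. On \<open>S (d + 1)\<close> the factor
    with root (m0 + d) / 2 lands in \<open>S d\<close>, which explains the choice of roots in
    \<open>js\<close>.\<close>
  define S where "S d = span (\<Union>i\<in>{..<m0 + int d}. Vh i)" for d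
  define js where "js d = map (\<lambda>i. (of_int m0 + of_nat i) / 2 :: complex) [0..<d]" for d
  have js: "js (Suc d) = js d @ [of_int (m0 + int d) / 2]" for d by (simp add: js_def)
  have dist: "distinct (js d)" for d
    by (auto simp: js_def distinct_map inj_on_def)
  have T: "Lb 0 u - sc (of_int (m0 + int d) / 2) u \<in> S d" if u: "u \<in> S (Suc d)" for u d
  proof -
    have sub: "subspace {u. Lb 0 u - sc (of_int (m0 + int d) / 2) u \<in> S d}"
      unfolding S_def
      using lin_subspace_vimage[OF annihilator_linear[OF L0_lin, of 0 "[of_int (m0 + int d) / 2]"] subspace_span]
      by (simp only: annihilator_simps)
    have gen: "x \<in> {u. Lb 0 u - sc (of_int (m0 + int d) / 2) u \<in> S d}" if x: "x \<in> (\<Union>i\<in>{..<m0 + int (Suc d)}. Vh i)" for x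
    proof -
      obtain i where i: "i < m0 + int (Suc d)" "x \<in> Vh i" using x by auto
      have le: "span (\<Union>i'\<in>{..<i}. Vh i') \<subseteq> S d"
        unfolding S_def by (rule span_mono) (use i(1) in force)
      have 1: "Lb 0 x - sc (of_int i / 2) x \<in> S d" using L0_diff_weight_lower[OF i(2)] le by blast
      show ?thesis
      proof (cases "i = m0 + int d")
        case True
        then show ?thesis using 1 by simp
      next
        case False
        then have "x \<in> S d" unfolding S_def using i by (intro span_base) auto
        then have "(Lb 0 x - sc (of_int i / 2) x) + sc (of_int i / 2 - of_int (m0 + int d) / 2) x \<in> S d"
          using 1 unfolding S_def by (intro span_add span_scale)
        moreover have "(Lb 0 x - sc (of_int i / 2) x) + sc (of_int i / 2 - of_int (m0 + int d) / 2) x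
            = Lb 0 x - sc (of_int (m0 + int d) / 2) x"
          unfolding scale_left_diff_distrib by simp
        ultimately have "Lb 0 x - sc (of_int (m0 + int d) / 2) x \<in> S d" by (simp only:)
        then show ?thesis by (simp only: mem_Collect_eq)
      qed
    qed
    have "u \<in> {u. Lb 0 u - sc (of_int (m0 + int d) / 2) u \<in> S d}"
      by (rule span_subspace_induct[OF u[unfolded S_def] sub gen])
    then show ?thesis by simp
  qed
  have ann: "u \<in> S d \<Longrightarrow> annihilator (Lb 0) (js d) u = 0" for d u
  proof (induction d arbitrary: u)
    case 0
    have "S 0 \<subseteq> {0}" unfolding S_def by (rule span_minimal) (use m0 in \<open>auto simp: subspace_def\<close>)
    then show ?case using 0 by (auto simp: js_def)
  next
    case (Suc d)
    then show ?case using T[of u d] by (simp add: js)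
  qed
  have "\<exists>d. v \<in> S d"
  proof (rule dirsum_induct[OF Vh_dirsum])
    fix x y assume "\<exists>d. x \<in> S d" "\<exists>d. y \<in> S d"
    then obtain d d' where "x \<in> S d" "y \<in> S d'" by auto
    moreover have "S d \<subseteq> S (max d d')" "S d' \<subseteq> S (max d d')"
      unfolding S_def by (rule span_mono; force)+
    ultimately have "x + y \<in> S (max d d')" unfolding S_def by (blast intro: span_add)
    then show "\<exists>d. x + y \<in> S d" ..
  next
    show "\<exists>d. 0 \<in> S d" by (auto simp: S_def span_zero)
  next
    fix i x assume "x \<in> Vh i"
    then have "x \<in> S (nat (i - m0 + 1))" unfolding S_def by (intro span_base) auto
    then show "\<exists>d. x \<in> S d" ..
  qed
  then show ?thesis using ann dist by blast
qed

abbreviation Vb :: "complex \<Rightarrow> 'v set" where "Vb \<equiv> Vbr sc Y vac om c Vh"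

lemma Vb_eq: "Vb = (\<lambda>k. {v. Lb 0 v = sc k v})"
  by (rule ext) (simp add: Vbr_def)

lemma Vb_dirsum: "dirsum sc Vb"
  unfolding Vb_eq by (rule eigenspaces_dirsum[OF L0_lin L0_annihilated])

lemma Vb_comp_invariant:
  assumes "subspace U" "\<And>u. u \<in> U \<Longrightarrow> Lb 0 u \<in> U" "v \<in> U"
  shows "comp sc Vb k v \<in> U"
  unfolding Vb_eq by (rule comp_eigenspace_invariant[OF L0_lin Vb_dirsum[unfolded Vb_eq] assms])

text \<open>\<open>L[0]\<close> mixes weights, but every \<open>om(p)\<close> changes the index m by
  an even number.\<close>

lemma L0_Vpar:
  assumes "v \<in> Vpar sc Vh e"
  shows "Lb 0 v \<in> Vpar sc Vh e"
proof -
  have sub: "subspace {v. Lb 0 v \<in> Vpar sc Vh e}"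
    unfolding Vpar_def by (rule lin_subspace_vimage[OF L0_lin subspace_span])
  have gen: "x \<in> {v. Lb 0 v \<in> Vpar sc Vh e}" if x: "x \<in> (\<Union>m\<in>{m. m mod 2 = e}. Vh m)" for x
  proof -
    obtain m where m: "m mod 2 = e" "x \<in> Vh m" using x by auto
    obtain P where P: "\<And>p. p > int P \<Longrightarrow> Y om p x = 0" using om_bound[of "{x}" 1] by auto
    have "(m + 2 - 2 * int p) mod 2 = e" for p using m(1) by presburger
    then have "(\<Sum>p\<le>P. sc (L0c p) (Y om (int p) x)) \<in> Vpar sc Vh e"
      unfolding Vpar_def by (intro span_sum span_scale span_base) (use om_mode_weight[OF m(2)] in blast)
    moreover have "Lb 0 x = (\<Sum>p\<le>P. sc (L0c p) (Y om (int p) x))"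
      by (rule L0_eq) (use P in auto)
    ultimately show ?thesis by simp
  qed
  have "v \<in> {v. Lb 0 v \<in> Vpar sc Vh e}"
    by (rule span_subspace_induct[OF assms[unfolded Vpar_def] sub gen])
  then show ?thesis by simp
qed

lemma L0_aut:
  assumes "vosa_aut sc Y vac om g"
  shows "g (Lb 0 v) = Lb 0 (g v)"
proof -
  have g: "lin g" "\<And>u n w. g (Y u n w) = Y (g u) n (g w)" "g om = om"
    using assms unfolding vosa_aut_def by auto
  obtain P where P: "\<And>p. p > int P \<Longrightarrow> Y om p v = 0" "\<And>p. p > int P \<Longrightarrow> Y om p (g v) = 0"
    using om_bound[of "{v, g v}" 1] by auto
  have "Lb 0 v = (\<Sum>p\<le>P. sc (L0c p) (Y om (int p) v))" "Lb 0 (g v) = (\<Sum>p\<le>P. sc (L0c p) (Y om (int p) (g v)))"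
    by (rule L0_eq; use P in auto)+
  then show ?thesis
    by (simp add: lin_sum[OF g(1)] lin_scale[OF g(1)] g(2,3))
qed

text \<open>Since om is \<open>om(-1) vac\<close>, these are the Virasoro relations between L(n) and
  L(-2) on the vacuum; the central term for n = 2 is c / 2.\<close>

lemma om_on_om: "Y om 2 om = 0" "Y om 3 om = sc (c / 2) vac" "p > 3 \<Longrightarrow> Y om p om = 0"
proof -
  have V: "Y om (n + 1) om = sc (of_int (n + 2)) (Y om (n - 1) vac) + (if n = 2 then sc ((of_int n ^ 3 - of_int n) / 12 * c) vac else 0)"
    if "n \<ge> 1" for n
    using Virasoro[of n "-2" vac] that Y_on_vac(1)[of om] Y_on_vac(2)[of "n + 1" om] by (auto split: if_splits)
  show "Y om 2 om = 0" using V[of 1] Y_on_vac(2)[of 0 om] by simp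
  show "Y om 3 om = sc (c / 2) vac" using V[of 2] Y_on_vac(2)[of 1 om] by simp
  show "p > 3 \<Longrightarrow> Y om p om = 0" using V[of "p - 1"] Y_on_vac(2)[of "p - 2" om] by simp
qed

text \<open>The reason for the constant c / 24: \<open>om(3) om = (c / 2) vac\<close> enters with
  the coefficient -1/6 of \<open>x^3\<close> in the symbol, which gives -c / 12, twice -c / 24,
  while \<open>L[0]\<close> kills vac. Consequently each \<open>L[n]\<close> shifts the
  \<open>L[0]\<close>-weight by -n.\<close>

lemma L0_conformal: "Lb 0 (om - sc (c / 24) vac) = sc 2 (om - sc (c / 24) vac)"
proof -
  have v: "Lb 0 vac = 0" using L0_eq[of 0 vac] Y_on_vac(2) by simp
  have "Lb 0 om = (\<Sum>p\<le>3. sc (L0c p) (Y om (int p) om))"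
    by (rule L0_eq) (use om_on_om in simp)
  also have "\<dots> = Y om 1 om + sc (L0c 2) (Y om 2 om) + sc (L0c 3) (Y om 3 om)"
    by (simp add: numeral_3_eq_3 numeral_2_eq_2 atMost_Suc add.commute)
  also have "\<dots> = sc 2 om - sc (c / 12) vac"
  proof -
    have "L0c 3 = - (1 / 6)" using L0c_ge_2[of 1] by (simp add: numeral_3_eq_3)
    then show ?thesis using L0_weight[OF om_weight] by (simp add: om_on_om)
  qed
  finally have "Lb 0 (om - sc (c / 24) vac) = sc 2 om - sc (c / 12) vac"
    by (simp add: lin_diff[OF L0_lin] lin_scale[OF L0_lin] v)
  also have "\<dots> = sc 2 (om - sc (c / 24) vac)" by (simp add: scale_right_diff_distrib)
  finally show ?thesis .
qed

lemma Lb_Vb: "w \<in> Vb l \<Longrightarrow> Lb n w \<in> Vb (l - of_int n)"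
  using brmode_weight[OF L0_conformal, of w l "n + 1"] unfolding Vb_eq Lbr_def[of _ _ _ _ _ _ n]
  by (simp add: algebra_simps)

lemma brm_Vb: "v \<in> Vb k \<Longrightarrow> w \<in> Vb l \<Longrightarrow> brm v n w \<in> Vb (k + l - of_int n - 1)"
  using brmode_weight unfolding Vb_eq by simp

end

section \<open>The slash action on 1-point functions\<close>

abbreviation unit_root :: "nat \<Rightarrow> nat \<Rightarrow> complex" where
  "unit_root j M \<equiv> exp (2 * pi * \<i> * of_nat j / of_nat M)"

text \<open>\<open>one_point\<close> parametrizes eigenvalues of the first automorphism by j and M,
  those of the second by arbitrary roots of unity. Mixed products must be brought back into the
  first form.\<close>

lemma root_of_unity_exp:
  assumes "root_of_unity z"
  obtains j M :: nat where "0 < M" "j < M" "z = unit_root j M"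
proof -
  obtain n where n: "n > 0" "z ^ n = 1" using assms by (auto simp: root_of_unity_def)
  then have "z \<in> {exp (2 * of_real pi * \<i> * of_nat j / of_nat n) | j. j < n}"
    using complex_roots_unity[of n] by auto
  then show ?thesis using that[of n] n(1) by auto
qed

lemma root_of_unity_mult:
  assumes "root_of_unity x" "root_of_unity y"
  shows "root_of_unity (x * y)"
proof -
  obtain m n where "m > 0" "x ^ m = 1" "n > 0" "y ^ n = 1" using assms by (auto simp: root_of_unity_def)
  moreover have "(x * y) ^ (m * n) = (x ^ m) ^ n * (y ^ n) ^ m"
    by (simp add: power_mult_distrib power_mult [symmetric] mult.commute)
  ultimately have "m * n > 0" "(x * y) ^ (m * n) = 1" by simp_all
  then show ?thesis unfolding root_of_unity_def by blast
qed

lemma root_of_unity_powi: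
  assumes "root_of_unity x"
  shows "root_of_unity (x powi i)"
proof -
  obtain n where n: "n > 0" "x ^ n = 1" using assms by (auto simp: root_of_unity_def)
  have "(x powi i) ^ n = (x ^ n) powi i"
    by (metis mult.commute power_int_mult power_int_of_nat)
  then show ?thesis using n by (auto simp: root_of_unity_def)
qed

lemma root_of_unity_norm: "root_of_unity x \<Longrightarrow> norm x = 1"
  by (metis norm_power norm_one power_eq_1_iff norm_ge_zero root_of_unity_def neq0_conv)

lemma exp_root_of_unity: "0 < M \<Longrightarrow> root_of_unity (unit_root j M)"
  unfolding root_of_unity_def
  by (rule exI[of _ M]) (auto simp: exp_of_nat_mult [symmetric] exp_eq_1 intro: exI[of _ "int j"])

lemma exp_eq_qpow: "unit_root j M = qpow 1 (real j / real M)"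
  by (simp add: qpow_def)

text \<open>Whatever branch is used for the complex exponent, a natural shift of it is an honest
  power. This allows a common factor to be taken out of all terms of a relation.\<close>

lemma powr_add_of_nat: "z \<noteq> 0 \<Longrightarrow> z powr (x + of_nat n) = z powr x * (z::complex) ^ n"
  by (simp add: powr_add powr_nat')

context vosa_data begin

text \<open>Reduction to \<open>L[0]\<close>-eigenvectors. Invariance of U keeps the components of v
  inside U, where the homogeneous relations are available; w ranges over the whole space.\<close>

lemma bilinear_vanish:
  assumes \<Phi>: "\<And>w. linf (\<lambda>v. \<Phi> v w)" "\<And>v. linf (\<Phi> v)"
    and U: "subspace U" "\<And>u. u \<in> U \<Longrightarrow> Lb 0 u \<in> U" "v \<in> U"
    and hom: "\<And>k l v w. v \<in> U \<Longrightarrow> v \<in> Vb k \<Longrightarrow> w \<in> Vb l \<Longrightarrow> \<Phi> v w = 0"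
  shows "\<Phi> v w = 0"
proof -
  have "\<Phi> (comp sc Vb k v) (comp sc Vb l w) = 0" for k l
    using hom[OF Vb_comp_invariant[OF U] comp_props(1)[OF Vb_dirsum] comp_props(1)[OF Vb_dirsum]] .
  then have "\<Phi> (comp sc Vb k v) (\<Sum>l\<in>A. comp sc Vb l w) = 0" for k A
    unfolding linf_sum[OF \<Phi>(2)] by simp
  then have "\<Phi> (comp sc Vb k v) w = 0" for k
    by (metis comp_sum[OF Vb_dirsum])
  then have "\<Phi> (\<Sum>k\<in>A. comp sc Vb k v) w = 0" for A
    unfolding linf_sum[OF \<Phi>(1)] by simp
  then show ?thesis by (metis comp_sum[OF Vb_dirsum])
qed

text \<open>The lower bound on \<open>e\<close> covers the mode numbers \<open>j - 1\<close>,
  \<open>2 j - 2\<close> and \<open>2 j - 1\<close> of the relations at once.\<close>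

lemma mode_sum_finite:
  assumes "linf T" "\<And>j. e j \<ge> int j - 2"
  shows "finite {j. q j * T (brm v (e j) w) \<noteq> 0}"
proof -
  obtain N where N: "\<forall>n\<ge>N. brm v n w = 0" using brmode_truncation by blast
  have "{j. q j * T (brm v (e j) w) \<noteq> 0} \<subseteq> {..nat (N + 2)}"
  proof (rule subsetI, rule ccontr)
    fix j assume j: "j \<in> {j. q j * T (brm v (e j) w) \<noteq> 0}" "j \<notin> {..nat (N + 2)}"
    then have "e j \<ge> N" using assms(2)[of j] by simp
    then show False using j N linf_0[OF assms(1)] by simp
  qed
  then show ?thesis using finite_subset by blast
qed

lemma linf_comp_brm: "linf T \<Longrightarrow> linf (\<lambda>v. T (brm v n w))" "linf T \<Longrightarrow> linf (\<lambda>w. T (brm v n w))"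
  by (auto simp: linf_iff lin_add[OF brmode_lin_left] lin_scale[OF brmode_lin_left]
      lin_add[OF brmode_lin_right] lin_scale[OF brmode_lin_right])

lemma mode_sum_linear:
  assumes T: "linf T" and e: "\<And>j. e j \<ge> int j - 2"
  shows "linf (\<lambda>v. nzsum (\<lambda>j. q j * T (brm v (e j) w)))" "linf (\<lambda>w. nzsum (\<lambda>j. q j * T (brm v (e j) w)))"
  by (rule nzsum_linf[OF _ mode_sum_finite[OF T e]];
      use linf_comp_brm[OF T] in \<open>simp add: linf_iff ring_distribs mult_ac\<close>)+

lemma linf_plus: "linf f \<Longrightarrow> linf f' \<Longrightarrow> linf (\<lambda>x. f x + f' x)"
  by (auto simp: linf_iff ring_distribs)

end

section \<open>The defining relations for the slashed function\<close>

locale one_point_data = vosa_data sc Y vac om c Vh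
  for sc :: "complex \<Rightarrow> 'v::ab_group_add \<Rightarrow> 'v" and Y vac om c Vh +
  fixes g h :: "'v \<Rightarrow> 'v" and S :: "'v \<Rightarrow> complex \<Rightarrow> complex" and a b cc d :: int
  assumes g: "vosa_aut sc Y vac om g" and h: "vosa_aut sc Y vac om h" and gh: "g \<circ> h = h \<circ> g"
    and S: "one_point sc Y vac om c Vh g h S" and det: "a * d - b * cc = 1"
begin

abbreviation "Sl \<equiv> slash sc Y vac om c Vh S a b cc d"
abbreviation "G \<equiv> zpow g a \<circ> zpow h cc"
abbreviation "H \<equiv> zpow g b \<circ> zpow h d"
abbreviation J :: "complex \<Rightarrow> complex" where "J \<tau> \<equiv> of_int cc * \<tau> + of_int d"
abbreviation \<gamma> :: "complex \<Rightarrow> complex" where "\<gamma> \<tau> \<equiv> moebius a b cc d \<tau>"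

lemmas S_conj = S[unfolded one_point_def, THEN conjunct2]
lemmas S_generators = S_conj[THEN conjunct2]

lemmas S_holomorphic = S[unfolded one_point_def, THEN conjunct1, rule_format]
  and S_linear = S_conj[THEN conjunct1, rule_format]
  and S_zero_modes = S_generators[THEN conjunct1, rule_format, THEN conjunct1]
    S_generators[THEN conjunct1, rule_format, THEN conjunct2]
  and S_twisted_vanish = S_generators[THEN conjunct2, THEN conjunct1, rule_format]
  and S_twisted_modes = S_generators[THEN conjunct2, THEN conjunct2, THEN conjunct1, rule_format]
  and S_Virasoro = S_generators[THEN conjunct2, THEN conjunct2, THEN conjunct2, rule_format]

lemma gamma_upper: "\<tau> \<in> upper \<Longrightarrow> \<gamma> \<tau> \<in> upper"
  using Im_moebius[OF _ det] by (simp add: upper_def)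

lemma J_nonzero: "\<tau> \<in> upper \<Longrightarrow> J \<tau> \<noteq> 0"
  using moebius_denominator_nonzero[OF _ det] by (simp add: upper_def)

lemma open_upper: "open upper"
  unfolding upper_def by (rule open_halfspace_Im_gt)

lemma slash_eq:
  assumes "\<tau> \<in> upper" "finite T" "\<And>k. k \<notin> T \<Longrightarrow> comp sc Vb k v = 0"
  shows "Sl v \<tau> = (\<Sum>k\<in>T. J \<tau> powr (- k) * S (comp sc Vb k v) (\<gamma> \<tau>))"
  unfolding slash_def
  by (rule nzsum_eq_sum) (use assms linf_0[OF S_linear[OF gamma_upper[OF assms(1)]]] in auto)

lemma slash_homogeneous:
  assumes "\<tau> \<in> upper" "v \<in> Vb k"
  shows "Sl v \<tau> = J \<tau> powr (- k) * S v (\<gamma> \<tau>)"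
  using slash_eq[OF assms(1), of "{k}" v] assms(2) by (simp add: comp_same[OF Vb_dirsum] comp_other[OF Vb_dirsum])

lemma slash_linear:
  assumes \<tau>: "\<tau> \<in> upper"
  shows "linf (\<lambda>v. Sl v \<tau>)"
  unfolding slash_def
proof (rule nzsum_linf)
  note lin = comp_linear[OF Vb_dirsum] S_linear[OF gamma_upper[OF \<tau>]]
  show "linf (\<lambda>v. J \<tau> powr (- k) * S (comp sc Vb k v) (\<gamma> \<tau>))" for k
    by (simp add: linf_iff lin_add[OF lin(1)] lin_scale[OF lin(1)] linf_add[OF lin(2)] linf_scale[OF lin(2)] ring_distribs)
  show "finite {k. J \<tau> powr (- k) * S (comp sc Vb k v) (\<gamma> \<tau>) \<noteq> 0}" for v
    by (rule finite_subset[OF _ comp_finite[OF Vb_dirsum, of v]]) (auto simp: linf_0[OF lin(2)])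
qed

lemma slash_term_derivative:
  assumes \<tau>: "\<tau> \<in> upper"
  shows "((\<lambda>t. J t powr (- k) * S v (\<gamma> t)) has_field_derivative
    - k * of_int cc * J \<tau> powr (- k - 1) * S v (\<gamma> \<tau>) + J \<tau> powr (- k) * (deriv (S v) (\<gamma> \<tau>) / (J \<tau>)\<^sup>2)) (at \<tau>)"
proof -
  have J: "J \<tau> \<noteq> 0" by (rule J_nonzero[OF \<tau>])
  \<comment> \<open>For c = 0 the denominator is constant, equal to 1 or -1, and may lie on the
    branch cut. Otherwise its imaginary part is nonzero on the upper half-plane, where the principal
    power is differentiable.\<close>
  have 1: "((\<lambda>t. J t powr (- k)) has_field_derivative (- k * of_int cc * J \<tau> powr (- k - 1))) (at \<tau>)"
  proof (cases "cc = 0")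
    case False
    have "Im (J \<tau>) \<noteq> 0" using False \<tau> by (simp add: upper_def)
    then have nr: "J \<tau> \<notin> \<real>\<^sub>\<le>\<^sub>0" by (auto simp: complex_nonpos_Reals_iff)
    have "((\<lambda>t. J t) has_field_derivative of_int cc) (at \<tau>)"
      by (auto intro!: derivative_eq_intros)
    from DERIV_chain2[OF has_field_derivative_powr[OF nr, of "- k"] this] show ?thesis by (simp add: mult_ac)
  qed simp
  have det': "of_int a * of_int d - of_int b * of_int cc = (1::complex)"
    using arg_cong[OF det, of complex_of_int] by simp
  have 2: "(\<gamma> has_field_derivative (1 / (J \<tau>)\<^sup>2)) (at \<tau>)"
    unfolding moebius_def using J det'
    by (auto intro!: derivative_eq_intros simp: power2_eq_square field_simps)
  have "(S v has_field_derivative deriv (S v) (\<gamma> \<tau>)) (at (\<gamma> \<tau>))"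
    by (rule holomorphic_derivI[OF S_holomorphic open_upper gamma_upper[OF \<tau>]])
  from DERIV_chain2[OF this 2]
  have 3: "((\<lambda>t. S v (\<gamma> t)) has_field_derivative (deriv (S v) (\<gamma> \<tau>) * (1 / (J \<tau>)\<^sup>2))) (at \<tau>)" .
  show ?thesis using DERIV_mult[OF 1 3] by (simp add: mult_ac)
qed

lemma slash_holomorphic: "Sl v holomorphic_on upper"
proof -
  have "(\<lambda>t. J t powr (- k) * S u (\<gamma> t)) holomorphic_on upper" for k u
    unfolding holomorphic_on_open[OF open_upper] using slash_term_derivative by blast
  then have "(\<lambda>t. \<Sum>k\<in>{k. comp sc Vb k v \<noteq> 0}. J t powr (- k) * S (comp sc Vb k v) (\<gamma> t)) holomorphic_on upper"
    by (intro holomorphic_on_sum)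
  then show ?thesis
    by (rule holomorphic_transform) (rule slash_eq[symmetric]; simp add: comp_finite[OF Vb_dirsum])
qed

lemma aut_bij: "lin g" "bij g" "lin h" "bij h"
  using g h by (auto simp: vosa_aut_def)

lemma GH_lin_bij: "lin G" "bij G" "lin H" "bij H"
proof -
  have *: "lin (zpow x i)" "bij (zpow x i)" if "x \<in> {g, h}" for x i
    using lin_zpow[of x i] bij_zpow[of x i] aut_bij that by auto
  show "lin G" "lin H" using *(1) by (auto simp: lin_iff)
  show "bij G" "bij H" using *(2) bij_comp by blast+
qed

lemma recovered_eigenvector:
  assumes "G v = sc (inverse mu) v" "H v = sc (inverse lam) v" "mu \<noteq> 0" "lam \<noteq> 0"
  shows "g v = sc (inverse (mu powi d * lam powi (- cc))) v" "h v = sc (inverse (mu powi (- b) * lam powi a)) v"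
proof -
  have nz: "inverse mu \<noteq> 0" "inverse lam \<noteq> 0" using assms by auto
  have Gi: "zpow G i v = sc (inverse mu powi i) v" for i
    by (rule zpow_eigenvector[OF GH_lin_bij(1,2) assms(1) nz(1)])
  have Hi: "zpow H i v = sc (inverse lam powi i) v" for i
    by (rule zpow_eigenvector[OF GH_lin_bij(3,4) assms(2) nz(2)])
  have Gs: "zpow G i (sc r v) = sc (r * inverse mu powi i) v" for i r
    by (simp add: lin_scale[OF lin_zpow[OF GH_lin_bij(1,2)]] Gi)
  have "g v = zpow G d (zpow H (- cc) v)"
    by (rule zpow_recover(1)[OF aut_bij(2,4) gh det, symmetric])
  then show "g v = sc (inverse (mu powi d * lam powi (- cc))) v"
    by (simp add: Hi Gs power_int_inverse mult.commute)
  have "h v = zpow G (- b) (zpow H a v)"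
    by (rule zpow_recover(2)[OF aut_bij(2,4) gh det, symmetric])
  then show "h v = sc (inverse (mu powi (- b) * lam powi a)) v"
    by (simp add: Hi Gs power_int_inverse mult.commute)
qed

text \<open>The parameters are the eigenvalues themselves, hence the inverses of the multipliers in
  \<open>Qf\<close>. Parity is part of the sector so that it can serve as the invariant subspace in
  \<open>bilinear_vanish\<close>.\<close>

definition twisted_sector :: "int \<Rightarrow> complex \<Rightarrow> complex \<Rightarrow> 'v set" where
  "twisted_sector e \<mu> \<nu> = {v \<in> Vpar sc Vh e. g v = sc \<mu> v \<and> h v = sc \<nu> v}"

lemma twisted_sector_subspace: "subspace (twisted_sector e \<mu> \<nu>)"
  unfolding twisted_sector_def Vpar_def
  by (auto simp: subspace_def span_zero span_add span_scale lin_0[OF aut_bij(1)] lin_0[OF aut_bij(3)]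
      lin_add[OF aut_bij(1)] lin_add[OF aut_bij(3)] lin_scale[OF aut_bij(1)] lin_scale[OF aut_bij(3)]
      scale_right_distrib scale_left_commute mult.commute)

lemma twisted_sector_invariant: "v \<in> twisted_sector e \<mu> \<nu> \<Longrightarrow> Lb 0 v \<in> twisted_sector e \<mu> \<nu>"
  by (auto simp: twisted_sector_def L0_Vpar L0_aut[OF g] L0_aut[OF h] lin_scale[OF L0_lin])

lemma slash_zero_mode:
  assumes e: "e \<in> {0,1}" and v: "v \<in> twisted_sector e 1 1" and \<tau>: "\<tau> \<in> upper"
  shows "Sl (brm v 0 w) \<tau> = 0"
proof (rule bilinear_vanish[where \<Phi> = "\<lambda>v w. Sl (brm v 0 w) \<tau>", OF _ _ twisted_sector_subspace twisted_sector_invariant v])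
  fix k l v w assume v: "v \<in> twisted_sector e 1 1" "v \<in> Vb k" and w: "w \<in> Vb l"
  have "S (brm v 0 w) (\<gamma> \<tau>) = 0"
    by (rule S_zero_modes(1)[OF e _ _ _ gamma_upper[OF \<tau>]]) (use v in \<open>auto simp: twisted_sector_def\<close>)
  then show "Sl (brm v 0 w) \<tau> = 0"
    using slash_homogeneous[OF \<tau> brm_Vb[OF v(2) w]] by simp
qed (rule linf_comp_brm[OF slash_linear[OF \<tau>]])+

text \<open>\<open>v[2 j - 2] w\<close> has weight 2 j less than \<open>v[-2] w\<close>, and the
  Eisenstein series of weight 2 j makes up the difference. Only j \<ge> 2 carries a coefficient, so
  the anomaly does not arise.\<close>

lemma slash_Eisenstein_modes:
  assumes e: "e \<in> {0,1}" and v: "v \<in> twisted_sector e 1 1" and \<tau>: "\<tau> \<in> upper"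
  shows "Sl (brm v (-2) w) \<tau> + nzsum (\<lambda>k::nat. (if k \<ge> 2 then of_nat (2 * k - 1) * Eis k \<tau> else 0) * Sl (brm v (2 * int k - 2) w) \<tau>) = 0"
  (is "?\<Phi> v w = 0")
proof (rule bilinear_vanish[where \<Phi> = ?\<Phi>, OF _ _ twisted_sector_subspace twisted_sector_invariant v])
  fix k l v w assume v: "v \<in> twisted_sector e 1 1" "v \<in> Vb k" and w: "w \<in> Vb l"
  define C where "C = J \<tau> powr (- (k + l + 1))"
  have 0: "S (brm v (-2) w) (\<gamma> \<tau>) + nzsum (\<lambda>k::nat. if k \<ge> 2 then of_nat (2 * k - 1) * Eis k (\<gamma> \<tau>) * S (brm v (2 * int k - 2) w) (\<gamma> \<tau>) else 0) = 0"
    by (rule S_zero_modes(2)[OF e _ _ _ gamma_upper[OF \<tau>]]) (use v in \<open>auto simp: twisted_sector_def\<close>)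
  have 1: "Sl (brm v (-2) w) \<tau> = C * S (brm v (-2) w) (\<gamma> \<tau>)"
    using slash_homogeneous[OF \<tau> brm_Vb[OF v(2) w, of "-2"]] by (simp add: C_def algebra_simps)
  have 2: "(if j \<ge> 2 then of_nat (2 * j - 1) * Eis j \<tau> else 0) * Sl (brm v (2 * int j - 2) w) \<tau>
     = C * (if j \<ge> 2 then of_nat (2 * j - 1) * Eis j (\<gamma> \<tau>) * S (brm v (2 * int j - 2) w) (\<gamma> \<tau>) else 0)" for j :: nat
  proof (cases "j \<ge> 2")
    case True
    have x: "- (k + l - of_int (2 * int j - 2) - 1) = - (k + l + 1) + of_nat (2 * j)" by simp
    have "Sl (brm v (2 * int j - 2) w) \<tau> = C * J \<tau> ^ (2 * j) * S (brm v (2 * int j - 2) w) (\<gamma> \<tau>)"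
      unfolding slash_homogeneous[OF \<tau> brm_Vb[OF v(2) w]] x powr_add_of_nat[OF J_nonzero[OF \<tau>]] C_def ..
    moreover have "Eis j (\<gamma> \<tau>) = J \<tau> ^ (2 * j) * Eis j \<tau>"
      using Eis_modular[OF _ det, of \<tau> j] \<tau> True by (simp add: upper_def)
    ultimately show ?thesis using True by simp
  qed simp
  show "?\<Phi> v w = 0"
    unfolding 1 2 nzsum_mult_left using 0 by (simp add: ring_distribs [symmetric])
qed (rule linf_plus linf_comp_brm mode_sum_linear slash_linear[OF \<tau>] | simp)+

text \<open>Transport of the pair of multipliers from (G, H) to (g, h). As the transformation is
  invertible, a nontrivial pair stays nontrivial, which is the side condition of the twisted
  relations.\<close>

lemma multiplier_root:
  assumes "0 < M" "j < M" "root_of_unity lam"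
  defines "mu \<equiv> unit_root j M"
  obtains j' M' :: nat where "0 < M'" "j' < M'" "mu powi d * lam powi (- cc) = unit_root j' M'"
    "root_of_unity (mu powi (- b) * lam powi a)" "root_of_unity mu"
    "j \<noteq> 0 \<or> lam \<noteq> 1 \<Longrightarrow> j' \<noteq> 0 \<or> mu powi (- b) * lam powi a \<noteq> 1"
proof -
  have mu: "root_of_unity mu" unfolding mu_def by (rule exp_root_of_unity[OF assms(1)])
  have r0: "root_of_unity (mu powi d * lam powi (- cc))" and r: "root_of_unity (mu powi (- b) * lam powi a)"
    by (intro root_of_unity_mult root_of_unity_powi mu assms)+
  obtain j' M' :: nat where jM: "0 < M'" "j' < M'" "mu powi d * lam powi (- cc) = unit_root j' M'"
    by (rule root_of_unity_exp[OF r0])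
  have nz: "mu \<noteq> 0" "lam \<noteq> 0" using root_of_unity_norm[OF mu] root_of_unity_norm[OF assms(3)] by auto
  have "j = 0 \<and> lam = 1" if "j' = 0" "mu powi (- b) * lam powi a = 1"
  proof -
    have "mu powi d * lam powi (- cc) = 1" using jM(3) that(1) by simp
    then have "mu = 1" "lam = 1" using character_inverse[OF nz det] that(2) by simp_all
    then have "qpow 1 (real j / real M) = 1" unfolding mu_def exp_eq_qpow by simp
    then have "real j / real M = 0" by (intro qpow_1_left_eq_1) (use assms in auto)
    then show ?thesis using \<open>lam = 1\<close> assms(1) by simp
  qed
  then show ?thesis using that jM r mu by blast
qed

lemma twisted_sector_recover:
  assumes "v \<in> Vpar sc Vh e" "G v = sc (inverse mu) v" "H v = sc (inverse lam) v" "root_of_unity mu" "root_of_unity lam"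
  shows "v \<in> twisted_sector e (inverse (mu powi d * lam powi (- cc))) (inverse (mu powi (- b) * lam powi a))"
proof -
  have "mu \<noteq> 0" "lam \<noteq> 0" using root_of_unity_norm[OF assms(4)] root_of_unity_norm[OF assms(5)] by auto
  then show ?thesis using recovered_eigenvector[OF assms(2,3)] assms(1) by (simp add: twisted_sector_def)
qed

lemma slash_twisted_vanish:
  assumes e: "e \<in> {0,1}" and v: "v \<in> Vpar sc Vh e" and jM: "0 < M" "j < M" and lam: "root_of_unity lam"
    and Gv: "G v = sc (inverse (unit_root j M)) v" and Hv: "H v = sc (inverse lam) v"
    and nt: "e \<noteq> 0 \<or> j \<noteq> 0 \<or> lam \<noteq> 1" and \<tau>: "\<tau> \<in> upper"
  shows "Sl v \<tau> = 0"
proof -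
  define mu where "mu = unit_root j M"
  obtain j' M' :: nat where jM': "0 < M'" "j' < M'" "mu powi d * lam powi (- cc) = unit_root j' M'"
    "root_of_unity (mu powi (- b) * lam powi a)" "root_of_unity mu"
    "j \<noteq> 0 \<or> lam \<noteq> 1 \<Longrightarrow> j' \<noteq> 0 \<or> mu powi (- b) * lam powi a \<noteq> 1"
    using multiplier_root[OF jM lam] unfolding mu_def by blast
  define U where "U = twisted_sector e (inverse (mu powi d * lam powi (- cc))) (inverse (mu powi (- b) * lam powi a))"
  have vU: "v \<in> U" unfolding U_def by (rule twisted_sector_recover[OF v Gv[folded mu_def] Hv jM'(5) lam])
  have "S (comp sc Vb k v) (\<gamma> \<tau>) = 0" for k
  proof -
    have "comp sc Vb k v \<in> U"
      by (rule Vb_comp_invariant[OF _ _ vU]) (auto simp: U_def twisted_sector_subspace twisted_sector_invariant)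
    then show ?thesis
      by (intro S_twisted_vanish[OF e _ jM'(1,2,4) _ _ _ gamma_upper[OF \<tau>]])
         (use nt jM'(3,6) in \<open>auto simp: U_def twisted_sector_def\<close>)
  qed
  then show ?thesis unfolding slash_def by simp
qed

text \<open>\<open>v[i - 1] w\<close> has weight k + l - i and \<open>Q_i\<close> has weight i, so
  the relation at \<open>\<gamma> \<tau>\<close> is a common factor times the one at \<tau>.
  Nontrivial multipliers remove both correction terms of \<open>Qf_modular\<close>.\<close>

lemma slash_twisted_modes:
  assumes e: "e \<in> {0,1}" and v: "v \<in> Vpar sc Vh e" and jM: "0 < M" "j < M" and lam: "root_of_unity lam"
    and Gv: "G v = sc (inverse (unit_root j M)) v" and Hv: "H v = sc (inverse lam) v"
    and nt: "j \<noteq> 0 \<or> lam \<noteq> 1" and \<tau>: "\<tau> \<in> upper"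
  shows "nzsum (\<lambda>k::nat. Qf k (real j / real M) lam \<tau> * Sl (brm v (int k - 1) w) \<tau>) = 0"
    (is "?\<Phi> v w = 0")
proof -
  define mu where "mu = unit_root j M"
  define lam' where "lam' = mu powi (- b) * lam powi a"
  obtain j' M' :: nat where jM': "0 < M'" "j' < M'" "mu powi d * lam powi (- cc) = unit_root j' M'"
    "root_of_unity lam'" "root_of_unity mu" "j \<noteq> 0 \<or> lam \<noteq> 1 \<Longrightarrow> j' \<noteq> 0 \<or> lam' \<noteq> 1"
    using multiplier_root[OF jM lam] unfolding mu_def lam'_def by blast
  have q1: "qpow 1 (real j / real M) = mu" unfolding mu_def exp_eq_qpow ..
  have q2: "qpow 1 (real j' / real M') = qpow 1 (real j / real M) powi d * lam powi (- cc)"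
    using jM'(3) unfolding mu_def exp_eq_qpow by (rule sym)
  have r: "0 \<le> real j / real M" "real j / real M < 1" "0 \<le> real j' / real M'" "real j' / real M' < 1"
    using jM jM' by auto
  obtain K where K: "\<And>k. Qf k (real j' / real M') lam' (\<gamma> \<tau>) = J \<tau> ^ k * Qf k (real j / real M) lam \<tau>
      + (if k = 1 then K else 0)
      - (if k = 2 then kernel_defect (real j / real M) lam * of_int cc * J \<tau> / (2 * pi * \<i>) else 0)"
    "real j / real M \<noteq> 0 \<or> lam \<noteq> 1 \<Longrightarrow> K = 0"
    by (rule Qf_modular[OF _ det root_of_unity_norm[OF lam] root_of_unity_norm[OF jM'(4)] r q2])
       (use \<tau> in \<open>auto simp: upper_def lam'_def q1\<close>)
  have nt': "real j / real M \<noteq> 0 \<or> lam \<noteq> 1" using nt jM by auto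
  then have "kernel_defect (real j / real M) lam = 0" by (auto simp: kernel_defect_def)
  then have Q: "Qf k (real j' / real M') lam' (\<gamma> \<tau>) = J \<tau> ^ k * Qf k (real j / real M) lam \<tau>" for k
    using K(1)[of k] K(2)[OF nt'] by simp
  have vU: "v \<in> twisted_sector e (inverse (mu powi d * lam powi (- cc))) (inverse lam')"
    unfolding lam'_def by (rule twisted_sector_recover[OF v Gv[folded mu_def] Hv jM'(5) lam])
  show ?thesis
  proof (rule bilinear_vanish[where \<Phi> = ?\<Phi>, OF _ _ twisted_sector_subspace twisted_sector_invariant vU])
    fix k l v w assume v: "v \<in> twisted_sector e (inverse (mu powi d * lam powi (- cc))) (inverse lam')" "v \<in> Vb k" and w: "w \<in> Vb l"
    define C where "C = J \<tau> powr (- (k + l))"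
    have 0: "nzsum (\<lambda>k::nat. Qf k (real j' / real M') lam' (\<gamma> \<tau>) * S (brm v (int k - 1) w) (\<gamma> \<tau>)) = 0"
      by (rule S_twisted_modes[OF e _ jM'(1,2,4) _ _ jM'(6)[OF nt] gamma_upper[OF \<tau>]])
         (use v jM'(3) in \<open>auto simp: twisted_sector_def\<close>)
    have 1: "Qf i (real j / real M) lam \<tau> * Sl (brm v (int i - 1) w) \<tau>
       = C * (Qf i (real j' / real M') lam' (\<gamma> \<tau>) * S (brm v (int i - 1) w) (\<gamma> \<tau>))" for i :: nat
    proof -
      have x: "- (k + l - of_int (int i - 1) - 1) = - (k + l) + of_nat i" by simp
      have "Sl (brm v (int i - 1) w) \<tau> = C * J \<tau> ^ i * S (brm v (int i - 1) w) (\<gamma> \<tau>)"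
        unfolding slash_homogeneous[OF \<tau> brm_Vb[OF v(2) w]] x powr_add_of_nat[OF J_nonzero[OF \<tau>]] C_def ..
      then show ?thesis unfolding Q by simp
    qed
    show "?\<Phi> v w = 0"
      unfolding 1 nzsum_mult_left 0 by simp
  qed (rule mode_sum_linear slash_linear[OF \<tau>] | simp)+
qed

lemma partialS_homogeneous:
  assumes x: "x \<in> Vb k" and \<tau>: "\<tau> \<in> upper"
  shows "partialS sc Y vac om c Vh S x \<tau> = deriv (S x) \<tau> / (2 * pi * \<i>) + k * Eis 1 \<tau> * S x \<tau>"
proof -
  have S0: "S 0 t = 0" if "t \<in> upper" for t using linf_0[OF S_linear[OF that]] .
  \<comment> \<open>Linearity determines \<open>S 0\<close> on the upper half-plane only, so its
    derivative is computed on that open set.\<close>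
  have "(S 0 has_field_derivative 0) (at \<tau>)"
    by (rule has_field_derivative_transform_within_open[OF _ open_upper \<tau>, of "\<lambda>_. 0"]) (auto simp: S0)
  then have d0: "deriv (S 0) \<tau> = 0" by (rule DERIV_imp_deriv)
  have "partialS sc Y vac om c Vh S x \<tau> = (let vk = comp sc Vb k x in deriv (S vk) \<tau> / (2 * pi * \<i>) + k * Eis 1 \<tau> * S vk \<tau>)"
    unfolding partialS_def
    by (rule nzsum_single) (simp add: comp_other[OF Vb_dirsum x] d0 S0[OF \<tau>])
  then show ?thesis by (simp add: comp_same[OF Vb_dirsum x])
qed

text \<open>Everything is measured against the factor for the weight k + 2 of
  \<open>L[-2] x\<close>. Differentiating the power of weight k yields
  \<open>-k c J / (2 \<pi> i)\<close> times the value of S, which is k times the anomaly of the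
  second Eisenstein series.\<close>

lemma slash_Virasoro_homogeneous:
  assumes x: "x \<in> twisted_sector 0 1 1" "x \<in> Vb k" and \<tau>: "\<tau> \<in> upper"
  shows "Sl (Lb (-2) x) \<tau> = deriv (Sl x) \<tau> / (2 * pi * \<i>) + k * Eis 1 \<tau> * Sl x \<tau>
     + nzsum (\<lambda>l::nat. (if l \<ge> 2 then Eis l \<tau> else 0) * Sl (Lb (2 * int l - 2) x) \<tau>)"
proof -
  define A where "A = J \<tau> powr (- (k + 2))"
  have J: "J \<tau> \<noteq> 0" by (rule J_nonzero[OF \<tau>])
  define N where "N = nzsum (\<lambda>l::nat. if l \<ge> 2 then Eis l (\<gamma> \<tau>) * S (Lb (2 * int l - 2) x) (\<gamma> \<tau>) else 0)"
  have SV: "S (Lb (-2) x) (\<gamma> \<tau>) = deriv (S x) (\<gamma> \<tau>) / (2 * pi * \<i>) + k * Eis 1 (\<gamma> \<tau>) * S x (\<gamma> \<tau>) + N"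
    unfolding N_def partialS_homogeneous[OF x(2) gamma_upper[OF \<tau>], symmetric]
    by (rule S_Virasoro[OF _ _ _ gamma_upper[OF \<tau>]]) (use x in \<open>auto simp: twisted_sector_def\<close>)
  have E2: "Eis 1 (\<gamma> \<tau>) = J \<tau> ^ 2 * Eis 1 \<tau> - of_int cc * J \<tau> / (2 * pi * \<i>)"
    using Eis_modular[OF _ det, of \<tau> 1] \<tau> by (simp add: upper_def)
  have L: "Sl (Lb (-2) x) \<tau> = A * S (Lb (-2) x) (\<gamma> \<tau>)"
    using slash_homogeneous[OF \<tau> Lb_Vb[OF x(2), of "-2"]] by (simp add: A_def)
  have p0: "J \<tau> powr (- k) = A * J \<tau> ^ 2"
    unfolding A_def powr_add_of_nat[OF J, symmetric] by simp
  have p1: "J \<tau> powr (- k - 1) = A * J \<tau>"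
  proof -
    have "- (k + 2) + of_nat 1 = - k - 1" by simp
    then show ?thesis using powr_add_of_nat[OF J, of "- (k + 2)" 1] unfolding A_def by (simp only: power_one_right)
  qed
  have x0: "Sl x \<tau> = A * J \<tau> ^ 2 * S x (\<gamma> \<tau>)"
    unfolding slash_homogeneous[OF \<tau> x(2)] p0 ..
  have "(Sl x has_field_derivative
    - k * of_int cc * J \<tau> powr (- k - 1) * S x (\<gamma> \<tau>) + J \<tau> powr (- k) * (deriv (S x) (\<gamma> \<tau>) / (J \<tau>)\<^sup>2)) (at \<tau>)"
    by (rule has_field_derivative_transform_within_open[OF slash_term_derivative[OF \<tau>] open_upper \<tau>])
       (simp add: slash_homogeneous[OF _ x(2)])
  then have D: "deriv (Sl x) \<tau> = - k * of_int cc * (A * J \<tau>) * S x (\<gamma> \<tau>) + A * deriv (S x) (\<gamma> \<tau>)"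
    unfolding p0 p1 using J by (auto dest!: DERIV_imp_deriv)
  have 2: "(if l \<ge> 2 then Eis l \<tau> else 0) * Sl (Lb (2 * int l - 2) x) \<tau>
     = A * (if l \<ge> 2 then Eis l (\<gamma> \<tau>) * S (Lb (2 * int l - 2) x) (\<gamma> \<tau>) else 0)" for l :: nat
  proof (cases "l \<ge> 2")
    case True
    have e: "- (k - of_int (2 * int l - 2)) = - (k + 2) + of_nat (2 * l)" by simp
    have "Sl (Lb (2 * int l - 2) x) \<tau> = A * J \<tau> ^ (2 * l) * S (Lb (2 * int l - 2) x) (\<gamma> \<tau>)"
      unfolding slash_homogeneous[OF \<tau> Lb_Vb[OF x(2)]] e powr_add_of_nat[OF J] A_def ..
    moreover have "Eis l (\<gamma> \<tau>) = J \<tau> ^ (2 * l) * Eis l \<tau>"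
      using Eis_modular[OF _ det, of \<tau> l] \<tau> True by (simp add: upper_def)
    ultimately show ?thesis using True by simp
  qed simp
  show ?thesis
    unfolding L SV E2 x0 D 2 nzsum_mult_left N_def [symmetric]
    by (simp add: field_simps)
qed

text \<open>\<open>partialS\<close> is defined componentwise because its E_2 term depends on the
  weight. The remaining terms are linear in v, so the homogeneous identities can be added
  up.\<close>

lemma slash_Virasoro:
  assumes v: "v \<in> twisted_sector 0 1 1" and \<tau>: "\<tau> \<in> upper"
  shows "Sl (Lb (-2) v) \<tau> = partialS sc Y vac om c Vh Sl v \<tau>
     + nzsum (\<lambda>l::nat. (if l \<ge> 2 then Eis l \<tau> else 0) * Sl (Lb (2 * int l - 2) v) \<tau>)"
proof -
  define T where "T = {k. comp sc Vb k v \<noteq> 0}"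
  have T: "finite T" using comp_finite[OF Vb_dirsum] by (simp add: T_def)
  have vT: "v = (\<Sum>k\<in>T. comp sc Vb k v)" unfolding T_def by (rule comp_sum[OF Vb_dirsum])
  have hom: "comp sc Vb k v \<in> twisted_sector 0 1 1" "comp sc Vb k v \<in> Vb k" for k
    using Vb_comp_invariant[OF twisted_sector_subspace twisted_sector_invariant v] comp_props(1)[OF Vb_dirsum] by auto
  define \<Psi> where "\<Psi> u = nzsum (\<lambda>l::nat. (if l \<ge> 2 then Eis l \<tau> else 0) * Sl (Lb (2 * int l - 2) u) \<tau>)" for u
  have \<Psi>: "linf \<Psi>" unfolding \<Psi>_def Lbr_def
    by (rule mode_sum_linear(2)[OF slash_linear[OF \<tau>]]) simp
  have lin2: "linf (\<lambda>u. Sl (Lb (-2) u) \<tau>)"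
    unfolding Lbr_def by (rule linf_comp_brm(2)[OF slash_linear[OF \<tau>]])
  define D where "D k = deriv (Sl (comp sc Vb k v)) \<tau> / (2 * pi * \<i>) + k * Eis 1 \<tau> * Sl (comp sc Vb k v) \<tau>" for k
  have S0: "Sl 0 t = 0" if "t \<in> upper" for t using linf_0[OF slash_linear[OF that]] .
  have "(Sl 0 has_field_derivative 0) (at \<tau>)"
    by (rule has_field_derivative_transform_within_open[OF _ open_upper \<tau>, of "\<lambda>_. 0"]) (auto simp: S0)
  then have d0: "deriv (Sl 0) \<tau> = 0" by (rule DERIV_imp_deriv)
  have pS: "partialS sc Y vac om c Vh Sl v \<tau> = (\<Sum>k\<in>T. D k)"
    unfolding partialS_def Let_def D_def
    by (rule nzsum_eq_sum[OF T]) (simp add: T_def d0 S0[OF \<tau>])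
  have "Sl (Lb (-2) v) \<tau> = (\<Sum>k\<in>T. Sl (Lb (-2) (comp sc Vb k v)) \<tau>)"
    using linf_sum[OF lin2, of "\<lambda>k. comp sc Vb k v" T] vT by simp
  also have "\<dots> = (\<Sum>k\<in>T. D k + \<Psi> (comp sc Vb k v))"
    unfolding D_def \<Psi>_def by (intro sum.cong refl slash_Virasoro_homogeneous[OF hom \<tau>])
  also have "\<dots> = (\<Sum>k\<in>T. D k) + \<Psi> v"
    using linf_sum[OF \<Psi>, of "\<lambda>k. comp sc Vb k v" T] vT by (simp add: sum.distrib)
  finally show ?thesis unfolding pS \<Psi>_def .
qed

theorem slash_one_point: "one_point sc Y vac om c Vh G H Sl"
proof -
  \<comment> \<open>Vectors fixed by G and H belong to the trivial pair of multipliers, which the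
    inverse of \<gamma> leaves trivial.\<close>
  have sector: "v \<in> twisted_sector e 1 1" if "v \<in> Vpar sc Vh e" "G v = v" "H v = v" for v e
    using twisted_sector_recover[of v e 1 1] that by (simp add: root_of_unity_def exI[of _ 1])
  show ?thesis
    unfolding one_point_def
  proof (intro conjI allI impI ballI, goal_cases)
    case (4 e v w \<tau>)
    \<comment> \<open>The condition k \<ge> 2 is moved from the whole term into its coefficient, the
      shape in which linearity of the mode sums was used.\<close>
    have "(\<lambda>k::nat. if k \<ge> 2 then of_nat (2 * k - 1) * Eis k \<tau> * Sl (brm v (2 * int k - 2) w) \<tau> else 0)
      = (\<lambda>k. (if k \<ge> 2 then of_nat (2 * k - 1) * Eis k \<tau> else 0) * Sl (brm v (2 * int k - 2) w) \<tau>)" by auto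
    then show ?case using slash_Eisenstein_modes[OF 4(1) sector[OF 4(2-4)] 4(5)] by (simp only:)
  next
    case (7 v \<tau>)
    have "(\<lambda>l::nat. if l \<ge> 2 then Eis l \<tau> * Sl (Lb (2 * int l - 2) v) \<tau> else 0)
      = (\<lambda>l. (if l \<ge> 2 then Eis l \<tau> else 0) * Sl (Lb (2 * int l - 2) v) \<tau>)" by auto
    then show ?case using slash_Virasoro[OF sector[OF 7(1-3)] 7(4)] by (simp only:)
  qed (rule slash_holomorphic slash_linear slash_zero_mode slash_twisted_vanish slash_twisted_modes sector; assumption?)+
qed

end

theorem theorem5p4:
  fixes sc :: "complex \<Rightarrow> 'v::ab_group_add \<Rightarrow> 'v"
    and Y :: "'v \<Rightarrow> int \<Rightarrow> 'v \<Rightarrow> 'v"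
    and vac om :: 'v and c :: complex and Vh :: "int \<Rightarrow> 'v set"
    and g h :: "'v \<Rightarrow> 'v" and S :: "'v \<Rightarrow> complex \<Rightarrow> complex"
    and a b cc d :: int
  assumes "vosa sc Y vac om c Vh"
    and "vosa_aut sc Y vac om g" and "finite_order g"
    and "vosa_aut sc Y vac om h" and "finite_order h"
    and "g \<circ> h = h \<circ> g"
    and "one_point sc Y vac om c Vh g h S"
    and "a * d - b * cc = 1"
  shows "one_point sc Y vac om c Vh (zpow g a \<circ> zpow h cc) (zpow g b \<circ> zpow h d)
           (slash sc Y vac om c Vh S a b cc d)"
proof -
  interpret one_point_data sc Y vac om c Vh g h S a b cc d
    using assms by unfold_locales
  show ?thesis by (rule slash_one_point)
qed

end
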